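(* Let $T$ be a forward expansive correspondence on a compact metric space $X$ and let $\mathcal{E}:\mathcal{M}(\Gamma_T)\to\mathbb{R}$ be continuous. Each of the following conditions implies that $(T,\mathcal{E})$ has an abundance of ergodic path measures: (i) the ergodic measures of $(\Omega_T,\sigma)$ are entropy dense; (ii) the energy $\mathcal{E}$ is convex on $\mathcal{M}(\Gamma_T)$.
   Context: For a compact metric space $Y$, $\mathcal{M}(Y)$ is the set of Borel probability measures on $Y$ with the weak-star topology. For $S:Y\to Y$ continuous, $\mathcal{M}(Y,S)$ is the set of $S$-invariant elements of $\mathcal{M}(Y)$ and $h_\nu(S)$ is Kolmogorov--Sinai entropy. Let $(X,d)$ be a compact metric space. A correspondence $T$ on $X$ assigns to each $x\in X$ a nonempty closed set $T(x)\subset X$ such that $\Gamma_T=\{(x,y)\in X^2:y\in T(x)\}$ is closed in $X^2$. The orbit space is $\Omega_T=\{(x_j)_{j\ge0}:x_{j+1}\in T(x_j)\ \forall j\ge 0\}$ with the product topology, shift $\sigma((x_j)_{j\geq 0})=(x_{j+1})_{j\geq 0}$, and projection $p_2:\Omega_T\to\Gamma_T$, $p_2((x_j)_{j\geq 0})=(x_0,x_1)$. $T$ is forward expansive if there is $\varepsilon_0>0$ such that any two distinct $\boldsymbol{x},\boldsymbol{y}\in\Omega_T$ satisfy $d(x_j,y_j)>\varepsilon_0$ for some $j\ge0$. Put $\widehat{\mathcal{E}}(\nu)=\mathcal{E}((p_2)_*\nu)$ for $\nu\in\mathcal{M}(\Omega_T)$. $(T,\mathcal{E})$ has an abundance of ergodic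 path measures if for every $\nu\in\mathcal{M}(\Omega_T,\sigma)$ and $\eta>0$ there is an ergodic $\rho\in\mathcal{M}(\Omega_T,\sigma)$ with $h_\rho(\sigma)+\widehat{\mathcal{E}}(\rho)>h_\nu(\sigma)+\widehat{\mathcal{E}}(\nu)-\eta$. The ergodic measures of $(\Omega_T,\sigma)$ are entropy dense if for every $\nu\in\mathcal{M}(\Omega_T,\sigma)$, every weak-star neighborhood $\mathcal{U}$ of $\nu$ and every $\eta>0$ there is an ergodic $\rho\in\mathcal{U}\cap\mathcal{M}(\Omega_T,\sigma)$ with $h_\rho(\sigma)>h_\nu(\sigma)-\eta$. *)

theory Defs
  imports "HOL-Probability.Probability"
begin

section \<open>Borel probability measures and the weak-star topology\<close>

text \<open>Spaces are subsets \<open>Y\<close> of a metric type. The type \<open>nat \<Rightarrow> 'a\<close> carries the product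
  topology and \<open>restrict_space borel Y\<close> is the Borel sigma-algebra of the subspace \<open>Y\<close>.\<close>

definition prob_measures :: "'b::metric_space set \<Rightarrow> 'b measure set" where
  "prob_measures Y = {\<nu>. prob_space \<nu> \<and> sets \<nu> = sets (restrict_space borel Y)}"

definition weak_star :: "'b::metric_space set \<Rightarrow> 'b measure topology" where
  "weak_star Y = topology_generated_by
     {{\<nu> \<in> prob_measures Y. (\<integral>x. f x \<partial>\<nu>) \<in> U} |f U.
        continuous_on Y (f :: 'b \<Rightarrow> real) \<and> open U}"

definition invariant_measures ::
    "'b::metric_space set \<Rightarrow> ('b \<Rightarrow> 'b) \<Rightarrow> 'b measure set" where
  "invariant_measures Y S =
     {\<nu> \<in> prob_measures Y. distr \<nu> (restrict_space borel Y) S = \<nu>}"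

definition ergodic_measures ::
    "'b::metric_space set \<Rightarrow> ('b \<Rightarrow> 'b) \<Rightarrow> 'b measure set" where
  "ergodic_measures Y S =
     {\<nu> \<in> invariant_measures Y S.
        \<forall>A\<in>sets \<nu>. S -` A \<inter> Y = A \<longrightarrow> measure \<nu> A = 0 \<or> measure \<nu> A = 1}"

definition mix_measure :: "real \<Rightarrow> 'b measure \<Rightarrow> 'b measure \<Rightarrow> 'b measure" where
  "mix_measure t \<mu> \<nu> = measure_of (space \<mu>) (sets \<mu>)
     (\<lambda>A. ennreal (1 - t) * emeasure \<mu> A + ennreal t * emeasure \<nu> A)"

definition convex_on_measures ::
    "'b::metric_space set \<Rightarrow> ('b measure \<Rightarrow> real) \<Rightarrow> bool" where
  "convex_on_measures Y E \<longleftrightarrow>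
     (\<forall>\<mu>\<in>prob_measures Y. \<forall>\<nu>\<in>prob_measures Y. \<forall>t\<in>{0..1}.
        E (mix_measure t \<mu> \<nu>) \<le> (1 - t) * E \<mu> + t * E \<nu>)"

lemma topspace_weak_star: "topspace (weak_star Y) = prob_measures Y"
proof -
  have "prob_measures Y \<in> {{\<nu> \<in> prob_measures Y. (\<integral>x. f x \<partial>\<nu>) \<in> U} |f U.
        continuous_on Y (f :: 'a \<Rightarrow> real) \<and> open U}"
    by (rule CollectI, rule exI[of _ "\<lambda>_. 0"], rule exI[of _ UNIV]) auto
  then show ?thesis
    unfolding weak_star_def topology_generated_by_topspace by auto
qed

lemma space_prob_measures: "\<nu> \<in> prob_measures Y \<Longrightarrow> space \<nu> = Y"
  unfolding prob_measures_def by (auto dest: sets_eq_imp_space_eq simp: space_restrict_space)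

lemma sets_mix_measure [simp]: "sets (mix_measure t \<mu> \<nu>) = sets \<mu>"
  and space_mix_measure [simp]: "space (mix_measure t \<mu> \<nu>) = space \<mu>"
  unfolding mix_measure_def by (auto simp: sets.space_closed)

lemma emeasure_mix_measure:
  assumes "sets \<nu> = sets \<mu>" and "A \<in> sets \<mu>"
  shows "emeasure (mix_measure t \<mu> \<nu>) A = ennreal (1 - t) * emeasure \<mu> A + ennreal t * emeasure \<nu> A"
proof (rule emeasure_measure_of[OF mix_measure_def])
  show "sets \<mu> \<subseteq> Pow (space \<mu>)" by (rule sets.space_closed)
  show "positive (sets (mix_measure t \<mu> \<nu>))
          (\<lambda>A. ennreal (1 - t) * emeasure \<mu> A + ennreal t * emeasure \<nu> A)"
    by (simp add: positive_def)
  show "countably_additive (sets (mix_measure t \<mu> \<nu>))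
          (\<lambda>A. ennreal (1 - t) * emeasure \<mu> A + ennreal t * emeasure \<nu> A)"
    unfolding countably_additive_def
    using assms(1)
    by (auto simp: suminf_add[symmetric] summableI ennreal_suminf_cmult suminf_emeasure)
qed (use assms in simp)

lemma mix_measure_in_prob_measures:
  assumes "\<mu> \<in> prob_measures Y" "\<nu> \<in> prob_measures Y" "t \<in> {0..1}"
  shows "mix_measure t \<mu> \<nu> \<in> prob_measures Y"
proof -
  have [simp]: "space \<mu> = Y" "space \<nu> = Y" using assms space_prob_measures by auto
  have s: "sets \<nu> = sets \<mu>" using assms by (simp add: prob_measures_def)
  have 1: "emeasure \<mu> Y = 1" "emeasure \<nu> Y = 1"
    using assms prob_space.emeasure_space_1[of \<mu>] prob_space.emeasure_space_1[of \<nu>]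
    by (auto simp: prob_measures_def)
  have "Y \<in> sets \<mu>" using sets.top[of \<mu>] by simp
  then have "emeasure (mix_measure t \<mu> \<nu>) Y = ennreal (1 - t) + ennreal t"
    by (simp add: emeasure_mix_measure[OF s] 1)
  also have "\<dots> = 1" using assms(3) by (simp flip: ennreal_plus)
  finally have "prob_space (mix_measure t \<mu> \<nu>)" by (intro prob_spaceI) simp
  then show ?thesis using assms(1) by (simp add: prob_measures_def)
qed

section \<open>Kolmogorov--Sinai entropy\<close>

definition partition_entropy :: "'b measure \<Rightarrow> 'b set set \<Rightarrow> real" where
  "partition_entropy \<nu> P = - (\<Sum>A\<in>P. measure \<nu> A * ln (measure \<nu> A))"

text \<open>The join of \<open>P\<close>, \<open>S\<^sup>-\<^sup>1 P\<close>, ..., \<open>S\<^bsup>-(n-1)\<^esup> P\<close>, without its empty members.\<close>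

definition iterated_refinement ::
    "'b set \<Rightarrow> ('b \<Rightarrow> 'b) \<Rightarrow> 'b set set \<Rightarrow> nat \<Rightarrow> 'b set set" where
  "iterated_refinement Y S P n =
     common_refinement ((\<lambda>i. (\<lambda>A. (S ^^ i) -` A \<inter> Y) ` P - {{}}) ` {..<n})"

text \<open>For invariant \<open>\<nu>\<close> the limit exists by subadditivity. The term for \<open>n = 0\<close> is irrelevant.\<close>

definition entropy_wrt_partition :: "'b measure \<Rightarrow> ('b \<Rightarrow> 'b) \<Rightarrow> 'b set set \<Rightarrow> real" where
  "entropy_wrt_partition \<nu> S P =
     lim (\<lambda>n. partition_entropy \<nu> (iterated_refinement (space \<nu>) S P n) / real n)"

definition KS_entropy :: "'b measure \<Rightarrow> ('b \<Rightarrow> 'b) \<Rightarrow> ereal" where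
  "KS_entropy \<nu> S =
     (SUP P \<in> {P. finite P \<and> P \<subseteq> sets \<nu> \<and> partition_on (space \<nu>) P}.
        ereal (entropy_wrt_partition \<nu> S P))"

section \<open>Correspondences\<close>

definition graph_of :: "'a set \<Rightarrow> ('a \<Rightarrow> 'a set) \<Rightarrow> ('a \<times> 'a) set" where
  "graph_of X T = {(x, y). x \<in> X \<and> y \<in> X \<and> y \<in> T x}"

definition correspondence :: "'a::metric_space set \<Rightarrow> ('a \<Rightarrow> 'a set) \<Rightarrow> bool" where
  "correspondence X T \<longleftrightarrow>
     (\<forall>x\<in>X. T x \<noteq> {} \<and> closedin (top_of_set X) (T x)) \<and>
     closedin (top_of_set (X \<times> X)) (graph_of X T)"

definition orbit_space :: "'a set \<Rightarrow> ('a \<Rightarrow> 'a set) \<Rightarrow> (nat \<Rightarrow> 'a) set" where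
  "orbit_space X T = {x. (\<forall>j. x j \<in> X) \<and> (\<forall>j. x (Suc j) \<in> T (x j))}"

definition orbit_shift :: "(nat \<Rightarrow> 'a) \<Rightarrow> nat \<Rightarrow> 'a" where
  "orbit_shift x = (\<lambda>j. x (Suc j))"

definition proj2 :: "(nat \<Rightarrow> 'a) \<Rightarrow> 'a \<times> 'a" where
  "proj2 x = (x 0, x 1)"

definition forward_expansive :: "'a::metric_space set \<Rightarrow> ('a \<Rightarrow> 'a set) \<Rightarrow> bool" where
  "forward_expansive X T \<longleftrightarrow>
     (\<exists>\<epsilon>>0. \<forall>x\<in>orbit_space X T. \<forall>y\<in>orbit_space X T.
        x \<noteq> y \<longrightarrow> (\<exists>j. dist (x j) (y j) > \<epsilon>))"

definition path_energy ::
    "'a::metric_space set \<Rightarrow> ('a \<Rightarrow> 'a set) \<Rightarrow> (('a \<times> 'a) measure \<Rightarrow> real) \<Rightarrow>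
     (nat \<Rightarrow> 'a) measure \<Rightarrow> real" where
  "path_energy X T E \<nu> = E (distr \<nu> (restrict_space borel (graph_of X T)) proj2)"

definition abundance_of_ergodic_path_measures ::
    "'a::metric_space set \<Rightarrow> ('a \<Rightarrow> 'a set) \<Rightarrow> (('a \<times> 'a) measure \<Rightarrow> real) \<Rightarrow> bool" where
  "abundance_of_ergodic_path_measures X T E \<longleftrightarrow>
     (\<forall>\<nu>\<in>invariant_measures (orbit_space X T) orbit_shift. \<forall>\<eta>>0.
        \<exists>\<rho>\<in>ergodic_measures (orbit_space X T) orbit_shift.
          KS_entropy \<rho> orbit_shift + ereal (path_energy X T E \<rho>)
            > KS_entropy \<nu> orbit_shift + ereal (path_energy X T E \<nu>) - ereal \<eta>)"

definition entropy_dense :: "'b::metric_space set \<Rightarrow> ('b \<Rightarrow> 'b) \<Rightarrow> bool" where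
  "entropy_dense Y S \<longleftrightarrow>
     (\<forall>\<nu>\<in>invariant_measures Y S. \<forall>U. openin (weak_star Y) U \<and> \<nu> \<in> U \<longrightarrow>
        (\<forall>\<eta>>0. \<exists>\<rho>\<in>ergodic_measures Y S. \<rho> \<in> U \<and>
           KS_entropy \<rho> S > KS_entropy \<nu> S - ereal \<eta>))"

lemma orbit_shift_in_orbit_space: "x \<in> orbit_space X T \<Longrightarrow> orbit_shift x \<in> orbit_space X T"
  by (auto simp: orbit_space_def orbit_shift_def)

lemma continuous_on_orbit_shift: "continuous_on Y (orbit_shift :: (nat \<Rightarrow> 'a::metric_space) \<Rightarrow> _)"
  unfolding orbit_shift_def
  by (intro continuous_on_coordinatewise_then_product
      continuous_on_subset[OF continuous_on_product_coordinates subset_UNIV])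

lemma pushforward_proj2_in_prob_measures:
  fixes X :: "'a::metric_space set"
  assumes "\<nu> \<in> prob_measures (orbit_space X T)"
  shows "distr \<nu> (restrict_space borel (graph_of X T)) proj2 \<in> prob_measures (graph_of X T)"
proof -
  interpret prob_space \<nu> using assms by (simp add: prob_measures_def)
  have c: "continuous_on (orbit_space X T) (proj2 :: (nat \<Rightarrow> 'a) \<Rightarrow> _)"
    unfolding proj2_def
    by (intro continuous_on_Pair continuous_on_subset[OF continuous_on_product_coordinates subset_UNIV])
  have "proj2 \<in> orbit_space X T \<rightarrow> graph_of X T"
    by (force simp: proj2_def orbit_space_def graph_of_def)
  then have "proj2 \<in> restrict_space borel (orbit_space X T)
      \<rightarrow>\<^sub>M restrict_space borel (graph_of X T)"
    using borel_measurable_continuous_on_restrict[OF c]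
    by (intro measurable_restrict_space2) (auto simp: space_restrict_space)
  then have "proj2 \<in> \<nu> \<rightarrow>\<^sub>M restrict_space borel (graph_of X T)"
    using assms measurable_cong_sets[of \<nu> "restrict_space borel (orbit_space X T)"]
    by (auto simp: prob_measures_def)
  then show ?thesis
    by (simp add: prob_measures_def prob_space_distr)
qed

end

theory Submission
  imports Defs
begin

text \<open>Let \<open>\<Omega>\<close> be the orbit space, \<open>\<sigma>\<close> the shift on it, and \<open>P \<nu>\<close> the energy of the image
  of \<open>\<nu>\<close> under \<open>proj2\<close>. Since pushing measures forward is weak-star continuous, so is \<open>P\<close>.

  If the ergodic measures are entropy dense, then \<open>{\<rho>. P \<rho> > P \<nu> - \<eta> / 2}\<close> is a weak-star
  neighbourhood of \<open>\<nu>\<close>, and an ergodic measure in it whose entropy exceeds that of \<open>\<nu>\<close> up to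
  \<open>\<eta> / 2\<close> is what is wanted.

  If the energy is convex, the argument is that of Bauer's maximum principle. On the invariant
  measures consider \<open>\<Phi> \<rho> = h \<rho> + P \<rho> + \<eta> / 2 * G \<rho>\<close>, where \<open>h\<close> is entropy and \<open>G\<close> is an upper
  semicontinuous, strictly convex functional with values in \<open>{0..1}\<close>. Entropy is convex, and
  expansiveness makes it upper semicontinuous; \<open>P\<close> is convex and continuous. So \<open>\<Phi>\<close> is upper
  semicontinuous and strictly convex. The space of invariant measures is sequentially compact, so \<open>\<Phi>\<close> has a
  maximiser \<open>\<rho>\<close> (\<open>usc_attains_max_invariant\<close>). By strict convexity \<open>\<rho>\<close> is an extreme point of the
  set of invariant measures, hence ergodic (\<open>extreme_imp_ergodic\<close>), and \<open>\<Phi> \<nu> \<le> \<Phi> \<rho>\<close> together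
  with the bounds on \<open>G\<close> gives \<open>h \<rho> + P \<rho> \<ge> h \<nu> + P \<nu> - \<eta> / 2\<close>. No ergodic decomposition is needed.

  Three ingredients carry this. Entropy of finite partitions is handled through simple functions
  whose fibres are the cells. This leads to the generator theorem \<open>KS_entropy_generating\<close> and to the
  convexity \<open>entropy_rate_mix\<close>. Sequential compactness of the probability measures on a compact
  metric space (\<open>prob_measures_seq_compact\<close>) is reduced to Helly's theorem on the real line by a
  Borel injection into a Cantor set whose inverse is uniformly continuous. Upper semicontinuity of
  entropy (\<open>entropy_rate_usc\<close>) uses a partition of \<open>X\<close> into pieces of diameter less than the
  expansiveness constant and with boundaries that are null for the limit measure. Expansiveness
  makes every such partition a generator for every invariant measure, so it computes the
  entropies along the whole converging sequence.\<close>

section \<open>Entropy of simple functions\<close>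

text \<open>The Shannon entropy, in nats, of the partition of the space into the fibres of \<open>f\<close>. Working
  with functions in place of partitions turns joins into tuples. With \<open>ln 0 = 0\<close> the null fibres
  contribute nothing.\<close>

definition code_entropy :: "'b measure \<Rightarrow> ('b \<Rightarrow> 'c) \<Rightarrow> real" where
  "code_entropy M f = - (\<Sum>v\<in>f ` space M.
     measure M (f -` {v} \<inter> space M) * ln (measure M (f -` {v} \<inter> space M)))"

lemma code_entropy_cong:
  assumes "\<And>x. x \<in> space M \<Longrightarrow> f x = g x"
  shows "code_entropy M f = code_entropy M g"
proof -
  have "f ` space M = g ` space M" "\<And>v. f -` {v} \<inter> space M = g -` {v} \<inter> space M"
    using assms by auto
  then show ?thesis unfolding code_entropy_def by simp
qed

lemma information_space_exp: "prob_space M \<Longrightarrow> information_space M (exp 1)"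
  by (simp add: information_space_def information_space_axioms_def)

lemma code_entropy_eq_entropy:
  assumes "prob_space M" "simple_function M f"
  shows "code_entropy M f = prob_space.entropy M (exp 1) (count_space (f ` space M)) f"
proof -
  interpret information_space M "exp 1" by (rule information_space_exp[OF assms(1)])
  show ?thesis
    unfolding entropy_simple_distributed[OF simple_distributedI[OF assms(2) measure_nonneg refl]]
    by (simp add: code_entropy_def log_def)
qed

text \<open>A function that is determined by \<open>g\<close> has at most the entropy of \<open>g\<close>.\<close>

lemma code_entropy_mono:
  fixes f :: "'b \<Rightarrow> 'c" and g :: "'b \<Rightarrow> 'd"
  assumes M: "prob_space M" and g: "simple_function M g"
    and det: "\<And>x y. x \<in> space M \<Longrightarrow> y \<in> space M \<Longrightarrow> g x = g y \<Longrightarrow> f x = f y"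
  shows "code_entropy M f \<le> code_entropy M g"
proof -
  interpret information_space M "exp 1" by (rule information_space_exp[OF M])
  define h where "h v = f (inv_into (space M) g v)" for v
  have h: "h (g x) = f x" if "x \<in> space M" for x
    unfolding h_def using that by (intro det inv_into_into f_inv_into_f) auto
  have "code_entropy M f = code_entropy M (h \<circ> g)"
    by (rule code_entropy_cong) (simp add: h)
  also have "\<dots> \<le> code_entropy M g"
    using code_entropy_eq_entropy[OF M g] code_entropy_eq_entropy[OF M simple_function_compose[OF g, of h]]
      entropy_data_processing[OF g, of h] by simp
  finally show ?thesis .
qed

lemma code_entropy_cong_det:
  fixes f :: "'b \<Rightarrow> 'c" and g :: "'b \<Rightarrow> 'd"
  assumes "prob_space M" "simple_function M f" "simple_function M g"
    and "\<And>x y. x \<in> space M \<Longrightarrow> y \<in> space M \<Longrightarrow> g x = g y \<longleftrightarrow> f x = f y"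
  shows "code_entropy M f = code_entropy M g"
  using assms by (intro antisym code_entropy_mono) blast+

lemma code_entropy_nonneg:
  assumes "prob_space M"
  shows "0 \<le> code_entropy M f"
proof -
  interpret prob_space M by fact
  have "measure M A * ln (measure M A) \<le> 0" for A
    by (cases "measure M A = 0")
       (auto intro!: mult_nonneg_nonpos simp: ln_le_zero_iff less_le zero_less_measure_iff)
  then show ?thesis unfolding code_entropy_def by (simp add: sum_nonpos)
qed

text \<open>The entropy of a function \<open>f = h \<circ> g\<close> as a sum over the fibres of the finer function \<open>g\<close>.\<close>

lemma code_entropy_marginal:
  assumes M: "prob_space M" and g: "simple_function M g"
    and f: "\<And>x. x \<in> space M \<Longrightarrow> f x = h (g x)"
  shows "code_entropy M f = - (\<Sum>v\<in>g ` space M.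
    measure M (g -` {v} \<inter> space M) * ln (measure M (f -` {h v} \<inter> space M)))"
proof -
  interpret prob_space M by fact
  have fin: "finite (g ` space M)" using g by (rule simple_functionD)
  have im: "f ` space M = h ` g ` space M" using f by (auto simp: image_iff)
  have part: "measure M (f -` {w} \<inter> space M) = (\<Sum>v\<in>{v \<in> g ` space M. h v = w}. measure M (g -` {v} \<inter> space M))" for w
  proof -
    have "f -` {w} \<inter> space M = (\<Union>v\<in>{v \<in> g ` space M. h v = w}. g -` {v} \<inter> space M)"
      using f by auto
    also have "measure M \<dots> = (\<Sum>v\<in>{v \<in> g ` space M. h v = w}. measure M (g -` {v} \<inter> space M))"
      by (rule finite_measure_finite_Union) (use fin g in \<open>auto simp: disjoint_family_on_def simple_functionD\<close>)
    finally show ?thesis .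
  qed
  have "(\<Sum>v\<in>g ` space M. measure M (g -` {v} \<inter> space M) * ln (measure M (f -` {h v} \<inter> space M)))
     = (\<Sum>w\<in>h ` g ` space M. \<Sum>v\<in>{v \<in> g ` space M. h v = w}.
          measure M (g -` {v} \<inter> space M) * ln (measure M (f -` {h v} \<inter> space M)))"
    by (rule sum.image_gen[OF fin])
  also have "\<dots> = (\<Sum>w\<in>h ` g ` space M. measure M (f -` {w} \<inter> space M) * ln (measure M (f -` {w} \<inter> space M)))"
    by (rule sum.cong) (auto simp: part sum_distrib_right)
  finally show ?thesis by (simp add: code_entropy_def im)
qed

text \<open>Strong subadditivity, which says that the conditional mutual information of \<open>X\<close> and \<open>Y\<close>
  given \<open>Z\<close> is nonnegative.\<close>

lemma code_entropy_submodular: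
  assumes M: "prob_space M"
    and X: "simple_function M X" and Y: "simple_function M Y" and Z: "simple_function M Z"
  shows "code_entropy M (\<lambda>x. (X x, Y x, Z x)) + code_entropy M Z
       \<le> code_entropy M (\<lambda>x. (X x, Z x)) + code_entropy M (\<lambda>x. (Y x, Z x))"
proof -
  interpret information_space M "exp 1" by (rule information_space_exp[OF M])
  let ?p = "\<lambda>f v. measure M (f -` {v} \<inter> space M)"
  let ?W = "\<lambda>x. (X x, Y x, Z x)" and ?U = "\<lambda>x. (X x, Z x)" and ?V = "\<lambda>x. (Y x, Z x)"
  note YZ = simple_function_Pair[OF Y Z] and XZ = simple_function_Pair[OF X Z]
  note W = simple_function_Pair[OF X YZ]
  have fin: "finite (?W ` space M)" using W by (rule simple_functionD)
  have Zm: "code_entropy M Z = - (\<Sum>v\<in>?W ` space M. ?p ?W v * ln (?p Z (snd (snd v))))"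
    by (rule code_entropy_marginal[OF M W]) simp
  have Um: "code_entropy M ?U = - (\<Sum>v\<in>?W ` space M. ?p ?W v * ln (?p ?U (fst v, snd (snd v))))"
    using code_entropy_marginal[OF M W, of ?U "\<lambda>v. (fst v, snd (snd v))"] by simp
  have Vm: "code_entropy M ?V = - (\<Sum>v\<in>?W ` space M. ?p ?W v * ln (?p ?V (snd v)))"
    by (rule code_entropy_marginal[OF M W]) simp
  have "0 \<le> conditional_mutual_information_Pow X Y Z" by (rule conditional_mutual_information_nonneg[OF X Y Z])
  also have "\<dots> = (\<Sum>(x, y, z)\<in>?W ` space M. ?p ?W (x, y, z) *
      log (exp 1) (?p ?W (x, y, z) / (?p ?U (x, z) * (?p ?V (y, z) / ?p Z z))))"
    by (rule conditional_mutual_information_eq)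
      (intro simple_distributedI measure_nonneg refl X Y Z XZ YZ W)+
  also have "\<dots> = (\<Sum>v\<in>?W ` space M. ?p ?W v * ln (?p ?W v) + ?p ?W v * ln (?p Z (snd (snd v)))
      - ?p ?W v * ln (?p ?U (fst v, snd (snd v))) - ?p ?W v * ln (?p ?V (snd v)))"
  proof (rule sum.cong[OF refl], clarify)
    fix x
    let ?x = "X x" and ?y = "Y x" and ?z = "Z x"
    show "?p ?W (?x, ?y, ?z) * log (exp 1) (?p ?W (?x, ?y, ?z) / (?p ?U (?x, ?z) * (?p ?V (?y, ?z) / ?p Z ?z)))
      = ?p ?W (?x, ?y, ?z) * ln (?p ?W (?x, ?y, ?z)) + ?p ?W (?x, ?y, ?z) * ln (?p Z (snd (snd (?x, ?y, ?z))))
      - ?p ?W (?x, ?y, ?z) * ln (?p ?U (fst (?x, ?y, ?z), snd (snd (?x, ?y, ?z)))) - ?p ?W (?x, ?y, ?z) * ln (?p ?V (snd (?x, ?y, ?z)))"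
    proof (cases "?p ?W (?x, ?y, ?z) = 0")
      case False
      then have pos: "0 < ?p ?W (?x, ?y, ?z)" by (simp add: zero_less_measure_iff)
      have "?p ?W (?x, ?y, ?z) \<le> ?p ?U (?x, ?z)"
        using XZ by (intro finite_measure_mono) (auto simp: simple_functionD)
      moreover have "?p ?W (?x, ?y, ?z) \<le> ?p ?V (?y, ?z)"
        using YZ by (intro finite_measure_mono) (auto simp: simple_functionD)
      moreover have "?p ?W (?x, ?y, ?z) \<le> ?p Z ?z"
        using Z by (intro finite_measure_mono) (auto simp: simple_functionD)
      ultimately have "0 < ?p ?U (?x, ?z)" "0 < ?p ?V (?y, ?z)" "0 < ?p Z ?z"
        using pos by linarith+
      then show ?thesis using pos
        by (simp add: log_def ln_div ln_mult algebra_simps)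
    qed simp
  qed
  also have "\<dots> = code_entropy M ?U + code_entropy M ?V - code_entropy M ?W - code_entropy M Z"
    unfolding Zm Um Vm by (simp add: code_entropy_def sum.distrib sum_subtractf)
  finally show ?thesis by simp
qed

text \<open>The conditional entropy of \<open>X\<close> given \<open>V\<close> is expressed as the difference of the entropies of
  \<open>(X, V)\<close> and \<open>V\<close>. It decreases when the condition becomes finer.\<close>

lemma code_entropy_cond_mono:
  assumes M: "prob_space M"
    and X: "simple_function M X" and V: "simple_function M V" and Z: "simple_function M Z"
    and det: "\<And>x y. x \<in> space M \<Longrightarrow> y \<in> space M \<Longrightarrow> V x = V y \<Longrightarrow> Z x = Z y"
  shows "code_entropy M (\<lambda>x. (X x, V x)) - code_entropy M V
       \<le> code_entropy M (\<lambda>x. (X x, Z x)) - code_entropy M Z"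
proof -
  note sf = simple_function_Pair[OF V Z] simple_function_Pair[OF X V]
     simple_function_Pair[OF X simple_function_Pair[OF V Z]]
  have "code_entropy M (\<lambda>x. (X x, V x, Z x)) = code_entropy M (\<lambda>x. (X x, V x))"
    by (rule code_entropy_cong_det[OF M]) (use sf V in simp_all, use det in blast)
  moreover have "code_entropy M (\<lambda>x. (V x, Z x)) = code_entropy M V"
    by (rule code_entropy_cong_det[OF M]) (use sf V in simp_all, use det in blast)
  ultimately show ?thesis
    using code_entropy_submodular[OF M X V Z] by simp
qed

lemma code_entropy_subadditive:
  assumes M: "prob_space M" and X: "simple_function M X" and Y: "simple_function M Y"
  shows "code_entropy M (\<lambda>x. (X x, Y x)) \<le> code_entropy M X + code_entropy M Y"
proof -
  interpret prob_space M by fact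
  have Z: "simple_function M (\<lambda>_. ())" by simp
  have "code_entropy M (\<lambda>_. ()) = 0"
    by (simp add: code_entropy_def image_constant_conv prob_space not_empty)
  moreover have "code_entropy M (\<lambda>x. (X x, ())) = code_entropy M X"
    by (rule code_entropy_cong_det[OF M]) (use simple_function_Pair[OF X Z] X in auto)
  ultimately show ?thesis
    using code_entropy_cond_mono[OF M X Y Z] by simp
qed

section \<open>Itineraries and the entropy rate\<close>

text \<open>The word of length \<open>n\<close> that the orbit of \<open>x\<close> reads off \<open>f\<close>. Its fibres are the cells of the
  iterated refinement of the partition into the fibres of \<open>f\<close>.\<close>

definition itinerary :: "('b \<Rightarrow> 'b) \<Rightarrow> ('b \<Rightarrow> 'c) \<Rightarrow> nat \<Rightarrow> 'b \<Rightarrow> 'c list" where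
  "itinerary S f n x = map (\<lambda>i. f ((S ^^ i) x)) [0..<n]"

lemma itinerary_eq_iff: "itinerary S f n x = itinerary S f n y \<longleftrightarrow> (\<forall>i<n. f ((S ^^ i) x) = f ((S ^^ i) y))"
  by (auto simp: itinerary_def)

text \<open>A probability space with a measure preserving self-map.\<close>

locale measure_preserving = prob_space M for M :: "'b measure" +
  fixes S :: "'b \<Rightarrow> 'b"
  assumes measurable_S: "S \<in> measurable M M" and invariant: "distr M M S = M"
begin

lemma funpow_measurable: "S ^^ i \<in> measurable M M"
proof (induction i)
  case (Suc i)
  then show ?case using measurable_S by (auto simp: comp_def)
qed (simp add: id_def)

lemma funpow_space: "x \<in> space M \<Longrightarrow> (S ^^ i) x \<in> space M"
  using funpow_measurable by (rule measurable_space)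

lemma invariant_pow: "distr M M (S ^^ i) = M"
proof (induction i)
  case (Suc i)
  have "distr M M (S ^^ Suc i) = distr (distr M M (S ^^ i)) M S"
    by (subst distr_distr[OF measurable_S funpow_measurable]) simp
  also have "\<dots> = M" by (simp add: Suc invariant)
  finally show ?case .
next
  case 0
  then show ?case by (simp add: id_def distr_id)
qed

lemma measure_pow_vimage:
  "A \<in> sets M \<Longrightarrow> measure M ((S ^^ i) -` A \<inter> space M) = measure M A"
  using measure_distr[OF funpow_measurable, of A i] by (simp add: invariant_pow)

lemma simple_function_pow:
  assumes "simple_function M f" shows "simple_function M (\<lambda>x. f ((S ^^ i) x))"
  unfolding simple_function_def
proof (intro conjI ballI)
  have "(\<lambda>x. f ((S ^^ i) x)) ` space M \<subseteq> f ` space M" using funpow_space by auto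
  then show "finite ((\<lambda>x. f ((S ^^ i) x)) ` space M)"
    by (rule finite_subset) (use assms in \<open>simp add: simple_functionD\<close>)
  fix v
  have "(\<lambda>x. f ((S ^^ i) x)) -` {v} \<inter> space M = (S ^^ i) -` (f -` {v} \<inter> space M) \<inter> space M"
    using funpow_space by auto
  then show "(\<lambda>x. f ((S ^^ i) x)) -` {v} \<inter> space M \<in> sets M"
    using measurable_sets[OF funpow_measurable simple_functionD(2)[OF assms]] by simp
qed

lemma code_entropy_pow:
  assumes f: "simple_function M f"
  shows "code_entropy M (\<lambda>x. f ((S ^^ i) x)) = code_entropy M f"
proof -
  let ?g = "\<lambda>x. f ((S ^^ i) x)"
  have sub: "?g ` space M \<subseteq> f ` space M" using funpow_space by auto
  have p: "measure M (?g -` {v} \<inter> space M) = measure M (f -` {v} \<inter> space M)" for v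
  proof -
    have "?g -` {v} \<inter> space M = (S ^^ i) -` (f -` {v} \<inter> space M) \<inter> space M"
      using funpow_space by auto
    then show ?thesis using measure_pow_vimage[OF simple_functionD(2)[OF f]] by simp
  qed
  have z: "measure M (f -` {v} \<inter> space M) = 0" if "v \<notin> ?g ` space M" for v
  proof -
    have "?g -` {v} \<inter> space M = {}" using that by auto
    then show ?thesis using p[of v] by simp
  qed
  show ?thesis unfolding code_entropy_def p
    by (rule arg_cong[where f = uminus], rule sum.mono_neutral_left)
       (use sub z f in \<open>auto simp: simple_functionD\<close>)
qed

lemma simple_function_itinerary:
  assumes f: "simple_function M f" shows "simple_function M (itinerary S f n)"
proof (induction n)
  case 0
  then show ?case by (simp add: itinerary_def[abs_def])
next
  case (Suc n)
  have "itinerary S f (Suc n) = (\<lambda>(w, a). w @ [a]) \<circ> (\<lambda>x. (itinerary S f n x, f ((S ^^ n) x)))"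
    by (auto simp: itinerary_def)
  then show ?case
    by (simp only: simple_function_compose[OF simple_function_Pair[OF Suc simple_function_pow[OF f]]])
qed

lemma code_entropy_itinerary_add:
  assumes f: "simple_function M f"
  shows "code_entropy M (itinerary S f (m + n))
       \<le> code_entropy M (itinerary S f m) + code_entropy M (itinerary S f n)"
proof -
  let ?B = "\<lambda>x. itinerary S f n ((S ^^ m) x)"
  note sf = simple_function_itinerary[OF f]
  note B = simple_function_pow[OF sf]
  have "code_entropy M (itinerary S f (m + n)) \<le> code_entropy M (\<lambda>x. (itinerary S f m x, ?B x))"
  proof (rule code_entropy_mono[OF prob_space_axioms simple_function_Pair[OF sf B]])
    fix x y assume "(itinerary S f m x, ?B x) = (itinerary S f m y, ?B y)"
    then have 1: "\<forall>i<m. f ((S ^^ i) x) = f ((S ^^ i) y)"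
      and 2: "\<forall>i<n. f ((S ^^ (i + m)) x) = f ((S ^^ (i + m)) y)"
      by (auto simp: itinerary_eq_iff funpow_add)
    have "f ((S ^^ i) x) = f ((S ^^ i) y)" if "i < m + n" for i
      using 1 2[rule_format, of "i - m"] that by (cases "i < m") auto
    then show "itinerary S f (m + n) x = itinerary S f (m + n) y"
      by (simp add: itinerary_eq_iff)
  qed
  also have "\<dots> \<le> code_entropy M (itinerary S f m) + code_entropy M ?B"
    by (rule code_entropy_subadditive[OF prob_space_axioms sf B])
  also have "code_entropy M ?B = code_entropy M (itinerary S f n)"
    by (rule code_entropy_pow[OF sf])
  finally show ?thesis .
qed

end

text \<open>Fekete's lemma for nonnegative subadditive sequences.\<close>

lemma fekete_limit:
  fixes a :: "nat \<Rightarrow> real"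
  assumes sub: "\<And>m n. a (m + n) \<le> a m + a n" and nonneg: "\<And>n. 0 \<le> a n"
  shows "(\<lambda>n. a n / real n) \<longlonglongrightarrow> (INF n\<in>{1..}. a n / real n)"
proof -
  define L where "L = (INF n\<in>{1..}. a n / real n)"
  have bdd: "bdd_below ((\<lambda>n. a n / real n) ` {1..})"
    by (rule bdd_belowI[of _ 0]) (auto simp: nonneg)
  have low: "L \<le> a n / real n" if "n \<ge> 1" for n
    unfolding L_def using that by (intro cINF_lower[OF bdd]) auto
  have mult: "a (q * m + r) \<le> real q * a m + a r" for q m r
  proof (induction q)
    case (Suc q)
    have "a (Suc q * m + r) \<le> a m + a (q * m + r)" using sub[of m "q * m + r"] by (simp add: algebra_simps)
    then show ?case using Suc by (simp add: algebra_simps)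
  qed simp
  have "(\<lambda>n. a n / real n) \<longlonglongrightarrow> L"
  proof (rule LIMSEQ_I)
    fix e :: real assume e: "0 < e"
    \<comment> \<open>Divide \<open>n\<close> by an index \<open>m\<close> that nearly attains the infimum; the remainder costs at most \<open>C\<close>.\<close>
    obtain m where m: "m \<ge> 1" "a m / real m < L + e / 2"
    proof -
      have "\<exists>x\<in>(\<lambda>n. a n / real n) ` {1..}. x < L + e/2"
        by (rule cInf_lessD) (use e in \<open>auto simp: L_def\<close>)
      then show ?thesis using that by auto
    qed
    define C where "C = Max (a ` {..<m})"
    have C: "a r \<le> C" if "r < m" for r unfolding C_def using that by (intro Max_ge) auto
    have C0: "0 \<le> C" using C[of 0] nonneg[of 0] m by simp
    obtain N :: nat where N: "real N > 2 * C / e" using reals_Archimedean2 by blast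
    show "\<exists>n0. \<forall>n\<ge>n0. norm (a n / real n - L) < e"
    proof (intro exI[of _ "Suc N"] allI impI)
      fix n assume n: "n \<ge> Suc N"
      then have n1: "n \<ge> 1" by simp
      have "a n = a ((n div m) * m + n mod m)" by simp
      also have "\<dots> \<le> real (n div m) * a m + a (n mod m)" by (rule mult)
      also have "\<dots> \<le> real n / real m * a m + C"
        by (intro add_mono mult_right_mono nonneg C) (use m in \<open>auto intro: of_nat_div_le_of_nat\<close>)
      finally have "a n / real n \<le> (real n / real m * a m + C) / real n"
        by (rule divide_right_mono) simp
      also have "\<dots> = a m / real m + C / real n" using n1 by (simp add: field_simps)
      also have "C / real n < e / 2"
      proof -
        have "2 * C / e < real n" using N n by linarith
        then show ?thesis using e n1 by (simp add: field_simps)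
      qed
      finally have "a n / real n < L + e" using m by linarith
      then show "norm (a n / real n - L) < e" using low[OF n1] by simp
    qed
  qed
  then show ?thesis unfolding L_def .
qed

text \<open>For \<open>n = 0\<close> the two sides can differ, since the common refinement of no partitions at all is the
  partition of the whole type.\<close>

lemma iterated_refinement_code:
  assumes S: "S \<in> Y \<rightarrow> Y" and n: "n \<ge> 1"
  shows "iterated_refinement Y S ((\<lambda>v. f -` {v} \<inter> Y) ` f ` Y) n
       = (\<lambda>w. itinerary S f n -` {w} \<inter> Y) ` itinerary S f n ` Y"
proof -
  have SY: "(S ^^ i) x \<in> Y" if "x \<in> Y" for i x
    using that S by (induction i) auto
  define F where "F i x = {y \<in> Y. f ((S ^^ i) y) = f ((S ^^ i) x)}" for i x
  have Q: "(\<lambda>A. (S ^^ i) -` A \<inter> Y) ` (\<lambda>v. f -` {v} \<inter> Y) ` f ` Y - {{}} = F i ` Y" for i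
  proof (intro set_eqI iffI)
    fix D assume D: "D \<in> (\<lambda>A. (S ^^ i) -` A \<inter> Y) ` (\<lambda>v. f -` {v} \<inter> Y) ` f ` Y - {{}}"
    then obtain z where z: "D = (S ^^ i) -` (f -` {f z} \<inter> Y) \<inter> Y" and "D \<noteq> {}" by auto
    then obtain x where x: "x \<in> D" by auto
    then have "D = F i x" "x \<in> Y" using z SY unfolding F_def by auto
    then show "D \<in> F i ` Y" by auto
  next
    fix D assume "D \<in> F i ` Y"
    then obtain x where x: "x \<in> Y" "D = F i x" by auto
    then have "D = (S ^^ i) -` (f -` {f ((S ^^ i) x)} \<inter> Y) \<inter> Y" "x \<in> D"
      using SY by (auto simp: F_def)
    then show "D \<in> (\<lambda>A. (S ^^ i) -` A \<inter> Y) ` (\<lambda>v. f -` {v} \<inter> Y) ` f ` Y - {{}}"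
      using SY[OF x(1), of i] by blast
  qed
  have itin: "(\<lambda>w. itinerary S f n -` {w} \<inter> Y) ` itinerary S f n ` Y = (\<lambda>x. \<Inter>i<n. F i x) ` Y"
  proof -
    have "itinerary S f n -` {itinerary S f n x} \<inter> Y = (\<Inter>i<n. F i x)" for x
    proof (intro set_eqI iffI)
      fix y assume y: "y \<in> (\<Inter>i<n. F i x)"
      then have "y \<in> F 0 x" using n by auto
      then show "y \<in> itinerary S f n -` {itinerary S f n x} \<inter> Y"
        using y by (auto simp: F_def itinerary_eq_iff)
    qed (auto simp: F_def itinerary_eq_iff)
    then show ?thesis by (simp add: image_image)
  qed
  have "common_refinement ((\<lambda>i. F i ` Y) ` {..<n}) = (\<lambda>x. \<Inter>i<n. F i x) ` Y"
  proof (intro set_eqI iffI)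
    \<comment> \<open>A nonempty cell is determined by any of its points, and so is each of the sets chosen for it.\<close>
    fix D assume "D \<in> common_refinement ((\<lambda>i. F i ` Y) ` {..<n})"
    then obtain g where g: "\<And>i. i < n \<Longrightarrow> g (F i ` Y) \<in> F i ` Y"
      and D: "D = (\<Inter>i<n. g (F i ` Y))" "D \<noteq> {}"
      unfolding common_refinement by auto
    obtain x where x: "x \<in> D" using D by auto
    have gF: "g (F i ` Y) = F i x" if i: "i < n" for i
    proof -
      obtain z where "g (F i ` Y) = F i z" using g[OF i] by auto
      moreover have "x \<in> g (F i ` Y)" using x D i by auto
      ultimately show ?thesis by (auto simp: F_def)
    qed
    have "x \<in> F 0 x" using x D gF[of 0] n by auto
    then have "x \<in> Y" by (simp add: F_def)
    moreover have "D = (\<Inter>i<n. F i x)" using D gF by simp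
    ultimately show "D \<in> (\<lambda>x. \<Inter>i<n. F i x) ` Y" by blast
  next
    fix D assume "D \<in> (\<lambda>x. \<Inter>i<n. F i x) ` Y"
    then obtain x where x: "x \<in> Y" "D = (\<Inter>i<n. F i x)" by auto
    define g where "g q = {y \<in> Y. \<exists>A\<in>q. x \<in> A \<and> y \<in> A}" for q
    have gF: "g (F i ` Y) = F i x" for i
      using x by (auto simp: g_def F_def)
    have "x \<in> D" using x by (auto simp: F_def)
    moreover have "D = \<Inter> (g ` (\<lambda>i. F i ` Y) ` {..<n})" using x gF by auto
    moreover have "g \<in> (\<Pi> P\<in>(\<lambda>i. F i ` Y) ` {..<n}. P)" using gF x by auto
    ultimately show "D \<in> common_refinement ((\<lambda>i. F i ` Y) ` {..<n})"
      unfolding common_refinement by blast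
  qed
  then show ?thesis unfolding iterated_refinement_def Q itin .
qed

lemma partition_entropy_code:
  "partition_entropy M ((\<lambda>v. f -` {v} \<inter> space M) ` f ` space M) = code_entropy M f"
proof -
  have "inj_on (\<lambda>v. f -` {v} \<inter> space M) (f ` space M)"
    by (auto simp: inj_on_def)
  then show ?thesis
    unfolding partition_entropy_def code_entropy_def by (simp add: sum.reindex)
qed

text \<open>Every finite measurable partition consists of the fibres of a simple function, which sends a
  point to the member that contains it.\<close>

lemma partition_on_code:
  assumes P: "finite P" "P \<subseteq> sets M" "partition_on (space M) P"
  obtains f :: "'b \<Rightarrow> 'b set" where "simple_function M f" "P = (\<lambda>v. f -` {v} \<inter> space M) ` f ` space M"
proof -
  define f where "f x = (THE A. A \<in> P \<and> x \<in> A)" for x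
  have f: "f x = A" if "A \<in> P" "x \<in> A" for x A
    unfolding f_def using that P(3) by (intro the_equality) (auto simp: partition_on_def disjoint_def)
  have cover: "\<exists>A\<in>P. x \<in> A" if "x \<in> space M" for x
    using that P(3) by (auto simp: partition_on_def)
  have sub: "A \<subseteq> space M" if "A \<in> P" for A using that P(3) by (auto simp: partition_on_def)
  have fib: "f -` {A} \<inter> space M = A" if "A \<in> P" for A
    using f[OF that] sub[OF that] cover f by fastforce
  have im: "f ` space M = P"
  proof (intro set_eqI iffI)
    fix A assume A: "A \<in> P"
    then obtain x where "x \<in> A" using P(3) unfolding partition_on_def by fastforce
    then show "A \<in> f ` space M" using f[OF A] sub[OF A] by force
  next
    fix A assume "A \<in> f ` space M"
    then show "A \<in> P" using f cover by force
  qed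
  show ?thesis
  proof
    show "simple_function M f" unfolding simple_function_def im using P fib by auto
    show "P = (\<lambda>v. f -` {v} \<inter> space M) ` f ` space M" unfolding im using fib by auto
  qed
qed

text \<open>The entropy per unit of time of the process \<open>f\<close>, \<open>f \<circ> S\<close>, \<open>f \<circ> S \<circ> S\<close>, ... . The infimum
  equals the limit by Fekete's lemma. The index \<open>0\<close> is excluded because \<open>a / 0 = 0\<close> would be its value.\<close>

definition entropy_rate :: "'b measure \<Rightarrow> ('b \<Rightarrow> 'b) \<Rightarrow> ('b \<Rightarrow> 'c) \<Rightarrow> real" where
  "entropy_rate M S f = (INF n\<in>{1..}. code_entropy M (itinerary S f n) / real n)"

lemma tendsto_xlnx:
  fixes p :: "'i \<Rightarrow> real"
  assumes p: "(p \<longlongrightarrow> a) F" and nonneg: "\<And>i. 0 \<le> p i"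
  shows "((\<lambda>i. p i * ln (p i)) \<longlongrightarrow> a * ln a) F"
proof (cases "F = bot")
  case False
  have a: "0 \<le> a" using tendsto_lowerbound[OF p _ False, of 0] nonneg by simp
  have "continuous (at a within {0..}) (\<lambda>x::real. x * ln x)"
  proof (cases "a = 0")
    case True
    have "((\<lambda>x::real. x * ln x) \<longlongrightarrow> 0) (at_right 0)" by real_asymp
    then show ?thesis by (simp add: continuous_within True at_within_Ici_at_right)
  next
    case False
    then show ?thesis using a by (intro continuous_intros) auto
  qed
  then show ?thesis
    by (rule continuous_within_tendsto_compose'[OF _ _ p]) (use nonneg in auto)
qed simp

lemma code_entropy_superset:
  assumes "finite V" "f ` space M \<subseteq> V"
  shows "code_entropy M f = - (\<Sum>v\<in>V. measure M (f -` {v} \<inter> space M) * ln (measure M (f -` {v} \<inter> space M)))"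
proof -
  have "f -` {v} \<inter> space M = {}" if "v \<in> V - f ` space M" for v using that by auto
  then have "measure M (f -` {v} \<inter> space M) = 0" if "v \<in> V - f ` space M" for v using that by simp
  then show ?thesis unfolding code_entropy_def
    by (intro arg_cong[where f = uminus] sum.mono_neutral_left) (use assms in auto)
qed

text \<open>Entropy is continuous in the function, for functions with values in a fixed finite set and
  convergence in probability.\<close>

lemma code_entropy_tendsto:
  assumes M: "prob_space M" and f: "simple_function M f" and g: "\<And>j::nat. simple_function M (g j)"
    and V: "finite V" "f ` space M \<subseteq> V" "\<And>j. g j ` space M \<subseteq> V"
    and lim: "(\<lambda>j. measure M {x \<in> space M. f x \<noteq> g j x}) \<longlonglongrightarrow> 0"
  shows "(\<lambda>j. code_entropy M (g j)) \<longlonglongrightarrow> code_entropy M f"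
proof -
  interpret prob_space M by fact
  have D: "{x \<in> space M. f x \<noteq> g j x} \<in> sets M" for j
  proof -
    have "simple_function M (\<lambda>x. f x \<noteq> g j x)"
      using simple_function_compose[OF simple_function_Pair[OF f g[of j]], of "\<lambda>(a, b). a \<noteq> b"]
      by (simp add: comp_def)
    from simple_functionD(2)[OF this, of "{True}"] show ?thesis by (simp add: vimage_def Int_def conj_commute)
  qed
  have p: "(\<lambda>j. measure M (g j -` {v} \<inter> space M)) \<longlonglongrightarrow> measure M (f -` {v} \<inter> space M)" for v
  proof -
    have "\<bar>measure M (g j -` {v} \<inter> space M) - measure M (f -` {v} \<inter> space M)\<bar>
       \<le> measure M {x \<in> space M. f x \<noteq> g j x}" for j
    proof -
      let ?A = "g j -` {v} \<inter> space M" and ?B = "f -` {v} \<inter> space M" and ?D = "{x \<in> space M. f x \<noteq> g j x}"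
      have m: "?A \<in> sets M" "?B \<in> sets M" using f g by (auto simp: simple_functionD)
      have "measure M ?A \<le> measure M (?B \<union> ?D)" using m D by (intro finite_measure_mono) auto
      also have "\<dots> \<le> measure M ?B + measure M ?D" using m D by (intro measure_Un_le) auto
      finally have 1: "measure M ?A \<le> measure M ?B + measure M ?D" .
      have "measure M ?B \<le> measure M (?A \<union> ?D)" using m D by (intro finite_measure_mono) auto
      also have "\<dots> \<le> measure M ?A + measure M ?D" using m D by (intro measure_Un_le) auto
      finally show ?thesis using 1 by simp
    qed
    then have "(\<lambda>j. measure M (g j -` {v} \<inter> space M) - measure M (f -` {v} \<inter> space M)) \<longlonglongrightarrow> 0"
      by (intro Lim_null_comparison[OF _ lim]) auto
    then show ?thesis by (simp add: LIM_zero_iff)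
  qed
  show ?thesis
    unfolding code_entropy_superset[OF V(1,2)] code_entropy_superset[OF V(1,3)]
    by (intro tendsto_intros tendsto_xlnx p measure_nonneg)
qed

context measure_preserving
begin

lemma entropy_rate_limit:
  assumes f: "simple_function M f"
  shows "(\<lambda>n. code_entropy M (itinerary S f n) / real n) \<longlonglongrightarrow> entropy_rate M S f"
  unfolding entropy_rate_def
  by (rule fekete_limit[OF code_entropy_itinerary_add[OF f] code_entropy_nonneg[OF prob_space_axioms]])

lemma entropy_rate_le:
  assumes "n \<ge> 1"
  shows "entropy_rate M S f \<le> code_entropy M (itinerary S f n) / real n"
  unfolding entropy_rate_def using assms
  by (intro cINF_lower bdd_belowI[of _ 0]) (auto simp: code_entropy_nonneg[OF prob_space_axioms])

lemma entropy_wrt_partition_code: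
  assumes f: "simple_function M f"
  shows "entropy_wrt_partition M S ((\<lambda>v. f -` {v} \<inter> space M) ` f ` space M) = entropy_rate M S f"
proof -
  have S: "S \<in> space M \<rightarrow> space M" using measurable_S by (auto dest: measurable_space)
  have "eventually (\<lambda>n. code_entropy M (itinerary S f n) / real n = partition_entropy M
     (iterated_refinement (space M) S ((\<lambda>v. f -` {v} \<inter> space M) ` f ` space M) n) / real n) sequentially"
    using eventually_ge_at_top[of 1]
    by eventually_elim (simp add: iterated_refinement_code[OF S] partition_entropy_code)
  then show ?thesis
    unfolding entropy_wrt_partition_def
    by (intro limI Lim_transform_eventually[OF entropy_rate_limit[OF f]])
qed

lemma entropy_rate_le_KS_entropy:
  assumes f: "simple_function M f"
  shows "ereal (entropy_rate M S f) \<le> KS_entropy M S"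
proof -
  let ?P = "(\<lambda>v. f -` {v} \<inter> space M) ` f ` space M"
  have "partition_on (space M) ?P"
    by (intro partition_onI) (auto simp: disjnt_def)
  moreover have "finite ?P" "?P \<subseteq> sets M" using f by (auto simp: simple_functionD)
  ultimately have "ereal (entropy_wrt_partition M S ?P) \<le> KS_entropy M S"
    unfolding KS_entropy_def by (intro SUP_upper) auto
  then show ?thesis by (simp add: entropy_wrt_partition_code[OF f])
qed

lemma KS_entropy_le:
  assumes "\<And>f :: 'b \<Rightarrow> 'b set. simple_function M f \<Longrightarrow> ereal (entropy_rate M S f) \<le> b"
  shows "KS_entropy M S \<le> b"
  unfolding KS_entropy_def
proof (rule SUP_least, clarify)
  fix P assume P: "finite P" "P \<subseteq> sets M" "partition_on (space M) P"
  from partition_on_code[OF this] obtain f :: "'b \<Rightarrow> 'b set"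
    where f: "simple_function M f" "P = (\<lambda>v. f -` {v} \<inter> space M) ` f ` space M" by metis
  show "ereal (entropy_wrt_partition M S P) \<le> b"
    unfolding f(2) entropy_wrt_partition_code[OF f(1)] by (rule assms[OF f(1)])
qed

text \<open>Given the itinerary under \<open>c\<close> of length \<open>n + m\<close>, each of the \<open>n\<close> letters of the itinerary under
  \<open>f\<close> carries at most the entropy of \<open>f\<close> given the itinerary under \<open>c\<close> of length \<open>m\<close>.\<close>

lemma code_entropy_itinerary_le:
  assumes f: "simple_function M f" and c: "simple_function M c"
  shows "code_entropy M (itinerary S f n) \<le> code_entropy M (itinerary S c (n + m))
    + real n * (code_entropy M (\<lambda>x. (f x, itinerary S c m x)) - code_entropy M (itinerary S c m))"
proof -
  let ?V = "itinerary S c (n + m)" and ?Z = "itinerary S c m"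
  let ?\<kappa> = "code_entropy M (\<lambda>x. (f x, ?Z x)) - code_entropy M ?Z"
  note ps = prob_space_axioms
  note V = simple_function_itinerary[OF c, of "n + m"] and Z = simple_function_itinerary[OF c, of m]
  note F = simple_function_itinerary[OF f]
  have step: "code_entropy M (\<lambda>x. (itinerary S f k x, ?V x)) \<le> code_entropy M ?V + real k * ?\<kappa>" if "k \<le> n" for k
    using that
  proof (induction k)
    case 0
    have "code_entropy M (\<lambda>x. (itinerary S f 0 x, ?V x)) \<le> code_entropy M ?V"
      by (rule code_entropy_mono[OF ps V]) (simp add: itinerary_def)
    then show ?case by simp
  next
    case (Suc k)
    let ?X = "\<lambda>x. f ((S ^^ k) x)" and ?W = "\<lambda>x. (itinerary S f k x, ?V x)" and ?U = "\<lambda>x. ?Z ((S ^^ k) x)"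
    note X = simple_function_pow[OF f, of k] and W = simple_function_Pair[OF F V]
      and U = simple_function_pow[OF Z, of k]
    have "code_entropy M (\<lambda>x. (itinerary S f (Suc k) x, ?V x)) \<le> code_entropy M (\<lambda>x. (?X x, ?W x))"
      by (rule code_entropy_mono[OF ps simple_function_Pair[OF X W]]) (simp add: itinerary_def)
    also have "\<dots> \<le> code_entropy M ?W + (code_entropy M (\<lambda>x. (?X x, ?U x)) - code_entropy M ?U)"
    proof -
      have "code_entropy M (\<lambda>x. (?X x, ?W x)) - code_entropy M ?W
         \<le> code_entropy M (\<lambda>x. (?X x, ?U x)) - code_entropy M ?U"
      proof (rule code_entropy_cond_mono[OF ps X W U])
        fix x y assume "?W x = ?W y"
        then have "\<forall>i<n + m. c ((S ^^ i) x) = c ((S ^^ i) y)" by (simp add: itinerary_eq_iff)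
        then have "c ((S ^^ (i + k)) x) = c ((S ^^ (i + k)) y)" if "i < m" for i
          using that Suc.prems by auto
        then show "?U x = ?U y" by (simp add: itinerary_eq_iff funpow_add)
      qed
      then show ?thesis by simp
    qed
    also have "code_entropy M ?U = code_entropy M ?Z" by (rule code_entropy_pow[OF Z])
    also have "code_entropy M (\<lambda>x. (?X x, ?U x)) = code_entropy M (\<lambda>x. (f x, ?Z x))"
      by (rule code_entropy_pow[OF simple_function_Pair[OF f Z]])
    also have "code_entropy M ?W \<le> code_entropy M ?V + real k * ?\<kappa>" using Suc by simp
    finally show ?case by (simp add: algebra_simps)
  qed
  have "code_entropy M (itinerary S f n) \<le> code_entropy M (\<lambda>x. (itinerary S f n x, ?V x))"
    by (rule code_entropy_mono[OF ps simple_function_Pair[OF F V]]) simp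
  also have "\<dots> \<le> code_entropy M ?V + real n * ?\<kappa>" by (rule step) simp
  finally show ?thesis .
qed

lemma entropy_rate_le_cond:
  assumes f: "simple_function M f" and c: "simple_function M c"
  shows "entropy_rate M S f \<le> entropy_rate M S c
    + (code_entropy M (\<lambda>x. (f x, itinerary S c m x)) - code_entropy M (itinerary S c m))" (is "_ \<le> _ + ?\<kappa>")
proof -
  have "(\<lambda>n. code_entropy M (itinerary S c (n + m)) / real (n + m) * (real (n + m) / real n))
      \<longlonglongrightarrow> entropy_rate M S c * 1"
  proof (rule tendsto_mult)
    show "(\<lambda>n. code_entropy M (itinerary S c (n + m)) / real (n + m)) \<longlonglongrightarrow> entropy_rate M S c"
      by (rule LIMSEQ_ignore_initial_segment[OF entropy_rate_limit[OF c]])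
    show "(\<lambda>n. real (n + m) / real n) \<longlonglongrightarrow> 1" by real_asymp
  qed
  then have lim: "(\<lambda>n. code_entropy M (itinerary S c (n + m)) / real (n + m) * (real (n + m) / real n) + ?\<kappa>)
      \<longlonglongrightarrow> entropy_rate M S c + ?\<kappa>"
    by (auto intro!: tendsto_intros)
  show ?thesis
  proof (rule LIMSEQ_le[OF entropy_rate_limit[OF f] lim], intro exI[of _ 1] allI impI)
    fix n :: nat assume n: "1 \<le> n"
    have "code_entropy M (itinerary S f n) / real n
       \<le> (code_entropy M (itinerary S c (n + m)) + real n * ?\<kappa>) / real n"
      by (rule divide_right_mono[OF code_entropy_itinerary_le[OF f c]]) simp
    also have "\<dots> = code_entropy M (itinerary S c (n + m)) / real (n + m) * (real (n + m) / real n) + ?\<kappa>"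
      using n by (simp add: add_divide_distrib del: of_nat_add)
    finally show "code_entropy M (itinerary S f n) / real n
       \<le> code_entropy M (itinerary S c (n + m)) / real (n + m) * (real (n + m) / real n) + ?\<kappa>" .
  qed
qed

text \<open>A simple function is generating if every measurable set is approximated in measure by unions
  of fibres of its itineraries of finite length.\<close>

definition generating :: "('b \<Rightarrow> 'c) \<Rightarrow> bool" where
  "generating c \<longleftrightarrow> simple_function M c \<and> (\<forall>A\<in>sets M. \<forall>e>0. \<exists>m W.
     measure M (sym_diff A (itinerary S c m -` W \<inter> space M)) < e)"

lemma itinerary_refine:
  assumes "m \<le> k"
  shows "\<exists>W'. itinerary S c m -` W \<inter> space M = itinerary S c k -` W' \<inter> space M"
proof (intro exI)
  have "itinerary S c m x = take m (itinerary S c k x)" for x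
    using assms by (simp add: itinerary_def take_map)
  then show "itinerary S c m -` W \<inter> space M = itinerary S c k -` (take m -` W) \<inter> space M" by auto
qed

text \<open>Every simple function is approximated in probability by functions of long itineraries under a
  generating one.\<close>

lemma generating_approx_code:
  assumes c: "generating c" and f: "simple_function M f" and e: "0 < e"
  shows "\<exists>m g. (\<forall>w. g w \<in> f ` space M) \<and> measure M {x \<in> space M. f x \<noteq> g (itinerary S c m x)} < e"
proof -
  let ?V = "f ` space M"
  have V: "finite ?V" "?V \<noteq> {}" using f not_empty by (auto simp: simple_functionD)
  then have K: "0 < real (card ?V)" by (simp add: card_gt_0_iff)
  have "\<forall>v. \<exists>m W. measure M (sym_diff (f -` {v} \<inter> space M) (itinerary S c m -` W \<inter> space M)) < e / real (card ?V)"
    using c f e K unfolding generating_def by (auto simp: simple_functionD)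
  then obtain m0 W0 where W0: "\<And>v. measure M (sym_diff (f -` {v} \<inter> space M) (itinerary S c (m0 v) -` W0 v \<inter> space M)) < e / real (card ?V)"
    by metis
  define m where "m = Max (m0 ` ?V)"
  have "m0 v \<le> m" if "v \<in> ?V" for v unfolding m_def using V that by auto
  then have "\<forall>v\<in>?V. \<exists>W'. itinerary S c (m0 v) -` W0 v \<inter> space M = itinerary S c m -` W' \<inter> space M"
    by (intro ballI itinerary_refine) auto
  then obtain W where "\<And>v. v \<in> ?V \<Longrightarrow> itinerary S c (m0 v) -` W0 v \<inter> space M = itinerary S c m -` W v \<inter> space M"
    by metis
  with W0 have W: "measure M (sym_diff (f -` {v} \<inter> space M) (itinerary S c m -` W v \<inter> space M)) < e / real (card ?V)"
    if "v \<in> ?V" for v using that by metis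
  define g where "g w = (if \<exists>v\<in>?V. w \<in> W v then SOME v. v \<in> ?V \<and> w \<in> W v else (SOME v. v \<in> ?V))" for w
  have gV: "g w \<in> ?V" for w
  proof (cases "\<exists>v\<in>?V. w \<in> W v")
    case True
    then show ?thesis unfolding g_def using someI_ex[of "\<lambda>v. v \<in> ?V \<and> w \<in> W v"] by auto
  next
    case False
    then show ?thesis unfolding g_def using some_in_eq[of ?V] V by auto
  qed
  let ?E = "\<lambda>v. sym_diff (f -` {v} \<inter> space M) (itinerary S c m -` W v \<inter> space M)"
  have sets: "?E v \<in> sets M" for v
    using f c simple_function_itinerary[of c m] by (auto simp: simple_functionD generating_def)
  \<comment> \<open>Off the exceptional sets the itinerary lies in exactly one of the \<open>W v\<close>, namely in that of \<open>v = f x\<close>.\<close>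
  have "{x \<in> space M. f x \<noteq> g (itinerary S c m x)} \<subseteq> (\<Union>v\<in>?V. ?E v)"
  proof (intro subsetI, rule ccontr)
    fix x assume x: "x \<in> {x \<in> space M. f x \<noteq> g (itinerary S c m x)}" and n: "x \<notin> (\<Union>v\<in>?V. ?E v)"
    let ?w = "itinerary S c m x"
    have iff: "?w \<in> W v \<longleftrightarrow> f x = v" if "v \<in> ?V" for v using n x that by auto
    then have "\<exists>v\<in>?V. ?w \<in> W v" using x by auto
    then have "g ?w = (SOME v. v \<in> ?V \<and> ?w \<in> W v)" by (simp add: g_def)
    moreover have "(SOME v. v \<in> ?V \<and> ?w \<in> W v) = f x"
      by (rule some_equality) (use iff x in auto)
    ultimately show False using x by auto
  qed
  then have "measure M {x \<in> space M. f x \<noteq> g (itinerary S c m x)} \<le> measure M (\<Union>v\<in>?V. ?E v)"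
    by (intro finite_measure_mono sets.finite_UN V sets)
  also have "\<dots> \<le> (\<Sum>v\<in>?V. measure M (?E v))"
    by (intro finite_measure_subadditive_finite V image_subsetI sets)
  also have "\<dots> < (\<Sum>v\<in>?V. e / real (card ?V))"
    using V W by (intro sum_strict_mono) auto
  also have "\<dots> = e" using K by simp
  finally show ?thesis using gV by blast
qed

text \<open>If \<open>h j\<close> is a function of an itinerary and tends to \<open>f\<close> in probability, then the conditional
  entropy of \<open>f\<close> given \<open>h j\<close> tends to that of \<open>f\<close> given \<open>f\<close>, which is \<open>0\<close>.\<close>

lemma generating_cond_entropy_small:
  assumes c: "generating c" and f: "simple_function M f" and e: "0 < e"
  shows "\<exists>m. code_entropy M (\<lambda>x. (f x, itinerary S c m x)) - code_entropy M (itinerary S c m) < e"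
proof -
  let ?V = "f ` space M"
  have V: "finite ?V" using f by (auto simp: simple_functionD)
  have cs: "simple_function M c" using c by (simp add: generating_def)
  have "\<forall>j. \<exists>m g. (\<forall>w. g w \<in> ?V) \<and> measure M {x \<in> space M. f x \<noteq> g (itinerary S c m x)} < 1 / real (Suc j)"
    by (intro allI generating_approx_code[OF c f]) simp
  then obtain m g where g: "\<And>j w. g j w \<in> ?V"
    and small: "\<And>j. measure M {x \<in> space M. f x \<noteq> g j (itinerary S c (m j) x)} < 1 / real (Suc j)"
    by metis
  define h where "h j x = g j (itinerary S c (m j) x)" for j :: nat and x
  have hs: "simple_function M (h j)" for j
    using simple_function_compose[OF simple_function_itinerary[OF cs], of "g j"]
    by (simp add: comp_def h_def[abs_def])
  have lim: "(\<lambda>j. measure M {x \<in> space M. f x \<noteq> h j x}) \<longlonglongrightarrow> 0"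
    by (rule tendsto_sandwich[OF _ _ tendsto_const LIMSEQ_inverse_real_of_nat])
       (use small in \<open>auto simp: h_def inverse_eq_divide intro!: always_eventually less_imp_le\<close>)
  have "(\<lambda>j. code_entropy M (h j)) \<longlonglongrightarrow> code_entropy M f"
    by (rule code_entropy_tendsto[OF prob_space_axioms f hs V _ _ lim]) (use g in \<open>auto simp: h_def\<close>)
  moreover have "(\<lambda>j. code_entropy M (\<lambda>x. (f x, h j x))) \<longlonglongrightarrow> code_entropy M (\<lambda>x. (f x, f x))"
  proof (rule code_entropy_tendsto[OF prob_space_axioms simple_function_Pair[OF f f] simple_function_Pair[OF f hs]])
    show "finite (?V \<times> ?V)" using V by simp
    show "(\<lambda>j. measure M {x \<in> space M. (f x, f x) \<noteq> (f x, h j x)}) \<longlonglongrightarrow> 0" using lim by simp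
  qed (use g in \<open>auto simp: h_def\<close>)
  moreover have "code_entropy M (\<lambda>x. (f x, f x)) = code_entropy M f"
    by (rule code_entropy_cong_det[OF prob_space_axioms simple_function_Pair[OF f f] f]) simp
  ultimately have "(\<lambda>j. code_entropy M (\<lambda>x. (f x, h j x)) - code_entropy M (h j)) \<longlonglongrightarrow> 0"
    using tendsto_diff by fastforce
  then have "eventually (\<lambda>j. code_entropy M (\<lambda>x. (f x, h j x)) - code_entropy M (h j) < e) sequentially"
    using e by (rule order_tendstoD)
  then obtain j where j: "code_entropy M (\<lambda>x. (f x, h j x)) - code_entropy M (h j) < e"
    by (auto simp: eventually_sequentially)
  have "code_entropy M (\<lambda>x. (f x, itinerary S c (m j) x)) - code_entropy M (itinerary S c (m j))
     \<le> code_entropy M (\<lambda>x. (f x, h j x)) - code_entropy M (h j)"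
    by (rule code_entropy_cond_mono[OF prob_space_axioms f simple_function_itinerary[OF cs] hs]) (simp add: h_def)
  then show ?thesis using j by (intro exI[of _ "m j"]) linarith
qed

text \<open>The generator theorem of Kolmogorov and Sinai.\<close>

theorem KS_entropy_generating:
  assumes c: "generating c"
  shows "KS_entropy M S = ereal (entropy_rate M S c)"
proof (rule antisym)
  have cs: "simple_function M c" using c by (simp add: generating_def)
  show "ereal (entropy_rate M S c) \<le> KS_entropy M S" by (rule entropy_rate_le_KS_entropy[OF cs])
  show "KS_entropy M S \<le> ereal (entropy_rate M S c)"
  proof (rule KS_entropy_le)
    fix f :: "'b \<Rightarrow> 'b set" assume f: "simple_function M f"
    have "entropy_rate M S f \<le> entropy_rate M S c + e" if "0 < e" for e
      using generating_cond_entropy_small[OF c f that] entropy_rate_le_cond[OF f cs] 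
      by (meson add_left_mono less_imp_le order_trans)
    then show "ereal (entropy_rate M S f) \<le> ereal (entropy_rate M S c)"
      by (simp add: field_le_epsilon)
  qed
qed

end


section \<open>Convexity of entropy in the measure\<close>

lemma neg_xlnx_mix:
  fixes a b t :: real
  assumes a: "0 \<le> a" and b: "0 \<le> b" and t: "t \<in> {0..1}"
  shows "- (((1 - t) * a + t * b) * ln ((1 - t) * a + t * b))
    \<le> (1 - t) * - (a * ln a) + t * - (b * ln b) + a * - ((1 - t) * ln (1 - t)) + b * - (t * ln t)"
proof -
  have sub: "- ((x + y) * ln (x + y)) \<le> - (x * ln x) - y * ln y" if "0 \<le> x" "0 \<le> y" for x y :: real
  proof -
    have "x * ln x \<le> x * ln (x + y)" using that by (cases "x = 0") (auto intro!: mult_left_mono)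
    moreover have "y * ln y \<le> y * ln (x + y)" using that by (cases "y = 0") (auto intro!: mult_left_mono)
    ultimately show ?thesis by (simp add: algebra_simps)
  qed
  have prod: "s * c * ln (s * c) = s * (c * ln c) + c * (s * ln s)" if "0 \<le> s" "0 \<le> c" for s c :: real
    using that by (cases "s = 0 \<or> c = 0") (auto simp: ln_mult algebra_simps)
  show ?thesis
    using sub[of "(1 - t) * a" "t * b"] prod[of "1 - t" a] prod[of t b] assms by simp
qed

lemma measure_mix_measure:
  assumes M: "prob_space \<mu>" and N: "prob_space \<nu>" and sets: "sets \<nu> = sets \<mu>"
    and t: "t \<in> {0..1}" and A: "A \<in> sets \<mu>"
  shows "measure (mix_measure t \<mu> \<nu>) A = (1 - t) * measure \<mu> A + t * measure \<nu> A"
proof -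
  interpret M: prob_space \<mu> by fact
  interpret N: prob_space \<nu> by fact
  have "emeasure (mix_measure t \<mu> \<nu>) A = ennreal (1 - t) * ennreal (measure \<mu> A) + ennreal t * ennreal (measure \<nu> A)"
    unfolding emeasure_mix_measure[OF sets A] by (simp add: M.emeasure_eq_measure N.emeasure_eq_measure)
  also have "\<dots> = ennreal ((1 - t) * measure \<mu> A + t * measure \<nu> A)"
    using t by (subst ennreal_plus) (simp_all add: ennreal_mult)
  finally show ?thesis using t by (intro measure_eq_emeasure_eq_ennreal) auto
qed

text \<open>Mixing two measures raises the entropy above the weighted average by at most the entropy of the
  weights. This excess does not depend on the function, so it disappears in the rate.\<close>

lemma code_entropy_mix:
  assumes M: "prob_space \<mu>" and N: "prob_space \<nu>" and sets: "sets \<nu> = sets \<mu>"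
    and t: "t \<in> {0..1}" and f: "simple_function \<mu> f"
  shows "code_entropy (mix_measure t \<mu> \<nu>) f \<le> (1 - t) * code_entropy \<mu> f + t * code_entropy \<nu> f
    + (- ((1 - t) * ln (1 - t)) - t * ln t)"
proof -
  interpret M: prob_space \<mu> by fact
  interpret N: prob_space \<nu> by fact
  have sp: "space \<nu> = space \<mu>" using sets by (rule sets_eq_imp_space_eq)
  let ?V = "f ` space \<mu>"
  define a where "a v = measure \<mu> (f -` {v} \<inter> space \<mu>)" for v
  define b where "b v = measure \<nu> (f -` {v} \<inter> space \<mu>)" for v
  have fin: "finite ?V" and ms: "f -` {v} \<inter> space \<mu> \<in> sets \<mu>" for v
    using f by (auto simp: simple_functionD)
  have mix: "measure (mix_measure t \<mu> \<nu>) (f -` {v} \<inter> space \<mu>) = (1 - t) * a v + t * b v" for v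
    unfolding a_def b_def by (rule measure_mix_measure[OF M N sets t ms])
  have total: "(\<Sum>v\<in>?V. measure \<rho> (f -` {v} \<inter> space \<mu>)) = 1"
    if "prob_space \<rho>" "sets \<rho> = sets \<mu>" for \<rho>
  proof -
    interpret R: prob_space \<rho> by fact
    have "space \<rho> = (\<Union>v\<in>?V. f -` {v} \<inter> space \<mu>)" using sets_eq_imp_space_eq[OF that(2)] by auto
    then show ?thesis using R.prob_space
      by (subst R.finite_measure_finite_Union[symmetric])
         (use fin ms that(2) in \<open>auto simp: disjoint_family_on_def\<close>)
  qed
  have ab: "(\<Sum>v\<in>?V. a v) = 1" "(\<Sum>v\<in>?V. b v) = 1"
    unfolding a_def b_def using total M N sets by auto
  have "code_entropy (mix_measure t \<mu> \<nu>) f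
      = (\<Sum>v\<in>?V. - (((1 - t) * a v + t * b v) * ln ((1 - t) * a v + t * b v)))"
    by (simp add: code_entropy_def mix sum_negf)
  also have "\<dots> \<le> (\<Sum>v\<in>?V. (1 - t) * - (a v * ln (a v)) + t * - (b v * ln (b v))
      + a v * - ((1 - t) * ln (1 - t)) + b v * - (t * ln t))"
    by (intro sum_mono neg_xlnx_mix t) (auto simp: a_def b_def)
  also have "\<dots> = (1 - t) * (\<Sum>v\<in>?V. - (a v * ln (a v))) + t * (\<Sum>v\<in>?V. - (b v * ln (b v)))
      + (\<Sum>v\<in>?V. a v) * - ((1 - t) * ln (1 - t)) + (\<Sum>v\<in>?V. b v) * - (t * ln t)"
    by (simp only: sum.distrib sum_distrib_left sum_distrib_right)
  also have "\<dots> = (1 - t) * code_entropy \<mu> f + t * code_entropy \<nu> f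
    + (- ((1 - t) * ln (1 - t)) - t * ln t)"
    unfolding ab by (simp add: code_entropy_def sp a_def b_def sum_negf)
  finally show ?thesis .
qed

lemma entropy_rate_mix:
  assumes M: "measure_preserving \<mu> S" and N: "measure_preserving \<nu> S"
    and R: "measure_preserving (mix_measure t \<mu> \<nu>) S"
    and sets: "sets \<nu> = sets \<mu>" and t: "t \<in> {0..1}" and f: "simple_function \<mu> f"
  shows "entropy_rate (mix_measure t \<mu> \<nu>) S f \<le> (1 - t) * entropy_rate \<mu> S f + t * entropy_rate \<nu> S f"
proof -
  interpret M: measure_preserving \<mu> S by fact
  interpret N: measure_preserving \<nu> S by fact
  interpret R: measure_preserving "mix_measure t \<mu> \<nu>" S by fact
  let ?R = "mix_measure t \<mu> \<nu>" and ?K = "- ((1 - t) * ln (1 - t)) - t * ln t"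
  have fN: "simple_function \<nu> f" and fR: "simple_function ?R f"
    using f sets sets_eq_imp_space_eq[OF sets] by (simp_all add: simple_function_def)
  let ?h = "\<lambda>\<rho> n. code_entropy \<rho> (itinerary S f n) / real n"
  have "(\<lambda>n. (1 - t) * ?h \<mu> n + t * ?h \<nu> n + ?K / real n)
      \<longlonglongrightarrow> (1 - t) * entropy_rate \<mu> S f + t * entropy_rate \<nu> S f + 0"
    by (intro tendsto_intros M.entropy_rate_limit[OF f] N.entropy_rate_limit[OF fN] lim_const_over_n)
  moreover have "?h ?R n \<le> (1 - t) * ?h \<mu> n + t * ?h \<nu> n + ?K / real n" for n
  proof -
    have "?h ?R n \<le> ((1 - t) * code_entropy \<mu> (itinerary S f n) + t * code_entropy \<nu> (itinerary S f n) + ?K) / real n"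
      by (intro divide_right_mono code_entropy_mix M.prob_space_axioms N.prob_space_axioms
          M.simple_function_itinerary f sets t) simp
    also have "\<dots> = (1 - t) * ?h \<mu> n + t * ?h \<nu> n + ?K / real n"
      by (simp add: add_divide_distrib diff_divide_distrib)
    finally show ?thesis .
  qed
  ultimately have "entropy_rate ?R S f \<le> (1 - t) * entropy_rate \<mu> S f + t * entropy_rate \<nu> S f + 0"
    by (intro LIMSEQ_le[OF R.entropy_rate_limit[OF fR]]) auto
  then show ?thesis by simp
qed

section \<open>Weak convergence on a compact metric space\<close>

lemma prob_measuresD:
  assumes "\<nu> \<in> prob_measures Y"
  shows "prob_space \<nu>" "sets \<nu> = sets (restrict_space borel Y)" "space \<nu> = Y"
  using assms space_prob_measures[OF assms] by (auto simp: prob_measures_def)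

lemma prob_measures_continuous:
  fixes f :: "'b::metric_space \<Rightarrow> real"
  assumes Y: "compact Y" and \<nu>: "\<nu> \<in> prob_measures Y" and f: "continuous_on Y f"
  shows "f \<in> borel_measurable \<nu>" "integrable \<nu> f"
proof -
  interpret prob_space \<nu> using \<nu> by (rule prob_measuresD)
  show m: "f \<in> borel_measurable \<nu>"
    using borel_measurable_continuous_on_restrict[OF f] prob_measuresD(2)[OF \<nu>]
    by (simp cong: measurable_cong_sets)
  have "bounded (f ` Y)" using compact_continuous_image[OF f Y] by (rule compact_imp_bounded)
  then obtain B where "\<And>x. x \<in> Y \<Longrightarrow> norm (f x) \<le> B" by (auto simp: bounded_iff)
  then show "integrable \<nu> f"
    using m by (intro integrable_const_bound[of _ B]) (auto simp: prob_measuresD(3)[OF \<nu>])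
qed

lemma closed_Int_sets:
  assumes "\<nu> \<in> prob_measures Y" "closed C"
  shows "C \<inter> Y \<in> sets \<nu>"
  unfolding prob_measuresD(2)[OF assms(1)] sets_restrict_space
  using assms(2) by (intro image_eqI[of _ _ C]) (simp_all add: Int_commute)

text \<open>Convergence of a sequence in the weak-star topology, stated through integrals.\<close>

definition weakly_converges :: "'b::metric_space set \<Rightarrow> (nat \<Rightarrow> 'b measure) \<Rightarrow> 'b measure \<Rightarrow> bool" where
  "weakly_converges Y \<nu>s \<nu> \<longleftrightarrow>
     (\<forall>f :: 'b \<Rightarrow> real. continuous_on Y f \<longrightarrow> (\<lambda>n. \<integral>x. f x \<partial>\<nu>s n) \<longlonglongrightarrow> (\<integral>x. f x \<partial>\<nu>))"

text \<open>Continuous functions that decrease to the indicator of a closed set.\<close>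

lemma bump_tendsto:
  assumes C: "closed C" "C \<noteq> {}"
  shows "(\<lambda>k. max 0 (1 - real k * infdist x C)) \<longlonglongrightarrow> indicat_real C x"
proof (cases "x \<in> C")
  case False
  then have d: "0 < infdist x C"
    using in_closed_iff_infdist_zero[OF C] infdist_nonneg[of x C] by (simp add: less_le)
  have "eventually (\<lambda>k. max 0 (1 - real k * infdist x C) = 0) sequentially"
  proof -
    obtain N :: nat where N: "real N > 1 / infdist x C" using reals_Archimedean2 by blast
    show ?thesis
      using eventually_ge_at_top[of N]
    proof eventually_elim
      case (elim k)
      then have "1 / infdist x C < real k" using N by linarith
      then show ?case using d by (simp add: field_simps)
    qed
  qed
  then show ?thesis using False by (simp add: tendsto_eventually)
qed simp

lemma bump_integral_tendsto:
  fixes Y :: "'b::metric_space set"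
  assumes Y: "compact Y" and \<nu>: "\<nu> \<in> prob_measures Y" and C: "closed C" "C \<noteq> {}"
  shows "(\<lambda>k. \<integral>x. max 0 (1 - real k * infdist x C) \<partial>\<nu>) \<longlonglongrightarrow> measure \<nu> (C \<inter> Y)"
proof -
  interpret prob_space \<nu> using \<nu> by (rule prob_measuresD)
  have sp: "space \<nu> = Y" by (rule prob_measuresD(3)[OF \<nu>])
  have cont: "continuous_on Y (\<lambda>x. max 0 (1 - real k * infdist x C))" for k
    by (intro continuous_intros)
  have "(\<lambda>k. \<integral>x. max 0 (1 - real k * infdist x C) \<partial>\<nu>) \<longlonglongrightarrow> (\<integral>x. indicat_real (C \<inter> Y) x \<partial>\<nu>)"
  proof (rule integral_dominated_convergence[where w="\<lambda>_. 1"])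
    show "indicat_real (C \<inter> Y) \<in> borel_measurable \<nu>"
      by (intro borel_measurable_indicator closed_Int_sets[OF \<nu> C(1)])
    show "(\<lambda>x. max 0 (1 - real k * infdist x C)) \<in> borel_measurable \<nu>" for k
      by (rule prob_measures_continuous(1)[OF Y \<nu> cont])
    show "AE x in \<nu>. (\<lambda>k. max 0 (1 - real k * infdist x C)) \<longlonglongrightarrow> indicat_real (C \<inter> Y) x"
      using bump_tendsto[OF C] by (intro AE_I2) (simp add: sp indicator_inter_arith)
    show "AE x in \<nu>. norm (max 0 (1 - real k * infdist x C)) \<le> 1" for k
      by (intro AE_I2) (auto simp: infdist_nonneg)
  qed simp
  then show ?thesis using closed_Int_sets[OF \<nu> C(1)] by simp
qed

text \<open>The portmanteau inequality: the mass of a closed set is upper semicontinuous.\<close>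

lemma weakly_converges_closed:
  fixes Y :: "'b::metric_space set"
  assumes Y: "compact Y" and \<nu>s: "\<And>n. \<nu>s n \<in> prob_measures Y" and \<nu>: "\<nu> \<in> prob_measures Y"
    and conv: "weakly_converges Y \<nu>s \<nu>" and C: "closed C" and a: "measure \<nu> (C \<inter> Y) < a"
  shows "eventually (\<lambda>n. measure (\<nu>s n) (C \<inter> Y) < a) sequentially"
proof (cases "C = {}")
  case True
  then show ?thesis using a by simp
next
  case False
  let ?f = "\<lambda>k x. max 0 (1 - real k * infdist x C)"
  have cont: "continuous_on Y (?f k)" for k by (intro continuous_intros)
  have "eventually (\<lambda>k. (\<integral>x. ?f k x \<partial>\<nu>) < a) sequentially"
    by (rule order_tendstoD(2)[OF bump_integral_tendsto[OF Y \<nu> C False] a])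
  then obtain k where k: "(\<integral>x. ?f k x \<partial>\<nu>) < a" by (auto simp: eventually_sequentially)
  have "(\<lambda>n. \<integral>x. ?f k x \<partial>\<nu>s n) \<longlonglongrightarrow> (\<integral>x. ?f k x \<partial>\<nu>)"
    using conv cont unfolding weakly_converges_def by blast
  then have "eventually (\<lambda>n. (\<integral>x. ?f k x \<partial>\<nu>s n) < a) sequentially"
    using k by (rule order_tendstoD(2))
  then show ?thesis
  proof eventually_elim
    case (elim n)
    interpret prob_space "\<nu>s n" by (rule prob_measuresD[OF \<nu>s])
    have "measure (\<nu>s n) (C \<inter> Y) = (\<integral>x. indicat_real (C \<inter> Y) x \<partial>\<nu>s n)"
      using closed_Int_sets[OF \<nu>s C] by simp
    also have "\<dots> \<le> (\<integral>x. ?f k x \<partial>\<nu>s n)"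
      using closed_Int_sets[OF \<nu>s C, of n] 
      by (intro integral_mono prob_measures_continuous(2)[OF Y \<nu>s cont])
         (auto split: split_indicator simp: integrable_indicator_iff emeasure_eq_measure)
    finally show ?case using elim by simp
  qed
qed

lemma prob_measures_eqI:
  assumes \<mu>: "\<mu> \<in> prob_measures Y" and \<nu>: "\<nu> \<in> prob_measures Y"
    and E: "Int_stable E" "E \<subseteq> Pow Y" "sets (restrict_space borel Y) = sigma_sets Y E"
    and eq: "\<And>A. A \<in> E \<Longrightarrow> measure \<mu> A = measure \<nu> A"
  shows "\<mu> = \<nu>"
proof -
  interpret M: prob_space \<mu> using \<mu> by (rule prob_measuresD)
  interpret N: prob_space \<nu> using \<nu> by (rule prob_measuresD)
  note sp = prob_measuresD(3)[OF \<mu>] prob_measuresD(3)[OF \<nu>]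
  have sig: "sigma_sets Y (insert Y E) = sigma_sets Y E"
  proof (rule sigma_sets_eqI)
    fix A assume "A \<in> insert Y E"
    then show "A \<in> sigma_sets Y E" by (auto intro: sigma_sets_top)
  qed auto
  show ?thesis
  proof (rule measure_eqI_generator_eq[where E="insert Y E" and \<Omega>=Y and A="\<lambda>_. Y"])
    show "Int_stable (insert Y E)"
      using E(1,2) by (auto simp: Int_stable_def Int_absorb1 Int_absorb2)
    show "emeasure \<mu> X = emeasure \<nu> X" if "X \<in> insert Y E" for X
      using that eq M.prob_space N.prob_space sp by (auto simp: M.emeasure_eq_measure N.emeasure_eq_measure)
    show "sets \<mu> = sigma_sets Y (insert Y E)" "sets \<nu> = sigma_sets Y (insert Y E)"
      unfolding sig prob_measuresD(2)[OF \<mu>] prob_measuresD(2)[OF \<nu>] by (rule E(3))+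
  qed (use E in \<open>auto simp: M.emeasure_eq_measure\<close>)
qed

lemma sets_restrict_space_closed:
  fixes Y :: "'b::metric_space set"
  assumes "closed Y"
  shows "sets (restrict_space borel Y) = sigma_sets Y {C \<inter> Y |C. closed C}"
proof -
  have "sets (restrict_space borel Y) = (\<inter>) Y ` sigma_sets UNIV (Collect closed)"
    unfolding sets_restrict_space borel_eq_closed by simp
  also have "\<dots> = sigma_sets Y ((\<inter>) Y ` Collect closed)"
    by (rule sigma_sets_Int) (use assms in auto)
  also have "(\<inter>) Y ` Collect closed = {C \<inter> Y |C. closed C}" by auto
  finally show ?thesis .
qed

lemma prob_measures_eqI_continuous:
  fixes Y :: "'b::metric_space set"
  assumes Y: "compact Y" and \<mu>: "\<mu> \<in> prob_measures Y" and \<nu>: "\<nu> \<in> prob_measures Y"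
    and eq: "\<And>f :: 'b \<Rightarrow> real. continuous_on Y f \<Longrightarrow> (\<integral>x. f x \<partial>\<mu>) = (\<integral>x. f x \<partial>\<nu>)"
  shows "\<mu> = \<nu>"
proof (rule prob_measures_eqI[OF \<mu> \<nu> _ _ sets_restrict_space_closed])
  show "Int_stable {C \<inter> Y |C. closed C}"
    unfolding Int_stable_def
  proof clarify
    fix C D :: "'b set" assume "closed C" "closed D"
    then show "\<exists>E. C \<inter> Y \<inter> (D \<inter> Y) = E \<inter> Y \<and> closed E" by (intro exI[of _ "C \<inter> D"]) auto
  qed
  show "measure \<mu> A = measure \<nu> A" if "A \<in> {C \<inter> Y |C. closed C}" for A
  proof -
    from that obtain C where C: "A = C \<inter> Y" "closed C" by auto
    show ?thesis
    proof (cases "C = {}")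
      case False
      have "(\<integral>x. max 0 (1 - real k * infdist x C) \<partial>\<mu>) = (\<integral>x. max 0 (1 - real k * infdist x C) \<partial>\<nu>)" for k
        by (intro eq continuous_intros)
      then show ?thesis
        using bump_integral_tendsto[OF Y \<mu> C(2) False] bump_integral_tendsto[OF Y \<nu> C(2) False]
        unfolding C by (simp add: LIMSEQ_unique)
    qed (simp add: C)
  qed
qed (use Y in \<open>auto intro: compact_imp_closed\<close>)

lemma weakly_converges_limitin:
  assumes "\<And>n. \<nu>s n \<in> prob_measures Y" "\<nu> \<in> prob_measures Y" "weakly_converges Y \<nu>s \<nu>"
  shows "limitin (weak_star Y) \<nu>s \<nu> sequentially"
  unfolding limitin_def topspace_weak_star
proof (intro conjI allI impI)
  fix U assume U: "openin (weak_star Y) U \<and> \<nu> \<in> U"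
  have "generate_topology_on {{\<nu> \<in> prob_measures Y. (\<integral>x. f x \<partial>\<nu>) \<in> U} |f U.
        continuous_on Y (f :: 'a \<Rightarrow> real) \<and> open U} U"
    using U unfolding weak_star_def openin_topology_generated_by_iff by simp
  then have "\<nu> \<in> U \<longrightarrow> eventually (\<lambda>n. \<nu>s n \<in> U) sequentially"
  proof (induction rule: generate_topology_on.induct)
    case (Int a b)
    then show ?case by (auto intro: eventually_conj)
  next
    case (UN K)
    then show ?case by (blast intro: eventually_mono)
  next
    case (Basis s)
    then obtain f V where s: "s = {\<nu> \<in> prob_measures Y. (\<integral>x. f x \<partial>\<nu>) \<in> V}"
      and f: "continuous_on Y (f :: 'a \<Rightarrow> real)" "open V" by auto
    have "(\<lambda>n. \<integral>x. f x \<partial>\<nu>s n) \<longlonglongrightarrow> (\<integral>x. f x \<partial>\<nu>)"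
      using assms(3) f unfolding weakly_converges_def by blast
    then show ?case using f(2) assms(1) unfolding s by (auto dest: topological_tendstoD)
  qed simp
  then show "eventually (\<lambda>n. \<nu>s n \<in> U) sequentially" using U by simp
qed (use assms in simp)

lemma weakly_converges_continuous_map:
  assumes "\<And>n. \<nu>s n \<in> prob_measures Y" "\<nu> \<in> prob_measures Y" "weakly_converges Y \<nu>s \<nu>"
    and E: "continuous_map (weak_star Y) euclideanreal E"
  shows "(\<lambda>n. E (\<nu>s n)) \<longlonglongrightarrow> E \<nu>"
  using continuous_map_limit[OF E weakly_converges_limitin[OF assms(1-3)]]
  by (simp add: comp_def)

section \<open>Sequential compactness of the space of probability measures\<close>

text \<open>A sequence of closed balls such that membership in sufficiently many of them determines a point up
  to any prescribed error, and each point lies in arbitrarily small ones.\<close>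

lemma compact_ball_sequence:
  fixes Y :: "'b::metric_space set"
  assumes Y: "compact Y" "Y \<noteq> {}"
  obtains C :: "nat \<Rightarrow> 'b set" where "\<And>m. closed (C m)"
    and "\<And>\<delta>. 0 < \<delta> \<Longrightarrow> \<exists>N. \<forall>y\<in>Y. \<forall>z\<in>Y. (\<forall>m<N. y \<in> C m \<longleftrightarrow> z \<in> C m) \<longrightarrow> dist y z < \<delta>"
    and "\<And>y e. y \<in> Y \<Longrightarrow> 0 < e \<Longrightarrow> \<exists>m. y \<in> C m \<and> C m \<subseteq> ball y e"
proof -
  have "\<exists>k. finite k \<and> k \<subseteq> Y \<and> Y \<subseteq> (\<Union>x\<in>k. ball x (1 / real (Suc n)))" for n
    using seq_compact_imp_totally_bounded[OF compact_imp_seq_compact[OF Y(1)]] by simp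
  then obtain K where K: "\<And>n. finite (K n)" "\<And>n. K n \<subseteq> Y" "\<And>n. Y \<subseteq> (\<Union>x\<in>K n. ball x (1 / real (Suc n)))"
    by metis
  define I where "I = (\<Union>n. K n \<times> {n})"
  have "countable I" unfolding I_def by (intro countable_UN) (simp_all add: K countable_finite)
  moreover have "I \<noteq> {}" using K(3)[of 0] Y(2) by (auto simp: I_def)
  ultimately have rng: "range (from_nat_into I) = I" by (rule range_from_nat_into[rotated])
  define C where "C m = (case from_nat_into I m of (x, n) \<Rightarrow> cball x (1 / real (Suc n)))" for m
  have idx: "\<exists>m. from_nat_into I m = (x, n)" if "x \<in> K n" for x n
  proof -
    have "(x, n) \<in> range (from_nat_into I)" using that rng by (auto simp: I_def)
    then show ?thesis by force
  qed
  obtain i where i: "\<And>x n. x \<in> K n \<Longrightarrow> from_nat_into I (i x n) = (x, n)" using idx by metis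
  have scale: "\<exists>n. 2 / real (Suc n) < \<delta>" if \<delta>: "0 < \<delta>" for \<delta>
  proof -
    obtain n where "1 / real (Suc n) < \<delta> / 2" using nat_approx_posE[OF half_gt_zero[OF \<delta>]] by blast
    then show ?thesis by (intro exI[of _ n]) simp
  qed
  show thesis
  proof
    show "closed (C m)" for m by (simp add: C_def split: prod.split)
  next
    fix \<delta> :: real assume "0 < \<delta>"
    then obtain n where n: "2 / real (Suc n) < \<delta>" using scale by blast
    define N where "N = Suc (Max ((\<lambda>x. i x n) ` K n))"
    have N: "i x n < N" if "x \<in> K n" for x
      unfolding N_def less_Suc_eq_le using that K(1) by (intro Max_ge) auto
    show "\<exists>N. \<forall>y\<in>Y. \<forall>z\<in>Y. (\<forall>m<N. y \<in> C m \<longleftrightarrow> z \<in> C m) \<longrightarrow> dist y z < \<delta>"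
    proof (intro exI[of _ N] ballI impI)
      fix y z assume y: "y \<in> Y" and z: "z \<in> Y" and eq: "\<forall>m<N. y \<in> C m \<longleftrightarrow> z \<in> C m"
      obtain x where x: "x \<in> K n" "dist x y < 1 / real (Suc n)" using K(3) y by fastforce
      have "y \<in> C (i x n)" using x i by (simp add: C_def)
      then have "z \<in> C (i x n)" using eq N x by blast
      then have "dist x z \<le> 1 / real (Suc n)" using x i by (simp add: C_def)
      then have "dist y z < 2 / real (Suc n)" using x(2) dist_triangle3[of y z x] by simp
      then show "dist y z < \<delta>" using n by simp
    qed
  next
    fix y and e :: real assume y: "y \<in> Y" and "0 < e"
    then obtain n where n: "2 / real (Suc n) < e" using scale by blast
    obtain x where x: "x \<in> K n" "dist x y < 1 / real (Suc n)" using K(3) y by fastforce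
    have "C (i x n) \<subseteq> ball y e"
    proof
      fix z assume "z \<in> C (i x n)"
      then have "dist x z \<le> 1 / real (Suc n)" using x i by (simp add: C_def)
      then have "dist y z < 2 / real (Suc n)" using x(2) dist_triangle3[of y z x] by simp
      then show "z \<in> ball y e" using n by simp
    qed
    moreover have "y \<in> C (i x n)" using x i by (simp add: C_def)
    ultimately show "\<exists>m. y \<in> C m \<and> C m \<subseteq> ball y e" by blast
  qed
qed

text \<open>The point of the Cantor middle-thirds set with the given digits \<open>0\<close> and \<open>2\<close>. Its first \<open>N\<close>
  digits are determined by the point up to an error less than \<open>1 / 3 ^ N\<close>.\<close>

definition ternary :: "(nat \<Rightarrow> bool) \<Rightarrow> real" where
  "ternary a = (\<Sum>m. (if a m then 2 else 0) / 3 ^ Suc m)"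

lemma ternary_geometric: "(\<lambda>n. 2 / 3 ^ (n + Suc k) :: real) sums (1 / 3 ^ k)"
proof -
  have "(\<lambda>n. (1 / 3 :: real) ^ n) sums (1 / (1 - 1 / 3))" by (rule geometric_sums) simp
  from sums_mult[OF this, of "2 / 3 ^ Suc k"] show ?thesis
    by (simp add: power_add field_simps)
qed

lemma ternary_summable: "summable (\<lambda>m. (if a m then 2 else 0) / 3 ^ Suc m :: real)"
  by (rule summable_comparison_test'[OF sums_summable[OF ternary_geometric[of 0]], of 0]) auto

lemma ternary_bounds: "ternary a \<in> {0..1}"
proof -
  have "ternary a \<le> (\<Sum>m. 2 / 3 ^ Suc m)"
    unfolding ternary_def
    by (rule suminf_le[OF _ ternary_summable]) (use sums_summable[OF ternary_geometric[of 0]] in auto)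
  also have "\<dots> = 1" using sums_unique[OF ternary_geometric[of 0]] by simp
  finally show ?thesis using suminf_nonneg[OF ternary_summable[of a]] by (simp add: ternary_def)
qed

lemma ternary_digits:
  assumes close: "\<bar>ternary a - ternary b\<bar> < 1 / 3 ^ N" and m: "m < N"
  shows "a m = b m"
proof (rule ccontr)
  assume "a m \<noteq> b m"
  \<comment> \<open>At the first differing digit the gap is \<open>2 / 3 ^ Suc k\<close>, and all later digits can undo only half of it.\<close>
  define k where "k = (LEAST m. a m \<noteq> b m)"
  have k: "a k \<noteq> b k" unfolding k_def by (rule LeastI) fact
  have km: "k \<le> m" unfolding k_def by (rule Least_le) fact
  have eq: "a i = b i" if "i < k" for i using not_less_Least that unfolding k_def by blast
  define d :: "nat \<Rightarrow> real" where "d i = (if a i then 2 else 0) / 3 ^ Suc i - (if b i then 2 else 0) / 3 ^ Suc i" for i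
  have sd: "summable d" unfolding d_def by (intro summable_diff ternary_summable)
  have bd: "norm (d i) \<le> 2 / 3 ^ Suc i" for i by (simp add: d_def)
  have "ternary a - ternary b = suminf d"
    unfolding ternary_def d_def by (rule suminf_diff[OF ternary_summable ternary_summable])
  also have "\<dots> = (\<Sum>i. d (i + Suc k)) + (\<Sum>i<Suc k. d i)"
    by (rule suminf_split_initial_segment[OF sd])
  also have "(\<Sum>i<Suc k. d i) = d k" using eq by (simp add: d_def)
  finally have diff: "ternary a - ternary b = (\<Sum>i. d (i + Suc k)) + d k" .
  have "norm (\<Sum>i. d (i + Suc k)) \<le> (\<Sum>i. 2 / 3 ^ (i + Suc (Suc k)))"
    by (rule norm_suminf_le) (use bd[of "_ + Suc k"] sums_summable[OF ternary_geometric[of "Suc k"]] in auto)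
  also have "\<dots> = 1 / 3 ^ Suc k" using sums_unique[OF ternary_geometric[of "Suc k"]] by simp
  finally have "\<bar>\<Sum>i. d (i + Suc k)\<bar> \<le> 1 / 3 ^ Suc k" by simp
  moreover have "\<bar>d k\<bar> = 2 / 3 ^ Suc k" using k by (auto simp: d_def)
  ultimately have "\<bar>ternary a - ternary b\<bar> \<ge> 2 / 3 ^ Suc k - 1 / 3 ^ Suc k" unfolding diff by linarith
  then have "\<bar>ternary a - ternary b\<bar> \<ge> 1 / 3 ^ Suc k" by (simp add: diff_divide_distrib[symmetric])
  moreover have "(1::real) / 3 ^ N \<le> 1 / 3 ^ Suc k"
    using km m by (intro divide_left_mono power_increasing) auto
  ultimately show False using close by linarith
qed

text \<open>A Borel map into the unit interval, in general not continuous, that is injective on \<open>Y\<close> with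
  uniformly continuous inverse. Its digits record the membership in the balls of
  \<open>compact_ball_sequence\<close>.\<close>

lemma compact_real_code:
  fixes Y :: "'b::metric_space set"
  assumes Y: "compact Y" "Y \<noteq> {}"
  obtains s :: "'b \<Rightarrow> real" where "s \<in> borel_measurable (restrict_space borel Y)" "\<And>y. s y \<in> {0..1}"
    and "\<And>\<delta>. 0 < \<delta> \<Longrightarrow> \<exists>\<gamma>>0. \<forall>y\<in>Y. \<forall>z\<in>Y. \<bar>s y - s z\<bar> < \<gamma> \<longrightarrow> dist y z < \<delta>"
proof -
  obtain C :: "nat \<Rightarrow> 'b set" where C: "\<And>m. closed (C m)"
    and sep: "\<And>\<delta>. 0 < \<delta> \<Longrightarrow> \<exists>N. \<forall>y\<in>Y. \<forall>z\<in>Y. (\<forall>m<N. y \<in> C m \<longleftrightarrow> z \<in> C m) \<longrightarrow> dist y z < \<delta>"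
    using compact_ball_sequence[OF Y] by metis
  define s where "s y = ternary (\<lambda>m. y \<in> C m)" for y
  show thesis
  proof
    have "(\<lambda>y. (if y \<in> C m then 2 else 0) / 3 ^ Suc m :: real) \<in> borel_measurable (restrict_space borel Y)" for m
      using C[of m] by (intro measurable_restrict_space1) measurable
    then show "s \<in> borel_measurable (restrict_space borel Y)"
      unfolding s_def[abs_def] ternary_def by (rule borel_measurable_suminf)
    show "s y \<in> {0..1}" for y unfolding s_def by (rule ternary_bounds)
    fix \<delta> :: real assume "0 < \<delta>"
    then obtain N where N: "\<forall>y\<in>Y. \<forall>z\<in>Y. (\<forall>m<N. y \<in> C m \<longleftrightarrow> z \<in> C m) \<longrightarrow> dist y z < \<delta>" using sep by blast
    show "\<exists>\<gamma>>0. \<forall>y\<in>Y. \<forall>z\<in>Y. \<bar>s y - s z\<bar> < \<gamma> \<longrightarrow> dist y z < \<delta>"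
    proof (intro exI[of _ "1 / 3 ^ N"] conjI ballI impI)
      fix y z assume "y \<in> Y" "z \<in> Y" "\<bar>s y - s z\<bar> < 1 / 3 ^ N"
      then show "dist y z < \<delta>" using N ternary_digits[of "\<lambda>m. y \<in> C m" "\<lambda>m. z \<in> C m" N] unfolding s_def by blast
    qed simp
  qed
qed

text \<open>The inverse extends continuously to the closure of the image, by compactness of \<open>Y\<close>.\<close>

lemma real_code_inverse:
  fixes Y :: "'b::metric_space set" and s :: "'b \<Rightarrow> real"
  assumes Y: "compact Y"
    and s: "\<And>\<delta>. 0 < \<delta> \<Longrightarrow> \<exists>\<gamma>>0. \<forall>y\<in>Y. \<forall>z\<in>Y. \<bar>s y - s z\<bar> < \<gamma> \<longrightarrow> dist y z < \<delta>"
  obtains q where "continuous_on (closure (s ` Y)) q" "q ` closure (s ` Y) \<subseteq> Y" "\<And>y. y \<in> Y \<Longrightarrow> q (s y) = y"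
proof -
  let ?K = "closure (s ` Y)"
  have "\<exists>y\<in>Y. \<forall>e>0. \<exists>z\<in>Y. \<bar>s z - t\<bar> < e \<and> dist z y < e" if t: "t \<in> ?K" for t
  proof -
    obtain u where u: "\<And>n. u n \<in> s ` Y" "u \<longlonglongrightarrow> t" using t unfolding closure_sequential by auto
    then have "\<forall>n. \<exists>y\<in>Y. u n = s y" by auto
    then obtain v where v: "\<And>n. v n \<in> Y" "\<And>n. u n = s (v n)" by metis
    obtain y r where y: "y \<in> Y" "strict_mono r" "(v \<circ> r) \<longlonglongrightarrow> y"
      using Y v(1) unfolding compact_eq_seq_compact_metric seq_compact_def by metis
    show ?thesis
    proof (rule bexI[OF _ y(1)], intro allI impI)
      fix e :: real assume e: "0 < e"
      have "eventually (\<lambda>n. dist (v (r n)) y < e) sequentially" using tendstoD[OF y(3) e] by simp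
      moreover have "eventually (\<lambda>n. dist (u (r n)) t < e) sequentially"
        using tendstoD[OF LIMSEQ_subseq_LIMSEQ[OF u(2) y(2)] e] by simp
      ultimately have "eventually (\<lambda>n. dist (v (r n)) y < e \<and> dist (u (r n)) t < e) sequentially"
        by (rule eventually_conj)
      then obtain n where "dist (v (r n)) y < e" "dist (u (r n)) t < e" by (auto simp: eventually_sequentially)
      then show "\<exists>z\<in>Y. \<bar>s z - t\<bar> < e \<and> dist z y < e"
        using v by (intro bexI[of _ "v (r n)"]) (auto simp: dist_real_def)
    qed
  qed
  then obtain q where q: "\<And>t. t \<in> ?K \<Longrightarrow> q t \<in> Y"
    and app: "\<And>t e. t \<in> ?K \<Longrightarrow> 0 < e \<Longrightarrow> \<exists>z\<in>Y. \<bar>s z - t\<bar> < e \<and> dist z (q t) < e"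
    by metis
  have near: "\<exists>\<gamma>>0. \<forall>t\<in>?K. \<forall>t'\<in>?K. \<bar>t - t'\<bar> < \<gamma> \<longrightarrow> dist (q t) (q t') < \<delta>" if \<delta>: "0 < \<delta>" for \<delta>
  proof -
    obtain \<gamma> where \<gamma>: "\<gamma> > 0" "\<And>y z. y \<in> Y \<Longrightarrow> z \<in> Y \<Longrightarrow> \<bar>s y - s z\<bar> < \<gamma> \<Longrightarrow> dist y z < \<delta> / 3"
      using s[of "\<delta> / 3"] \<delta> by auto
    show ?thesis
    proof (intro exI[of _ "\<gamma> / 3"] conjI ballI impI)
      fix t t' assume t: "t \<in> ?K" "t' \<in> ?K" "\<bar>t - t'\<bar> < \<gamma> / 3"
      define e where "e = min (\<gamma> / 3) (\<delta> / 3)"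
      have e: "0 < e" "e \<le> \<gamma> / 3" "e \<le> \<delta> / 3" using \<gamma> \<delta> by (auto simp: e_def)
      obtain z where z: "z \<in> Y" "\<bar>s z - t\<bar> < e" "dist z (q t) < e" using app[OF t(1) e(1)] by auto
      obtain z' where z': "z' \<in> Y" "\<bar>s z' - t'\<bar> < e" "dist z' (q t') < e" using app[OF t(2) e(1)] by auto
      have "\<bar>s z - s z'\<bar> < \<gamma>" using z z' t e by linarith
      then have "dist z z' < \<delta> / 3" using \<gamma> z z' by blast
      moreover have "dist (q t) (q t') \<le> dist z (q t) + dist z z' + dist z' (q t')"
        by metric
      ultimately show "dist (q t) (q t') < \<delta>" using z z' e by linarith
    qed (use \<gamma> in simp)
  qed
  show thesis
  proof
    show "q ` ?K \<subseteq> Y" using q by auto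
    show "continuous_on ?K q"
      unfolding continuous_on_iff
    proof (intro ballI allI impI)
      fix t and \<delta> :: real assume t: "t \<in> ?K" and "0 < \<delta>"
      then obtain \<gamma> where "\<gamma> > 0" "\<forall>t\<in>?K. \<forall>t'\<in>?K. \<bar>t - t'\<bar> < \<gamma> \<longrightarrow> dist (q t) (q t') < \<delta>"
        using near by blast
      then show "\<exists>d>0. \<forall>x'\<in>?K. dist x' t < d \<longrightarrow> dist (q x') (q t) < \<delta>"
        using t by (intro exI[of _ \<gamma>]) (auto simp: dist_real_def)
    qed
    fix y assume y: "y \<in> Y"
    have K: "s y \<in> ?K" using y closure_subset[of "s ` Y"] by blast
    have "dist (q (s y)) y < \<delta>" if \<delta>: "0 < \<delta>" for \<delta>
    proof -
      obtain \<gamma> where \<gamma>: "\<gamma> > 0" "\<And>y z. y \<in> Y \<Longrightarrow> z \<in> Y \<Longrightarrow> \<bar>s y - s z\<bar> < \<gamma> \<Longrightarrow> dist y z < \<delta> / 2"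
        using s[of "\<delta> / 2"] \<delta> by auto
      obtain z where z: "z \<in> Y" "\<bar>s z - s y\<bar> < min \<gamma> (\<delta> / 2)" "dist z (q (s y)) < min \<gamma> (\<delta> / 2)"
        using app[OF K, of "min \<gamma> (\<delta> / 2)"] \<gamma> \<delta> by auto
      have "dist z y < \<delta> / 2" using \<gamma> z y by auto
      then show ?thesis using z(3) dist_triangle3[of "q (s y)" y z] by simp
    qed
    then show "q (s y) = y" by (metis dist_self less_irrefl zero_less_dist_iff)
  qed
qed

text \<open>The images of the measures on the real line are tight, so by Helly's theorem a subsequence
  converges weakly. The limit is carried by the closure of the image of \<open>Y\<close> and is transported
  back to \<open>Y\<close> by the extended inverse \<open>q\<close>.\<close>

theorem prob_measures_seq_compact:
  fixes Y :: "'b::metric_space set"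
  assumes Y: "compact Y" and \<nu>s: "\<And>n. \<nu>s n \<in> prob_measures Y"
  obtains r \<nu> where "strict_mono (r :: nat \<Rightarrow> nat)" "\<nu> \<in> prob_measures Y" "weakly_converges Y (\<nu>s \<circ> r) \<nu>"
proof -
  have ne: "Y \<noteq> {}"
    using prob_space.not_empty[OF prob_measuresD(1)[OF \<nu>s]] prob_measuresD(3)[OF \<nu>s] by simp
  obtain s :: "'b \<Rightarrow> real" where sm: "s \<in> borel_measurable (restrict_space borel Y)"
    and s01: "\<And>y. s y \<in> {0..1}"
    and s: "\<And>\<delta>. 0 < \<delta> \<Longrightarrow> \<exists>\<gamma>>0. \<forall>y\<in>Y. \<forall>z\<in>Y. \<bar>s y - s z\<bar> < \<gamma> \<longrightarrow> dist y z < \<delta>"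
    using compact_real_code[OF Y ne] by metis
  let ?K = "closure (s ` Y)"
  obtain q where qc: "continuous_on ?K q" and qY: "q ` ?K \<subseteq> Y" and qs: "\<And>y. y \<in> Y \<Longrightarrow> q (s y) = y"
    using real_code_inverse[OF Y s] by metis
  have sms: "s \<in> borel_measurable (\<nu>s n)" for n
    using sm prob_measuresD(2)[OF \<nu>s] by (simp cong: measurable_cong_sets)
  define \<mu> where "\<mu> n = distr (\<nu>s n) borel s" for n
  have rd: "real_distribution (\<mu> n)" for n
    unfolding \<mu>_def by (rule prob_space.real_distribution_distr[OF prob_measuresD(1)[OF \<nu>s] sms])
  have "tight \<mu>"
    unfolding tight_def
  proof (intro conjI allI impI rd)
    fix \<epsilon> :: real assume "0 < \<epsilon>"
    have "measure (\<mu> n) {- 1<..1} = 1" for n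
    proof -
      interpret P: prob_space "\<nu>s n" by (rule prob_measuresD[OF \<nu>s])
      have "s y \<in> {- 1<..1}" for y using s01[of y] by simp
      then have "s -` {- 1<..1} \<inter> space (\<nu>s n) = space (\<nu>s n)" by blast
      then show ?thesis unfolding \<mu>_def by (subst measure_distr[OF sms]) (simp_all add: P.prob_space)
    qed
    then show "\<exists>a b. a < b \<and> (\<forall>n. 1 - \<epsilon> < measure (\<mu> n) {a<..b})"
      using \<open>0 < \<epsilon>\<close> by (intro exI[of _ "- 1"] exI[of _ 1]) simp
  qed
  from tight_imp_convergent_subsubsequence[OF this strict_mono_id]
  obtain r M where r: "strict_mono (r :: nat \<Rightarrow> nat)" and M: "real_distribution M" and conv: "weak_conv_m (\<mu> \<circ> r) M"
    by (auto simp: comp_def)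
  interpret M: real_distribution M by (rule M)
  have lim: "(\<lambda>n. \<integral>x. f x \<partial>\<mu> (r n)) \<longlonglongrightarrow> (\<integral>x. f x \<partial>M)"
    if "continuous_on UNIV f" "\<And>x. norm (f x) \<le> B" for f :: "real \<Rightarrow> real" and B
    using weak_conv_imp_integral_bdd_continuous_conv[of "\<mu> \<circ> r" M f B] rd M conv that
    by (simp add: comp_def continuous_on_eq_continuous_at)
  have int\<mu>: "(\<integral>x. f x \<partial>\<mu> n) = (\<integral>y. f (s y) \<partial>\<nu>s n)" if "continuous_on UNIV f" for f :: "real \<Rightarrow> real" and n
    unfolding \<mu>_def using that by (intro integral_distr sms borel_measurable_continuous_onI)
  \<comment> \<open>The truncated distance to \<open>?K\<close> has integral \<open>0\<close> for every image measure, hence also for the limit.\<close>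
  have ae: "AE t in M. t \<in> ?K"
  proof -
    let ?f = "\<lambda>t. min 1 (infdist t ?K)"
    have c: "continuous_on UNIV ?f" by (intro continuous_intros)
    have "(\<integral>x. ?f x \<partial>\<mu> n) = 0" for n
    proof -
      have "?f (s y) = 0" if "y \<in> space (\<nu>s n)" for y
      proof -
        have "y \<in> Y" using that prob_measuresD(3)[OF \<nu>s] by simp
        then have "s y \<in> ?K" using closure_subset[of "s ` Y"] by blast
        then have "infdist (s y) ?K = 0" by (rule infdist_zero)
        then show ?thesis by (simp only: min.absorb2[OF zero_le_one])
      qed
      then have "(\<integral>y. ?f (s y) \<partial>\<nu>s n) = (\<integral>y. 0 \<partial>\<nu>s n)"
        by (intro Bochner_Integration.integral_cong refl)
      then show ?thesis unfolding int\<mu>[OF c] by simp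
    qed
    then have "(\<lambda>n. 0) \<longlonglongrightarrow> (\<integral>x. ?f x \<partial>M)" using lim[OF c, of 1] by (simp add: infdist_nonneg)
    then have "(\<integral>x. ?f x \<partial>M) = 0" by (simp add: LIMSEQ_const_iff)
    moreover have fM: "?f \<in> borel_measurable M"
      using borel_measurable_continuous_onI[OF c] by simp
    moreover have "integrable M ?f"
      by (rule M.integrable_const_bound[OF _ fM, of 1]) (simp add: infdist_nonneg)
    ultimately have "AE t in M. ?f t = 0"
      using integral_nonneg_eq_0_iff_AE[of M ?f] by (simp add: infdist_nonneg)
    then show ?thesis
    proof eventually_elim
      case (elim t)
      then have "infdist t ?K = 0" by (auto simp: min_def split: if_splits)
      then show ?case using in_closed_iff_infdist_zero[of ?K t] ne by simp
    qed
  qed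
  obtain y0 where y0: "y0 \<in> Y" using ne by auto
  define q' where "q' t = (if t \<in> ?K then q t else y0)" for t
  have q'm: "q' \<in> measurable M (restrict_space borel Y)"
  proof (rule measurable_restrict_space2)
    show "q' \<in> space M \<rightarrow> Y" using subsetD[OF qY imageI] y0 by (simp add: q'_def)
    have "q' \<in> borel_measurable borel"
      unfolding q'_def[abs_def]
    proof (rule measurable_If_restrict_space_iff[THEN iffD2], rule_tac [2] conjI)
      show "{x \<in> space borel. x \<in> ?K} \<in> sets borel" by simp
      show "q \<in> borel_measurable (restrict_space borel {x. x \<in> ?K})"
        using borel_measurable_continuous_on_restrict[OF qc] by simp
    qed simp
    then show "q' \<in> borel_measurable M" by simp
  qed
  define \<nu> where "\<nu> = distr M (restrict_space borel Y) q'"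
  have \<nu>: "\<nu> \<in> prob_measures Y"
    unfolding prob_measures_def \<nu>_def using M.prob_space_distr[OF q'm] by simp
  have "weakly_converges Y (\<nu>s \<circ> r) \<nu>"
    unfolding weakly_converges_def
  proof (intro allI impI)
    fix f :: "'b \<Rightarrow> real" assume f: "continuous_on Y f"
    have fq: "continuous_on ?K (\<lambda>t. f (q t))"
      using continuous_on_compose2[OF f qc qY] .
    obtain B where B: "\<And>y. y \<in> Y \<Longrightarrow> norm (f y) \<le> B"
      using compact_imp_bounded[OF compact_continuous_image[OF f Y]] by (auto simp: bounded_iff)
    have B0: "0 \<le> B" by (rule order_trans[OF norm_ge_zero B[OF y0]])
    \<comment> \<open>Weak convergence on the line needs a function that is continuous and bounded everywhere.\<close>
    obtain h where h: "continuous_on UNIV h" "\<And>t. t \<in> ?K \<Longrightarrow> h t = f (q t)" "\<And>t. norm (h t) \<le> B"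
    proof (rule Tietze[OF fq _ B0, of UNIV])
      show "norm (f (q t)) \<le> B" if "t \<in> ?K" for t using that by (intro B subsetD[OF qY imageI])
    qed auto
    have "(\<integral>x. h x \<partial>\<mu> (r n)) = (\<integral>y. f y \<partial>(\<nu>s \<circ> r) n)" for n
    proof -
      have "h (s y) = f y" if "y \<in> space (\<nu>s (r n))" for y
      proof -
        have "y \<in> Y" using that prob_measuresD(3)[OF \<nu>s] by simp
        moreover from this have "s y \<in> ?K" using closure_subset[of "s ` Y"] by blast
        ultimately show ?thesis by (simp add: h(2) qs)
      qed
      then show ?thesis unfolding int\<mu>[OF h(1)] comp_def
        by (intro Bochner_Integration.integral_cong refl)
    qed
    moreover have "(\<integral>x. h x \<partial>M) = (\<integral>y. f y \<partial>\<nu>)"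
    proof -
      have fm: "f \<in> borel_measurable (restrict_space borel Y)"
        by (rule borel_measurable_continuous_on_restrict[OF f])
      have "(\<integral>y. f y \<partial>\<nu>) = (\<integral>t. f (q' t) \<partial>M)"
        unfolding \<nu>_def by (rule integral_distr[OF q'm fm])
      also have "\<dots> = (\<integral>t. h t \<partial>M)"
      proof (rule integral_cong_AE)
        show "AE t in M. f (q' t) = h t"
          using ae by eventually_elim (simp add: q'_def h(2))
        show "(\<lambda>t. f (q' t)) \<in> borel_measurable M" using measurable_compose[OF q'm fm] .
        show "h \<in> borel_measurable M" using borel_measurable_continuous_onI[OF h(1)] by simp
      qed
      finally show ?thesis by simp
    qed
    ultimately show "(\<lambda>n. \<integral>x. f x \<partial>(\<nu>s \<circ> r) n) \<longlonglongrightarrow> (\<integral>x. f x \<partial>\<nu>)"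
      using lim[OF h(1,3)] by simp
  qed
  with r \<nu> show thesis by (rule that)
qed

section \<open>A strictly convex upper semicontinuous functional\<close>

lemma sets_restrict_space_open:
  fixes Y :: "'b::metric_space set"
  assumes "closed Y"
  shows "sets (restrict_space borel Y) = sigma_sets Y {U \<inter> Y |U. open U}"
proof -
  have "Y \<in> sigma_sets UNIV (Collect open)"
    using assms by (metis borel_closed sets_borel)
  have "sets (restrict_space borel Y) = (\<inter>) Y ` sigma_sets UNIV (Collect open)"
    unfolding sets_restrict_space sets_borel ..
  also have "\<dots> = sigma_sets Y ((\<inter>) Y ` Collect open)"
    by (rule sigma_sets_Int) (use \<open>Y \<in> _\<close> in auto)
  also have "(\<inter>) Y ` Collect open = {U \<inter> Y |U. open U}" by auto
  finally show ?thesis .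
qed

text \<open>Countably many closed sets determine a measure: the finite intersections of the balls of
  \<open>compact_ball_sequence\<close> are stable under intersection and generate the Borel sets.\<close>

lemma compact_determining_sequence:
  fixes Y :: "'b::metric_space set"
  assumes Y: "compact Y"
  obtains D :: "nat \<Rightarrow> 'b set" where "\<And>k. closed (D k)"
    and "\<And>\<mu> \<nu>. \<mu> \<in> prob_measures Y \<Longrightarrow> \<nu> \<in> prob_measures Y \<Longrightarrow>
      \<forall>k. measure \<mu> (D k \<inter> Y) = measure \<nu> (D k \<inter> Y) \<Longrightarrow> \<mu> = \<nu>"
proof (cases "Y = {}")
  case True
  have none: "prob_measures Y = {}"
    using True prob_space.not_empty prob_measuresD by blast
  show thesis by (rule that[of "\<lambda>_. {}"]) (simp_all add: none)
next
  case False
  obtain C :: "nat \<Rightarrow> 'b set" where C: "\<And>m. closed (C m)"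
    and fine: "\<And>y e. y \<in> Y \<Longrightarrow> 0 < e \<Longrightarrow> \<exists>m. y \<in> C m \<and> C m \<subseteq> ball y e"
    using compact_ball_sequence[OF Y False] by metis
  let ?F = "Collect finite :: nat set set"
  define e where "e = from_nat_into ?F"
  have rng: "range e = ?F" unfolding e_def by (rule range_from_nat_into) (auto simp: countable_Collect_finite)
  define D where "D k = (\<Inter>i\<in>e k. C i)" for k
  define \<E> where "\<E> = range (\<lambda>k. D k \<inter> Y)"
  have mem: "(\<Inter>i\<in>J. C i) \<inter> Y \<in> \<E>" if "finite J" for J
  proof -
    have "J \<in> range e" unfolding rng using that by simp
    then obtain k where "J = e k" by auto
    then show ?thesis unfolding \<E>_def D_def by (intro range_eqI[of _ _ k]) simp
  qed
  have stable: "Int_stable \<E>"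
    unfolding Int_stable_def
  proof (intro ballI)
    fix A B assume "A \<in> \<E>" "B \<in> \<E>"
    then obtain k l where "A = (\<Inter>i\<in>e k. C i) \<inter> Y" "B = (\<Inter>i\<in>e l. C i) \<inter> Y"
      unfolding \<E>_def D_def by auto
    then have "A \<inter> B = (\<Inter>i\<in>e k \<union> e l. C i) \<inter> Y" by auto
    moreover have "finite (e k \<union> e l)" using rng by auto
    ultimately show "A \<inter> B \<in> \<E>" using mem by simp
  qed
  have closedD: "closed (D k)" for k unfolding D_def using C by auto
  have gen: "sets (restrict_space borel Y) = sigma_sets Y \<E>"
    unfolding sets_restrict_space_open[OF compact_imp_closed[OF Y]]
  proof (rule sigma_sets_eqI)
    fix A assume "A \<in> {U \<inter> Y |U. open U}"
    then obtain U where U: "A = U \<inter> Y" "open U" by auto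
    have "A = (\<Union>m\<in>{m. C m \<subseteq> U}. C m \<inter> Y)"
    proof (intro equalityI subsetI)
      fix y assume "y \<in> A"
      then have y: "y \<in> U" "y \<in> Y" using U by auto
      then obtain r where r: "0 < r" "ball y r \<subseteq> U" using U(2) open_contains_ball by blast
      then obtain m where "y \<in> C m" "C m \<subseteq> ball y r" using fine y by blast
      then show "y \<in> (\<Union>m\<in>{m. C m \<subseteq> U}. C m \<inter> Y)" using y r by blast
    qed (use U in auto)
    also have "\<dots> \<in> sigma_sets Y \<E>"
    proof (rule sigma_sets_UNION)
      show "countable ((\<lambda>m. C m \<inter> Y) ` {m. C m \<subseteq> U})" by simp
      fix B assume "B \<in> (\<lambda>m. C m \<inter> Y) ` {m. C m \<subseteq> U}"
      then obtain m where "B = C m \<inter> Y" by auto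
      then have "B \<in> \<E>" using mem[of "{m}"] by simp
      then show "B \<in> sigma_sets Y \<E>" by auto
    qed
    finally show "A \<in> sigma_sets Y \<E>" .
  next
    fix A assume "A \<in> \<E>"
    then obtain k where "A = D k \<inter> Y" by (auto simp: \<E>_def)
    then have "A \<in> sets (restrict_space borel Y)"
      using closedD[of k] unfolding sets_restrict_space
      by (intro image_eqI[of _ _ "D k"]) (simp_all add: Int_commute)
    then show "A \<in> sigma_sets Y {U \<inter> Y |U. open U}"
      unfolding sets_restrict_space_open[OF compact_imp_closed[OF Y]] .
  qed
  show thesis
  proof (rule that[of D])
    fix \<mu> \<nu> assume "\<mu> \<in> prob_measures Y" "\<nu> \<in> prob_measures Y"
      "\<forall>k. measure \<mu> (D k \<inter> Y) = measure \<nu> (D k \<inter> Y)"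
    then show "\<mu> = \<nu>"
      by (intro prob_measures_eqI[OF _ _ stable _ gen]) (auto simp: \<E>_def)
  qed (rule closedD)
qed

text \<open>A weighted sum of the squared masses of countably many sets. It is upper semicontinuous if the sets
  are closed, and strictly convex if they determine the measure.\<close>

definition square_mass :: "(nat \<Rightarrow> 'b set) \<Rightarrow> 'b set \<Rightarrow> 'b measure \<Rightarrow> real" where
  "square_mass D Y \<nu> = (\<Sum>k. (1 / 2) ^ Suc k * (measure \<nu> (D k \<inter> Y))\<^sup>2)"

lemma square_mass_summable:
  assumes "\<nu> \<in> prob_measures Y"
  shows "summable (\<lambda>k. (1 / 2) ^ Suc k * (measure \<nu> (D k \<inter> Y))\<^sup>2 :: real)"
proof -
  interpret prob_space \<nu> using assms by (rule prob_measuresD)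
  have "norm ((1 / 2) ^ Suc k * (measure \<nu> (D k \<inter> Y))\<^sup>2) \<le> (1 / 2) ^ Suc k" for k
    by (simp add: mult_left_le power_le_one)
  then show ?thesis
    by (intro summable_comparison_test'[OF sums_summable[OF power_half_series], of 0]) 
qed

lemma square_mass_bounds:
  assumes "\<nu> \<in> prob_measures Y"
  shows "square_mass D Y \<nu> \<in> {0..1}"
proof -
  interpret prob_space \<nu> using assms by (rule prob_measuresD)
  have "square_mass D Y \<nu> \<le> (\<Sum>k. (1 / 2) ^ Suc k)"
    unfolding square_mass_def
    by (rule suminf_le[OF _ square_mass_summable[OF assms] sums_summable[OF power_half_series]])
       (simp add: mult_left_le power_le_one)
  also have "\<dots> = 1" using sums_unique[OF power_half_series] by simp
  finally show ?thesis
    using suminf_nonneg[OF square_mass_summable[OF assms, of D]] by (simp add: square_mass_def)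
qed

lemma square_mass_strict_convex:
  assumes \<mu>: "\<mu> \<in> prob_measures Y" and \<nu>: "\<nu> \<in> prob_measures Y"
    and t: "0 < t" "t < 1" and closed: "\<And>k. closed (D k)"
    and neq: "measure \<mu> (D k \<inter> Y) \<noteq> measure \<nu> (D k \<inter> Y)"
  shows "square_mass D Y (mix_measure t \<mu> \<nu>) < (1 - t) * square_mass D Y \<mu> + t * square_mass D Y \<nu>"
proof -
  let ?a = "\<lambda>k. measure \<mu> (D k \<inter> Y)" and ?b = "\<lambda>k. measure \<nu> (D k \<inter> Y)"
  have R: "mix_measure t \<mu> \<nu> \<in> prob_measures Y"
    using t by (intro mix_measure_in_prob_measures[OF \<mu> \<nu>]) auto
  have mix: "measure (mix_measure t \<mu> \<nu>) (D k \<inter> Y) = (1 - t) * ?a k + t * ?b k" for k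
    using closed_Int_sets[OF \<mu> closed] prob_measuresD(1,2)[OF \<mu>] prob_measuresD(1,2)[OF \<nu>] t
    by (intro measure_mix_measure) auto
  note sa = square_mass_summable[OF \<mu>, of D] and sb = square_mass_summable[OF \<nu>, of D]
    and sr = square_mass_summable[OF R, of D]
  have sm: "summable (\<lambda>k. (1 - t) * ((1 / 2) ^ Suc k * (?a k)\<^sup>2) + t * ((1 / 2) ^ Suc k * (?b k)\<^sup>2))"
    by (intro summable_add summable_mult sa sb)
  \<comment> \<open>The convexity defect is a sum of nonnegative terms, one of which is positive.\<close>
  define d where "d k = (1 / 2) ^ Suc k * (t * (1 - t) * (?a k - ?b k)\<^sup>2)" for k
  have d: "(1 - t) * ((1 / 2) ^ Suc k * (?a k)\<^sup>2) + t * ((1 / 2) ^ Suc k * (?b k)\<^sup>2)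
      - (1 / 2) ^ Suc k * ((1 - t) * ?a k + t * ?b k)\<^sup>2 = d k" for k
  proof -
    have "(1 - t) * (w * a\<^sup>2) + t * (w * b\<^sup>2) - w * ((1 - t) * a + t * b)\<^sup>2 = w * (t * (1 - t) * (a - b)\<^sup>2)"
      for w a b :: real by (simp add: power2_eq_square algebra_simps)
    then show ?thesis unfolding d_def .
  qed
  have "(1 - t) * square_mass D Y \<mu> + t * square_mass D Y \<nu>
      = (\<Sum>k. (1 - t) * ((1 / 2) ^ Suc k * (?a k)\<^sup>2) + t * ((1 / 2) ^ Suc k * (?b k)\<^sup>2))"
    unfolding square_mass_def
    by (simp only: suminf_add[symmetric] suminf_mult[OF sa, symmetric] suminf_mult[OF sb, symmetric] summable_mult sa sb)
  moreover have "square_mass D Y (mix_measure t \<mu> \<nu>) = (\<Sum>k. (1 / 2) ^ Suc k * ((1 - t) * ?a k + t * ?b k)\<^sup>2)"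
    unfolding square_mass_def mix ..
  ultimately have "(1 - t) * square_mass D Y \<mu> + t * square_mass D Y \<nu> - square_mass D Y (mix_measure t \<mu> \<nu>) = suminf d"
    using suminf_diff[OF sm sr[unfolded mix]] by (simp only: d)
  moreover have "0 < suminf d"
  proof (rule suminf_pos2)
    show "summable d" using summable_diff[OF sm sr[unfolded mix]] by (simp only: d)
    show "0 \<le> d n" for n using t by (simp add: d_def)
    show "0 < d k" using t neq by (simp add: d_def)
  qed
  ultimately show ?thesis by linarith
qed

lemma square_mass_usc:
  fixes Y :: "'b::metric_space set"
  assumes Y: "compact Y" and \<nu>s: "\<And>n. \<nu>s n \<in> prob_measures Y" and \<nu>: "\<nu> \<in> prob_measures Y"
    and conv: "weakly_converges Y \<nu>s \<nu>" and closed: "\<And>k. closed (D k)" and e: "0 < e"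
  shows "eventually (\<lambda>n. square_mass D Y (\<nu>s n) < square_mass D Y \<nu> + e) sequentially"
proof -
  let ?x = "\<lambda>\<nu> k. measure \<nu> (D k \<inter> Y)"
  obtain N where N: "(1 / 2 :: real) ^ N < e / 2"
    using real_arch_pow_inv[of "e / 2" "1 / 2"] e by auto
  have tail: "(\<lambda>k. (1 / 2 :: real) ^ Suc (k + N)) sums ((1 / 2) ^ N)"
    using sums_mult[OF power_half_series, of "(1 / 2) ^ N"] by (simp add: power_add mult_ac)
  have split: "square_mass D Y \<rho> = (\<Sum>k. (1 / 2) ^ Suc (k + N) * (?x \<rho> (k + N))\<^sup>2) + (\<Sum>k<N. (1 / 2) ^ Suc k * (?x \<rho> k)\<^sup>2)"
    if "\<rho> \<in> prob_measures Y" for \<rho>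
    unfolding square_mass_def by (rule suminf_split_initial_segment[OF square_mass_summable[OF that]])
  have le: "square_mass D Y \<rho> \<le> (1 / 2) ^ N + (\<Sum>k<N. (1 / 2) ^ Suc k * (?x \<rho> k)\<^sup>2)"
    if \<rho>: "\<rho> \<in> prob_measures Y" for \<rho>
  proof -
    interpret prob_space \<rho> using \<rho> by (rule prob_measuresD)
    have "(\<Sum>k. (1 / 2) ^ Suc (k + N) * (?x \<rho> (k + N))\<^sup>2) \<le> (\<Sum>k. (1 / 2) ^ Suc (k + N))"
      using square_mass_summable[OF \<rho>, of D, THEN summable_ignore_initial_segment, of N] sums_summable[OF tail]
      by (intro suminf_le) (auto simp: mult_left_le power_le_one)
    then show ?thesis using split[OF \<rho>] sums_unique[OF tail] by simp
  qed
  have ge: "(\<Sum>k<N. (1 / 2) ^ Suc k * (?x \<nu> k)\<^sup>2) \<le> square_mass D Y \<nu>"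
    unfolding square_mass_def by (rule sum_le_suminf[OF square_mass_summable[OF \<nu>]]) auto
  have "eventually (\<lambda>n. \<forall>k\<in>{..<N}. (?x (\<nu>s n) k)\<^sup>2 \<le> (?x \<nu> k)\<^sup>2 + e / 2) sequentially"
  proof (rule eventually_ball_finite, simp, intro ballI)
    fix k
    define b where "b = sqrt ((?x \<nu> k)\<^sup>2 + e / 2)"
    have "?x \<nu> k < b" unfolding b_def using e by (intro real_less_rsqrt) simp
    then have "eventually (\<lambda>n. ?x (\<nu>s n) k < b) sequentially"
      by (rule weakly_converges_closed[OF Y \<nu>s \<nu> conv closed])
    then show "eventually (\<lambda>n. (?x (\<nu>s n) k)\<^sup>2 \<le> (?x \<nu> k)\<^sup>2 + e / 2) sequentially"
    proof eventually_elim
      case (elim n)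
      then have "(?x (\<nu>s n) k)\<^sup>2 \<le> b\<^sup>2" by (intro power_mono) auto
      then show ?case using e by (simp add: b_def)
    qed
  qed
  then show ?thesis
  proof eventually_elim
    case (elim n)
    have "(\<Sum>k<N. (1 / 2) ^ Suc k * (?x (\<nu>s n) k)\<^sup>2) \<le> (\<Sum>k<N. (1 / 2) ^ Suc k * (?x \<nu> k)\<^sup>2 + (1 / 2) ^ Suc k * (e / 2))"
      unfolding distrib_left[symmetric] using elim by (intro sum_mono mult_left_mono) auto
    also have "\<dots> = (\<Sum>k<N. (1 / 2) ^ Suc k * (?x \<nu> k)\<^sup>2) + (\<Sum>k<N. (1 / 2) ^ Suc k) * (e / 2)"
      by (simp only: sum.distrib sum_distrib_right)
    also have "(\<Sum>k<N. (1 / 2 :: real) ^ Suc k) \<le> 1"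
      using sum_le_suminf[OF sums_summable[OF power_half_series], of "{..<N}"] sums_unique[OF power_half_series] by simp
    finally have "(\<Sum>k<N. (1 / 2) ^ Suc k * (?x (\<nu>s n) k)\<^sup>2) \<le> (\<Sum>k<N. (1 / 2) ^ Suc k * (?x \<nu> k)\<^sup>2) + e / 2"
      using e by simp
    then show ?case using le[OF \<nu>s, of n] ge N by linarith
  qed
qed

section \<open>Invariant measures and weak limits\<close>

lemma invariant_measuresD:
  assumes "\<nu> \<in> invariant_measures Y S"
  shows "\<nu> \<in> prob_measures Y" "distr \<nu> (restrict_space borel Y) S = \<nu>"
  using assms by (auto simp: invariant_measures_def)

lemma continuous_self_map_measurable:
  assumes "continuous_on Y S" "S \<in> Y \<rightarrow> Y" "\<nu> \<in> prob_measures Y"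
  shows "S \<in> measurable \<nu> (restrict_space borel Y)" "S \<in> measurable \<nu> \<nu>"
proof -
  have "S \<in> restrict_space borel Y \<rightarrow>\<^sub>M restrict_space borel Y"
    using borel_measurable_continuous_on_restrict[OF assms(1)] assms(2)
    by (intro measurable_restrict_space2) (auto simp: space_restrict_space)
  then show "S \<in> measurable \<nu> (restrict_space borel Y)" "S \<in> measurable \<nu> \<nu>"
    using prob_measuresD(2)[OF assms(3)] by (simp_all cong: measurable_cong_sets)
qed

lemma measure_preserving_invariant:
  assumes S: "continuous_on Y S" "S \<in> Y \<rightarrow> Y" and \<nu>: "\<nu> \<in> invariant_measures Y S"
  shows "measure_preserving \<nu> S"
proof -
  note \<nu>D = invariant_measuresD[OF \<nu>]
  interpret prob_space \<nu> by (rule prob_measuresD[OF \<nu>D(1)])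
  show ?thesis
  proof
    show "S \<in> measurable \<nu> \<nu>" by (rule continuous_self_map_measurable[OF S \<nu>D(1)])
    have "distr \<nu> \<nu> S = distr \<nu> (restrict_space borel Y) S"
      by (rule distr_cong) (simp_all add: prob_measuresD(2)[OF \<nu>D(1)])
    then show "distr \<nu> \<nu> S = \<nu>" using \<nu>D(2) by simp
  qed
qed

lemma weak_limit_invariant:
  fixes Y :: "'b::metric_space set"
  assumes Y: "compact Y" and S: "continuous_on Y S" "S \<in> Y \<rightarrow> Y"
    and \<nu>s: "\<And>n. \<nu>s n \<in> invariant_measures Y S" and \<nu>: "\<nu> \<in> prob_measures Y"
    and conv: "weakly_converges Y \<nu>s \<nu>"
  shows "\<nu> \<in> invariant_measures Y S"
proof -
  note \<nu>sD = invariant_measuresD[OF \<nu>s]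
  have SS: "S ` Y \<subseteq> Y" using S(2) by auto
  note Sm = continuous_self_map_measurable(1)[OF S]
  have D: "distr \<nu> (restrict_space borel Y) S \<in> prob_measures Y"
    unfolding prob_measures_def using prob_space.prob_space_distr[OF prob_measuresD(1)[OF \<nu>] Sm[OF \<nu>]] by simp
  have "distr \<nu> (restrict_space borel Y) S = \<nu>"
  proof (rule prob_measures_eqI_continuous[OF Y D \<nu>])
    fix f :: "'b \<Rightarrow> real" assume f: "continuous_on Y f"
    have fS: "continuous_on Y (\<lambda>x. f (S x))" by (rule continuous_on_compose2[OF f S(1) SS])
    have push: "(\<integral>x. f x \<partial>distr \<rho> (restrict_space borel Y) S) = (\<integral>x. f (S x) \<partial>\<rho>)"
      if "\<rho> \<in> prob_measures Y" for \<rho>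
      by (rule integral_distr[OF Sm[OF that] borel_measurable_continuous_on_restrict[OF f]])
    have "(\<lambda>n. \<integral>x. f (S x) \<partial>\<nu>s n) \<longlonglongrightarrow> (\<integral>x. f (S x) \<partial>\<nu>)"
      using conv fS unfolding weakly_converges_def by blast
    moreover have "(\<integral>x. f (S x) \<partial>\<nu>s n) = (\<integral>x. f x \<partial>\<nu>s n)" for n
      using push[OF \<nu>sD(1), of n] \<nu>sD(2)[of n] by simp
    moreover have "(\<lambda>n. \<integral>x. f x \<partial>\<nu>s n) \<longlonglongrightarrow> (\<integral>x. f x \<partial>\<nu>)"
      using conv f unfolding weakly_converges_def by blast
    ultimately have "(\<integral>x. f (S x) \<partial>\<nu>) = (\<integral>x. f x \<partial>\<nu>)" by (simp add: LIMSEQ_unique)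
    then show "(\<integral>x. f x \<partial>distr \<nu> (restrict_space borel Y) S) = (\<integral>x. f x \<partial>\<nu>)"
      by (simp add: push[OF \<nu>])
  qed
  then show ?thesis using \<nu> by (simp add: invariant_measures_def)
qed

text \<open>If \<open>g\<close> is locally constant on \<open>Y\<close> off a closed null set of the limit measure, then its fibres are
  continuity sets. Adding the null set to a preimage under \<open>g\<close> makes it closed in \<open>Y\<close>, which gives an
  upper bound for a fibre and for its complement.\<close>

lemma weakly_converges_locally_constant:
  fixes Y :: "'b::metric_space set"
  assumes Y: "compact Y" and \<nu>s: "\<And>n. \<nu>s n \<in> prob_measures Y" and \<nu>: "\<nu> \<in> prob_measures Y"
    and conv: "weakly_converges Y \<nu>s \<nu>"
    and g: "\<And>V. g -` V \<inter> Y \<in> sets (restrict_space borel Y)"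
    and Z: "closed Z" "measure \<nu> (Z \<inter> Y) = 0"
    and loc: "\<And>x. x \<in> Y \<Longrightarrow> x \<notin> Z \<Longrightarrow> \<exists>U. open U \<and> x \<in> U \<and> (\<forall>y\<in>U \<inter> Y. g y = g x)"
  shows "(\<lambda>n. measure (\<nu>s n) (g -` {v} \<inter> Y)) \<longlonglongrightarrow> measure \<nu> (g -` {v} \<inter> Y)"
proof -
  have upper: "eventually (\<lambda>n. measure (\<nu>s n) (g -` V \<inter> Y) < measure \<nu> (g -` V \<inter> Y) + e) sequentially"
    if e: "0 < e" for e V
  proof -
    let ?A = "g -` V \<inter> Y" and ?F = "(g -` V \<inter> Y) \<union> (Z \<inter> Y)"
    have A: "?A \<in> sets \<rho>" and ZY: "Z \<inter> Y \<in> sets \<rho>" if "\<rho> \<in> prob_measures Y" for \<rho>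
      using g[of V] closed_Int_sets[OF that Z(1)] prob_measuresD(2)[OF that] by simp_all
    have "closed ?F"
    proof -
      have "open (- ?F)"
      proof (rule open_subopen[THEN iffD2], intro ballI)
        fix x assume x: "x \<in> - ?F"
        show "\<exists>T. open T \<and> x \<in> T \<and> T \<subseteq> - ?F"
        proof (cases "x \<in> Y")
          case False
          then show ?thesis
            using compact_imp_closed[OF Y] by (intro exI[of _ "- Y"]) (auto simp: open_Compl)
        next
          case True
          with x have "x \<notin> Z" by auto
          then obtain U where U: "open U" "x \<in> U" "\<forall>y\<in>U \<inter> Y. g y = g x" using loc True by blast
          have "y \<notin> ?F" if "y \<in> U - Z" for y
          proof
            assume "y \<in> ?F"
            with that have "y \<in> U \<inter> Y" "g y \<in> V" by auto
            then have "g x \<in> V" using U(3) by simp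
            then show False using x True by simp
          qed
          then show ?thesis using U Z(1) \<open>x \<notin> Z\<close>
            by (intro exI[of _ "U - Z"]) (auto intro: open_Diff)
        qed
      qed
      then show ?thesis by (simp add: closed_def)
    qed
    have FY: "?F \<inter> Y = ?F" by auto
    have "measure \<nu> ?F \<le> measure \<nu> ?A + measure \<nu> (Z \<inter> Y)"
      using A[OF \<nu>] ZY[OF \<nu>] by (rule measure_Un_le)
    then have "measure \<nu> (?F \<inter> Y) < measure \<nu> ?A + e" using Z(2) e FY by simp
    then have "eventually (\<lambda>n. measure (\<nu>s n) (?F \<inter> Y) < measure \<nu> ?A + e) sequentially"
      by (rule weakly_converges_closed[OF Y \<nu>s \<nu> conv \<open>closed ?F\<close>])
    then show ?thesis
    proof eventually_elim
      case (elim n)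
      interpret prob_space "\<nu>s n" by (rule prob_measuresD[OF \<nu>s])
      have "measure (\<nu>s n) ?A \<le> measure (\<nu>s n) ?F"
        using A[OF \<nu>s] ZY[OF \<nu>s] by (intro finite_measure_mono) auto
      then show ?case using elim FY by simp
    qed
  qed
  show ?thesis
  proof (rule LIMSEQ_I)
    fix e :: real assume e: "0 < e"
    have compl: "measure \<rho> (g -` (- {v}) \<inter> Y) = 1 - measure \<rho> (g -` {v} \<inter> Y)" if "\<rho> \<in> prob_measures Y" for \<rho>
    proof -
      interpret prob_space \<rho> using that by (rule prob_measuresD)
      have "g -` (- {v}) \<inter> Y = space \<rho> - (g -` {v} \<inter> Y)" using prob_measuresD(3)[OF that] by auto
      then show ?thesis
        using prob_compl[of "g -` {v} \<inter> Y"] g[of "{v}"] prob_measuresD(2,3)[OF that]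
        by simp
    qed
    have "eventually (\<lambda>n. norm (measure (\<nu>s n) (g -` {v} \<inter> Y) - measure \<nu> (g -` {v} \<inter> Y)) < e) sequentially"
      using upper[OF e, of "{v}"] upper[OF e, of "- {v}"]
      by eventually_elim (simp add: compl[OF \<nu>s] compl[OF \<nu>] abs_less_iff)
    then show "\<exists>no. \<forall>n\<ge>no. norm (measure (\<nu>s n) (g -` {v} \<inter> Y) - measure \<nu> (g -` {v} \<inter> Y)) < e"
      by (simp add: eventually_sequentially)
  qed
qed

text \<open>A simple function is generating if the diameters of the fibres of its itineraries tend to \<open>0\<close>.
  A closed set is the decreasing intersection of the unions \<open>D m\<close> of the fibres that meet it, and the
  approximable sets form a sigma-algebra.\<close>

lemma generating_if_mesh:
  fixes Y :: "'b::metric_space set"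
  assumes Y: "compact Y" and \<nu>: "\<nu> \<in> prob_measures Y" and mp: "measure_preserving \<nu> S"
    and c: "simple_function \<nu> c"
    and mesh: "\<And>\<delta>. 0 < \<delta> \<Longrightarrow> \<exists>m. \<forall>x\<in>Y. \<forall>y\<in>Y. itinerary S c m x = itinerary S c m y \<longrightarrow> dist x y < \<delta>"
  shows "measure_preserving.generating \<nu> S c"
proof -
  interpret measure_preserving \<nu> S by (rule mp)
  have sp: "space \<nu> = Y" by (rule prob_measuresD(3)[OF \<nu>])
  let ?B = "\<lambda>m W. itinerary S c m -` W \<inter> Y"
  have B: "?B m W \<in> sets \<nu>" for m W
    using simple_functionD(2)[OF simple_function_itinerary[OF c]] sp by simp
  let ?good = "\<lambda>A. \<forall>e>0. \<exists>m W. measure \<nu> (sym_diff A (?B m W)) < e"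
  have "?good A" if "A \<in> sigma_sets Y {C \<inter> Y |C. closed C}" for A
    using that
  proof (induction rule: sigma_sets.induct)
    case (Basic A)
    then obtain F where F: "A = F \<inter> Y" "closed F" by auto
    have A: "A \<in> sets \<nu>" unfolding F by (rule closed_Int_sets[OF \<nu> F(2)])
    define D where "D m = ?B m (itinerary S c m ` A)" for m
    have AD: "A \<subseteq> D m" for m using F by (auto simp: D_def)
    have dec: "decseq D"
    proof (rule decseq_SucI, rule subsetI)
      fix m x assume "x \<in> D (Suc m)"
      then obtain a where "a \<in> A" "itinerary S c (Suc m) x = itinerary S c (Suc m) a" "x \<in> Y"
        by (auto simp: D_def)
      then show "x \<in> D m" by (auto simp: D_def itinerary_def)
    qed
    have "(\<Inter>m. D m) \<subseteq> A"
    proof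
      fix x assume x: "x \<in> (\<Inter>m. D m)"
      then have xY: "x \<in> Y" by (auto simp: D_def)
      have "\<exists>a\<in>F. dist a x < \<delta>" if \<delta>: "0 < \<delta>" for \<delta>
      proof -
        obtain m where m: "\<forall>x\<in>Y. \<forall>y\<in>Y. itinerary S c m x = itinerary S c m y \<longrightarrow> dist x y < \<delta>"
          using mesh[OF \<delta>] by blast
        have "x \<in> D m" using x by auto
        then obtain a where "a \<in> A" "itinerary S c m a = itinerary S c m x" by (force simp: D_def)
        then show ?thesis using m xY F by auto
      qed
      then have "x \<in> closure F" by (simp add: closure_approachable)
      then show "x \<in> A" using F xY by (simp add: closure_closed)
    qed
    with AD have "(\<Inter>m. D m) = A" by blast
    moreover have "range D \<subseteq> sets \<nu>" using B by (auto simp: D_def)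
    ultimately have lim: "(\<lambda>m. measure \<nu> (D m)) \<longlonglongrightarrow> measure \<nu> A"
      using finite_Lim_measure_decseq[OF _ dec] by simp
    show ?case
    proof (intro allI impI)
      fix e :: real assume "0 < e"
      then have "eventually (\<lambda>m. measure \<nu> (D m) < measure \<nu> A + e) sequentially"
        by (intro order_tendstoD(2)[OF lim]) simp
      then obtain m where m: "measure \<nu> (D m) < measure \<nu> A + e" by (auto simp: eventually_sequentially)
      have "sym_diff A (D m) = D m - A" using AD by auto
      then have "measure \<nu> (sym_diff A (D m)) = measure \<nu> (D m) - measure \<nu> A"
        using finite_measure_Diff[of "D m" A] A B AD by (simp add: D_def)
      with m show "\<exists>m W. measure \<nu> (sym_diff A (?B m W)) < e" unfolding D_def
        by (intro exI[of _ m] exI[of _ "itinerary S c m ` A"]) simp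
    qed
  next
    case Empty
    have "sym_diff {} (?B 0 {}) = {}" by auto
    then show ?case by (metis measure_empty)
  next
    case (Compl A)
    have "sym_diff (Y - A) (?B m (- W)) = sym_diff A (?B m W)" if "A \<subseteq> Y" for m W
      using that by auto
    moreover have "A \<subseteq> Y" using Compl.hyps by (rule sigma_sets_into_sp[rotated]) auto
    ultimately show ?case using Compl.IH by metis
  next
    case (Union A)
    have sets_A: "A i \<in> sets \<nu>" for i
      using Union.hyps[of i] unfolding prob_measuresD(2)[OF \<nu>] sets_restrict_space_closed[OF compact_imp_closed[OF Y]] .
    show ?case
    proof (intro allI impI)
      fix e :: real assume e: "0 < e"
      have "(\<lambda>n. measure \<nu> (\<Union>i<n. A i)) \<longlonglongrightarrow> measure \<nu> (\<Union>n. \<Union>i<n. A i)"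
        by (rule finite_Lim_measure_incseq) (use sets_A in \<open>auto simp: incseq_def intro: less_le_trans\<close>)
      also have "(\<Union>n. \<Union>i<n. A i) = (\<Union>i. A i)" by blast
      finally have "eventually (\<lambda>n. measure \<nu> (\<Union>i. A i) - e / 2 < measure \<nu> (\<Union>i<n. A i)) sequentially"
        by (rule order_tendstoD(1)) (use e in simp)
      then obtain n where n: "measure \<nu> (\<Union>i. A i) - e / 2 < measure \<nu> (\<Union>i<n. A i)"
        by (auto simp: eventually_sequentially)
      define e' where "e' = e / (2 * real (Suc n))"
      have e': "0 < e'" using e by (simp add: e'_def)
      then have "\<forall>i. \<exists>m W. measure \<nu> (sym_diff (A i) (?B m W)) < e'" using Union.IH by blast
      then obtain m0 W0 where W0: "\<And>i. measure \<nu> (sym_diff (A i) (?B (m0 i) (W0 i))) < e'" by metis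
      define m where "m = Max (m0 ` {..n})"
      have mm: "m0 i \<le> m" if "i \<le> n" for i unfolding m_def using that by auto
      have "\<forall>i\<in>{..n}. \<exists>W'. ?B (m0 i) (W0 i) = ?B m W'"
        by (intro ballI itinerary_refine[unfolded sp] mm) simp
      then obtain W where "\<And>i. i \<le> n \<Longrightarrow> ?B (m0 i) (W0 i) = ?B m (W i)" by (metis atMost_iff)
      with W0 have W: "measure \<nu> (sym_diff (A i) (?B m (W i))) < e'" if "i \<le> n" for i using that by metis
      \<comment> \<open>Truncate the union after \<open>n\<close> sets and approximate these by fibres of itineraries of common length.\<close>
      let ?U = "\<Union>i. A i" and ?V = "\<Union>i<n. A i"
      have "sym_diff ?U (?B m (\<Union>i<n. W i)) \<subseteq> (?U - ?V) \<union> (\<Union>i<n. sym_diff (A i) (?B m (W i)))"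
        by blast
      then have "measure \<nu> (sym_diff ?U (?B m (\<Union>i<n. W i))) \<le> measure \<nu> ((?U - ?V) \<union> (\<Union>i<n. sym_diff (A i) (?B m (W i))))"
        using sets_A B by (intro finite_measure_mono) auto
      also have "\<dots> \<le> measure \<nu> (?U - ?V) + measure \<nu> (\<Union>i<n. sym_diff (A i) (?B m (W i)))"
        using sets_A B by (intro measure_Un_le) auto
      also have "measure \<nu> (?U - ?V) = measure \<nu> ?U - measure \<nu> ?V"
        using sets_A by (intro finite_measure_Diff) auto
      also have "measure \<nu> (\<Union>i<n. sym_diff (A i) (?B m (W i))) \<le> (\<Sum>i<n. measure \<nu> (sym_diff (A i) (?B m (W i))))"
        using sets_A B by (intro finite_measure_subadditive_finite) auto
      also have "\<dots> \<le> (\<Sum>i<n. e')" using W by (intro sum_mono) (simp add: less_imp_le)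
      also have "\<dots> \<le> e / 2" using e by (simp add: e'_def field_simps)
      finally have "measure \<nu> (sym_diff ?U (?B m (\<Union>i<n. W i))) < e" using n by linarith
      then show "\<exists>m W. measure \<nu> (sym_diff ?U (?B m W)) < e" by blast
    qed
  qed
  then show ?thesis
    unfolding generating_def sp prob_measuresD(2)[OF \<nu>] sets_restrict_space_closed[OF compact_imp_closed[OF Y]]
    using c by blast
qed

section \<open>The orbit space and its cell partitions\<close>

lemma compact_orbit_space:
  fixes X :: "'a::metric_space set"
  assumes X: "compact X" and T: "correspondence X T"
  shows "compact (orbit_space X T)"
proof -
  have "compactin (product_topology (\<lambda>_. euclidean) UNIV) (PiE UNIV (\<lambda>_::nat. X))"
    using X by (simp add: compactin_PiE)
  then have K: "compact (PiE UNIV (\<lambda>_::nat. X))"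
    by (simp add: euclidean_product_topology)
  have "closedin (top_of_set (X \<times> X)) (graph_of X T)" using T by (simp add: correspondence_def)
  then have G: "closed (graph_of X T)"
    using closedin_compact[OF compact_Times[OF X X]] compact_imp_closed by blast
  have "closed ((\<lambda>x :: nat \<Rightarrow> 'a. (x j, x (Suc j))) -` graph_of X T)" for j
    by (intro closed_vimage G continuous_on_Pair continuous_on_product_coordinates)
  then have "closed (\<Inter>j. (\<lambda>x :: nat \<Rightarrow> 'a. (x j, x (Suc j))) -` graph_of X T)" by blast
  moreover have "orbit_space X T = PiE UNIV (\<lambda>_. X) \<inter> (\<Inter>j. (\<lambda>x. (x j, x (Suc j))) -` graph_of X T)"
    by (auto simp: orbit_space_def graph_of_def PiE_UNIV_domain)
  ultimately show ?thesis using compact_Int_closed[OF K] by simp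
qed

lemma orbit_shift_funpow: "(orbit_shift ^^ i) x j = x (i + j)"
  by (induction i arbitrary: j) (simp_all add: orbit_shift_def)

lemma orbit_shift_self_map: "orbit_shift \<in> orbit_space X T \<rightarrow> orbit_space X T"
  by (simp add: orbit_shift_in_orbit_space)

text \<open>A finite cover of \<open>X\<close> by the open balls with centres \<open>p i\<close> and radii \<open>r i\<close>, for \<open>i < k\<close>, each of
  diameter less than \<open>\<epsilon>\<close>.\<close>

definition fine_cover :: "'a::metric_space set \<Rightarrow> real \<Rightarrow> (nat \<Rightarrow> 'a) \<Rightarrow> (nat \<Rightarrow> real) \<Rightarrow> nat \<Rightarrow> bool" where
  "fine_cover X \<epsilon> p r k \<longleftrightarrow> (\<forall>x\<in>X. \<exists>i<k. dist (p i) x < r i) \<and> (\<forall>i<k. r i < \<epsilon> / 2)"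

text \<open>The index of the first ball that contains \<open>x\<close>, or \<open>k\<close> if there is none. The implication makes
  the condition hold vacuously at \<open>k\<close>, so that the least index always exists.\<close>

definition cell :: "(nat \<Rightarrow> 'a::metric_space) \<Rightarrow> (nat \<Rightarrow> real) \<Rightarrow> nat \<Rightarrow> 'a \<Rightarrow> nat" where
  "cell p r k x = (LEAST i. i < k \<longrightarrow> dist (p i) x < r i)"

text \<open>The cell of the initial point of an orbit.\<close>

definition orbit_cell :: "(nat \<Rightarrow> 'a::metric_space) \<Rightarrow> (nat \<Rightarrow> real) \<Rightarrow> nat \<Rightarrow> (nat \<Rightarrow> 'a) \<Rightarrow> nat" where
  "orbit_cell p r k x = cell p r k (x 0)"

lemma cell_le: "cell p r k x \<le> k"
  unfolding cell_def by (rule Least_le) simp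

lemma cell_dist:
  assumes "fine_cover X \<epsilon> p r k" "x \<in> X" "y \<in> X" "cell p r k x = cell p r k y"
  shows "dist x y < \<epsilon>"
proof -
  have c: "cell p r k z < k \<and> dist (p (cell p r k z)) z < r (cell p r k z)" if z: "z \<in> X" for z
  proof -
    obtain i where "i < k" "dist (p i) z < r i" using assms(1) z unfolding fine_cover_def by blast
    then have "cell p r k z \<le> i" unfolding cell_def by (intro Least_le) simp
    moreover have "cell p r k z < k \<longrightarrow> dist (p (cell p r k z)) z < r (cell p r k z)"
      unfolding cell_def by (rule LeastI[of _ k]) simp
    ultimately show ?thesis using \<open>i < k\<close> by simp
  qed
  have "dist x y \<le> dist (p (cell p r k x)) x + dist (p (cell p r k x)) y" by metric
  also have "\<dots> < \<epsilon>" using c[OF assms(2)] c[OF assms(3)] assms(1,4) unfolding fine_cover_def by fastforce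
  finally show ?thesis .
qed

lemma simple_function_orbit_cell:
  fixes X :: "'a::metric_space set"
  assumes X: "compact X" "correspondence X T" and \<nu>: "\<nu> \<in> prob_measures (orbit_space X T)"
  shows "simple_function \<nu> (orbit_cell p r k)"
proof -
  have "orbit_cell p r k ` space \<nu> \<subseteq> {..k}" by (auto simp: orbit_cell_def cell_le)
  then have fin: "finite (orbit_cell p r k ` space \<nu>)" by (rule finite_subset) simp
  have [measurable]: "(\<lambda>x. dist (p i) (x 0)) \<in> borel_measurable \<nu>" for i
    by (rule prob_measures_continuous(1)[OF compact_orbit_space[OF X] \<nu>])
       (intro continuous_intros continuous_on_subset[OF continuous_on_product_coordinates subset_UNIV])
  have "orbit_cell p r k \<in> measurable \<nu> (count_space UNIV)"
    unfolding orbit_cell_def[abs_def] cell_def by measurable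
  then have "orbit_cell p r k -` {v} \<inter> space \<nu> \<in> sets \<nu>" for v by (rule measurable_sets) simp
  then show ?thesis using fin by (simp add: simple_function_def)
qed

lemma itinerary_orbit_cell:
  "itinerary orbit_shift (orbit_cell p r k) n x = map (\<lambda>i. cell p r k (x i)) [0..<n]"
  by (simp add: itinerary_def orbit_cell_def orbit_shift_funpow)

text \<open>Uniform expansiveness. If it failed, two limit orbits would be distinct and yet stay within
  \<open>\<epsilon>\<close> of each other for all time.\<close>

lemma orbit_cell_mesh:
  fixes X :: "'a::metric_space set"
  assumes X: "compact X" and T: "correspondence X T"
    and exp: "\<And>x y. x \<in> orbit_space X T \<Longrightarrow> y \<in> orbit_space X T \<Longrightarrow> x \<noteq> y \<Longrightarrow> \<exists>j. dist (x j) (y j) > \<epsilon>"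
    and cover: "fine_cover X \<epsilon> p r k" and \<delta>: "0 < \<delta>"
  shows "\<exists>m. \<forall>x\<in>orbit_space X T. \<forall>y\<in>orbit_space X T.
    itinerary orbit_shift (orbit_cell p r k) m x = itinerary orbit_shift (orbit_cell p r k) m y \<longrightarrow> dist x y < \<delta>"
proof (rule ccontr)
  let ?\<Omega> = "orbit_space X T" and ?I = "itinerary orbit_shift (orbit_cell p r k)"
  assume "\<not> ?thesis"
  then have "\<forall>m. \<exists>x y. x \<in> ?\<Omega> \<and> y \<in> ?\<Omega> \<and> ?I m x = ?I m y \<and> \<delta> \<le> dist x y" by (meson not_le)
  then obtain x y where xy: "\<And>m. x m \<in> ?\<Omega>" "\<And>m. y m \<in> ?\<Omega>" "\<And>m. ?I m (x m) = ?I m (y m)"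
    "\<And>m. \<delta> \<le> dist (x m) (y m)" by metis
  have sc: "seq_compact ?\<Omega>" using compact_orbit_space[OF X T] by (simp add: compact_eq_seq_compact_metric)
  obtain a f where a: "a \<in> ?\<Omega>" "strict_mono (f :: nat \<Rightarrow> nat)" "(x \<circ> f) \<longlonglongrightarrow> a"
    using sc xy(1) unfolding seq_compact_def by metis
  have "\<forall>n. (y \<circ> f) n \<in> ?\<Omega>" using xy(2) by simp
  then obtain b g where b: "b \<in> ?\<Omega>" "strict_mono (g :: nat \<Rightarrow> nat)" "((y \<circ> f) \<circ> g) \<longlonglongrightarrow> b"
    using sc unfolding seq_compact_def by metis
  define h where "h = f \<circ> g"
  have h: "n \<le> h n" for n
    unfolding h_def by (rule seq_suble[OF strict_mono_o[OF a(2) b(2)]])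
  have xa: "(\<lambda>n. x (h n)) \<longlonglongrightarrow> a" using LIMSEQ_subseq_LIMSEQ[OF a(3) b(2)] by (simp add: h_def comp_def)
  have yb: "(\<lambda>n. y (h n)) \<longlonglongrightarrow> b" using b(3) by (simp add: h_def comp_def)
  have "\<delta> \<le> dist a b"
    by (rule tendsto_lowerbound[OF tendsto_dist[OF xa yb]]) (simp_all add: xy(4))
  then have "a \<noteq> b" using \<delta> by auto
  then obtain j where j: "dist (a j) (b j) > \<epsilon>" using exp a(1) b(1) by blast
  have coord: "(\<lambda>n. u n j) \<longlonglongrightarrow> c j" if "u \<longlonglongrightarrow> c" for u :: "nat \<Rightarrow> nat \<Rightarrow> 'a" and c
    by (rule continuous_on_tendsto_compose[OF continuous_on_product_coordinates that]) simp_all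
  have "eventually (\<lambda>n. dist (x (h n) j) (y (h n) j) \<le> \<epsilon>) sequentially"
    using eventually_gt_at_top[of j]
  proof eventually_elim
    case (elim n)
    then have "j < h n" using h[of n] by simp
    then have "cell p r k (x (h n) j) = cell p r k (y (h n) j)"
      using xy(3)[of "h n"] by (simp add: itinerary_orbit_cell)
    moreover have "x (h n) j \<in> X" "y (h n) j \<in> X" using xy(1,2) by (auto simp: orbit_space_def)
    ultimately show ?case using cell_dist[OF cover] by (simp add: less_imp_le)
  qed
  then have "dist (a j) (b j) \<le> \<epsilon>"
    by (intro tendsto_upperbound[OF tendsto_dist[OF coord[OF xa] coord[OF yb]]]) simp_all
  then show False using j by simp
qed

text \<open>Around each centre only countably many spheres have positive measure, so a radius between \<open>\<epsilon> / 4\<close>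
  and \<open>\<epsilon> / 2\<close> with a null sphere can be chosen. The centres form a finite \<open>\<epsilon> / 4\<close>-net, so the balls cover
  \<open>X\<close> whatever the choice.\<close>

lemma null_boundary_cover:
  fixes X :: "'a::metric_space set"
  assumes X: "compact X" and T: "correspondence X T" and \<nu>: "\<nu> \<in> prob_measures (orbit_space X T)" and \<epsilon>: "0 < \<epsilon>"
  obtains p r k where "fine_cover X \<epsilon> p r k"
    and "\<forall>i. measure \<nu> ({x. dist (p i) (x 0) = r i} \<inter> orbit_space X T) = 0"
proof -
  interpret prob_space \<nu> using \<nu> by (rule prob_measuresD)
  have sp: "space \<nu> = orbit_space X T" by (rule prob_measuresD(3)[OF \<nu>])
  have m: "(\<lambda>x. dist a (x 0)) \<in> borel_measurable \<nu>" for a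
    by (rule prob_measures_continuous(1)[OF compact_orbit_space[OF X T] \<nu>])
       (intro continuous_intros continuous_on_subset[OF continuous_on_product_coordinates subset_UNIV])
  have "\<exists>s. \<epsilon> / 4 < s \<and> s < \<epsilon> / 2 \<and> measure \<nu> ({x. dist a (x 0) = s} \<inter> orbit_space X T) = 0" for a
  proof -
    interpret D: prob_space "distr \<nu> borel (\<lambda>x. dist a (x 0))" by (rule prob_space_distr[OF m])
    have "\<not> {\<epsilon> / 4<..<\<epsilon> / 2} \<subseteq> {s. measure (distr \<nu> borel (\<lambda>x. dist a (x 0))) {s} \<noteq> 0}"
      using countable_subset[OF _ D.countable_support] uncountable_open_interval[of "\<epsilon> / 4" "\<epsilon> / 2"] \<epsilon> by auto
    then obtain s where s: "\<epsilon> / 4 < s" "s < \<epsilon> / 2" "measure (distr \<nu> borel (\<lambda>x. dist a (x 0))) {s} = 0" by auto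
    have "measure (distr \<nu> borel (\<lambda>x. dist a (x 0))) {s} = measure \<nu> ((\<lambda>x. dist a (x 0)) -` {s} \<inter> space \<nu>)"
      by (rule measure_distr[OF m]) simp
    also have "(\<lambda>x. dist a (x 0)) -` {s} \<inter> space \<nu> = {x. dist a (x 0) = s} \<inter> orbit_space X T"
      unfolding sp by auto
    finally show ?thesis using s by auto
  qed
  then obtain \<rho> where \<rho>: "\<And>a. \<epsilon> / 4 < \<rho> a" "\<And>a. \<rho> a < \<epsilon> / 2"
    "\<And>a. measure \<nu> ({x. dist a (x 0) = \<rho> a} \<inter> orbit_space X T) = 0" by metis
  obtain K where K: "finite K" "X \<subseteq> (\<Union>a\<in>K. ball a (\<epsilon> / 4))"
    using seq_compact_imp_totally_bounded[OF compact_imp_seq_compact[OF X], rule_format, of "\<epsilon> / 4"] \<epsilon> by auto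
  obtain p where p: "bij_betw p {0..<card K} K" using ex_bij_betw_nat_finite[OF K(1)] by blast
  show thesis
  proof (rule that[of p "\<lambda>i. \<rho> (p i)" "card K"])
    show "fine_cover X \<epsilon> p (\<lambda>i. \<rho> (p i)) (card K)"
      unfolding fine_cover_def
    proof (intro conjI ballI allI impI \<rho>)
      fix x assume "x \<in> X"
      then obtain a where a: "a \<in> K" "dist a x < \<epsilon> / 4" using K(2) by auto
      then obtain i where "i < card K" "p i = a" using p unfolding bij_betw_def by force
      then show "\<exists>i<card K. dist (p i) x < \<rho> (p i)" using a \<rho>(1)[of a] by (intro exI[of _ i]) auto
    qed
  qed (intro allI \<rho>(3))
qed

lemma orbit_measure_preserving:
  fixes X :: "'a::metric_space set"
  assumes "\<nu> \<in> invariant_measures (orbit_space X T) orbit_shift"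
  shows "measure_preserving \<nu> orbit_shift"
  by (rule measure_preserving_invariant[OF continuous_on_orbit_shift orbit_shift_self_map assms])

lemma KS_entropy_orbit_cell:
  fixes X :: "'a::metric_space set"
  assumes X: "compact X" and T: "correspondence X T"
    and exp: "\<And>x y. x \<in> orbit_space X T \<Longrightarrow> y \<in> orbit_space X T \<Longrightarrow> x \<noteq> y \<Longrightarrow> \<exists>j. dist (x j) (y j) > \<epsilon>"
    and cover: "fine_cover X \<epsilon> p r k" and \<nu>: "\<nu> \<in> invariant_measures (orbit_space X T) orbit_shift"
  shows "KS_entropy \<nu> orbit_shift = ereal (entropy_rate \<nu> orbit_shift (orbit_cell p r k))"
proof -
  note \<nu>' = invariant_measuresD(1)[OF \<nu>]
  show ?thesis
    by (rule measure_preserving.KS_entropy_generating[OF orbit_measure_preserving[OF \<nu>]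
        generating_if_mesh[OF compact_orbit_space[OF X T] \<nu>' orbit_measure_preserving[OF \<nu>]
          simple_function_orbit_cell[OF X T \<nu>'] orbit_cell_mesh[OF X T exp cover]]])
qed

text \<open>For a fixed length \<open>N\<close>, the entropies of the itineraries converge along the sequence, since the
  boundaries of their fibres are null by invariance. The rate is the infimum over \<open>N\<close>.\<close>

lemma entropy_rate_usc:
  fixes X :: "'a::metric_space set"
  assumes X: "compact X" and T: "correspondence X T"
    and \<nu>s: "\<And>n. \<nu>s n \<in> invariant_measures (orbit_space X T) orbit_shift"
    and \<nu>: "\<nu> \<in> invariant_measures (orbit_space X T) orbit_shift"
    and conv: "weakly_converges (orbit_space X T) \<nu>s \<nu>"
    and null: "\<And>i. measure \<nu> ({x. dist (p i) (x 0) = r i} \<inter> orbit_space X T) = 0" and e: "0 < e"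
  shows "eventually (\<lambda>n. entropy_rate (\<nu>s n) orbit_shift (orbit_cell p r k)
    < entropy_rate \<nu> orbit_shift (orbit_cell p r k) + e) sequentially"
proof -
  let ?\<Omega> = "orbit_space X T" and ?c = "orbit_cell p r k"
  note Y = compact_orbit_space[OF X T]
  note \<nu>P = invariant_measuresD(1)[OF \<nu>] and \<nu>sP = invariant_measuresD(1)[OF \<nu>s]
  interpret measure_preserving \<nu> orbit_shift by (rule orbit_measure_preserving[OF \<nu>])
  have sp: "space \<nu> = ?\<Omega>" by (rule prob_measuresD(3)[OF \<nu>P])
  note sf = simple_function_orbit_cell[OF X T]
  have "eventually (\<lambda>n. code_entropy \<nu> (itinerary orbit_shift ?c n) / real n < entropy_rate \<nu> orbit_shift ?c + e) sequentially"
    by (rule order_tendstoD(2)[OF entropy_rate_limit[OF sf[OF \<nu>P]]]) (use e in simp)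
  then have "eventually (\<lambda>n. code_entropy \<nu> (itinerary orbit_shift ?c n) / real n < entropy_rate \<nu> orbit_shift ?c + e \<and> 1 \<le> n) sequentially"
    using eventually_ge_at_top[of 1] by (rule eventually_conj)
  then obtain N where N: "code_entropy \<nu> (itinerary orbit_shift ?c N) / real N < entropy_rate \<nu> orbit_shift ?c + e" "1 \<le> N"
    by (auto simp: eventually_sequentially)
  let ?I = "itinerary orbit_shift ?c N"
  \<comment> \<open>The orbits that lie on one of the boundary spheres at some time before \<open>N\<close>.\<close>
  define Z where "Z = (\<Union>i<N. \<Union>j<k. {x :: nat \<Rightarrow> 'a. dist (p j) (x i) = r j})"
  have cont: "continuous_on UNIV (\<lambda>x :: nat \<Rightarrow> 'a. dist (p j) (x i))" for i j
    by (intro continuous_intros continuous_on_product_coordinates)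
  have "closed {x :: nat \<Rightarrow> 'a. dist (p j) (x i) = r j}" for i j
    by (intro closed_Collect_eq cont continuous_on_const)
  then have Zc: "closed Z" unfolding Z_def by (intro closed_UN) auto
  have sphere: "{x :: nat \<Rightarrow> 'a. dist (p j) (x i) = r j} \<inter> ?\<Omega> \<in> sets \<nu>" for i j
    by (intro closed_Int_sets[OF \<nu>P] closed_Collect_eq cont continuous_on_const)
  have null': "measure \<nu> ({x. dist (p j) (x i) = r j} \<inter> ?\<Omega>) = 0" for i j
  proof -
    have "(orbit_shift ^^ i) -` ({x. dist (p j) (x 0) = r j} \<inter> ?\<Omega>) \<inter> space \<nu> = {x. dist (p j) (x i) = r j} \<inter> ?\<Omega>"
      using funpow_space unfolding sp by (auto simp: orbit_shift_funpow)
    then show ?thesis using measure_pow_vimage[OF sphere[of j 0], of i] null by simp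
  qed
  have "Z \<inter> ?\<Omega> = (\<Union>(i, j)\<in>{..<N} \<times> {..<k}. {x. dist (p j) (x i) = r j} \<inter> ?\<Omega>)"
    by (auto simp: Z_def)
  also have "measure \<nu> \<dots> \<le> (\<Sum>(i, j)\<in>{..<N} \<times> {..<k}. measure \<nu> ({x. dist (p j) (x i) = r j} \<inter> ?\<Omega>))"
    using sphere finite_measure_subadditive_finite[of "{..<N} \<times> {..<k}" "\<lambda>(i, j). {x. dist (p j) (x i) = r j} \<inter> ?\<Omega>"]
    by (auto simp: case_prod_unfold)
  also have "\<dots> = 0" by (simp add: null')
  finally have Z0: "measure \<nu> (Z \<inter> ?\<Omega>) = 0" by (simp add: measure_le_0_iff)
  have loc: "\<exists>U. open U \<and> x \<in> U \<and> (\<forall>y\<in>U \<inter> ?\<Omega>. ?I y = ?I x)" if x: "x \<notin> Z" for x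
  proof -
    define U where "U = (\<Inter>i<N. \<Inter>j<k. if dist (p j) (x i) < r j
      then {y. dist (p j) (y i) < r j} else {y. r j < dist (p j) (y i)})"
    have "open U" unfolding U_def
      by (intro open_INT finite_lessThan ballI) (auto intro!: open_Collect_less cont continuous_on_const)
    moreover have "x \<in> U" using x by (auto simp: U_def Z_def less_le)
    moreover have "?I y = ?I x" if "y \<in> U" for y
    proof -
      have "dist (p j) (y i) < r j \<longleftrightarrow> dist (p j) (x i) < r j" if "i < N" "j < k" for i j
      proof -
        have "y \<in> (if dist (p j) (x i) < r j then {y. dist (p j) (y i) < r j} else {y. r j < dist (p j) (y i)})"
          using \<open>y \<in> U\<close> that unfolding U_def by blast
        then show ?thesis by (simp split: if_splits)
      qed
      then have "cell p r k (y i) = cell p r k (x i)" if "i < N" for i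
        unfolding cell_def using that by (intro arg_cong[where f = Least]) auto
      then show ?thesis by (simp add: itinerary_orbit_cell)
    qed
    ultimately show ?thesis by blast
  qed
  have sfI: "simple_function \<nu> ?I" by (rule simple_function_itinerary[OF sf[OF \<nu>P]])
  have I: "?I -` V \<inter> ?\<Omega> \<in> sets (restrict_space borel ?\<Omega>)" for V
    using simple_functionD(2)[OF sfI, of V] sp prob_measuresD(2)[OF \<nu>P] by simp
  have lim: "(\<lambda>n. measure (\<nu>s n) (?I -` {v} \<inter> ?\<Omega>)) \<longlonglongrightarrow> measure \<nu> (?I -` {v} \<inter> ?\<Omega>)" for v
    by (rule weakly_converges_locally_constant[OF Y \<nu>sP \<nu>P conv I Zc Z0 loc])
  have fin: "finite (?I ` ?\<Omega>)" using simple_functionD(1)[OF sfI] sp by simp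
  have CE: "code_entropy \<rho> ?I = - (\<Sum>v\<in>?I ` ?\<Omega>. measure \<rho> (?I -` {v} \<inter> ?\<Omega>) * ln (measure \<rho> (?I -` {v} \<inter> ?\<Omega>)))"
    if "\<rho> \<in> prob_measures ?\<Omega>" for \<rho>
    unfolding code_entropy_def prob_measuresD(3)[OF that] ..
  have "(\<lambda>n. code_entropy (\<nu>s n) ?I / real N) \<longlonglongrightarrow> code_entropy \<nu> ?I / real N"
    unfolding CE[OF \<nu>sP] CE[OF \<nu>P]
    by (intro tendsto_intros tendsto_xlnx lim measure_nonneg) (use N in simp)
  then have "eventually (\<lambda>n. code_entropy (\<nu>s n) ?I / real N < entropy_rate \<nu> orbit_shift ?c + e) sequentially"
    using N(1) by (rule order_tendstoD(2))
  then show ?thesis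
  proof eventually_elim
    case (elim n)
    then show ?case
      using measure_preserving.entropy_rate_le[OF orbit_measure_preserving[OF \<nu>s] N(2), of n ?c] by linarith
  qed
qed

section \<open>Maximisers and extreme points\<close>

lemma usc_attains_max_invariant:
  fixes Y :: "'b::metric_space set"
  assumes Y: "compact Y" and S: "continuous_on Y S" "S \<in> Y \<rightarrow> Y"
    and ne: "invariant_measures Y S \<noteq> {}"
    and usc: "\<And>\<nu>s \<nu> e. (\<And>n. \<nu>s n \<in> invariant_measures Y S) \<Longrightarrow> \<nu> \<in> invariant_measures Y S \<Longrightarrow>
      weakly_converges Y \<nu>s \<nu> \<Longrightarrow> 0 < e \<Longrightarrow> eventually (\<lambda>n. \<Phi> (\<nu>s n) < \<Phi> \<nu> + e) sequentially"
  obtains \<rho> where "\<rho> \<in> invariant_measures Y S" "\<And>\<mu>. \<mu> \<in> invariant_measures Y S \<Longrightarrow> \<Phi> \<mu> \<le> (\<Phi> \<rho> :: real)"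
proof -
  let ?M = "invariant_measures Y S"
  let ?A = "(\<lambda>\<mu>. ereal (\<Phi> \<mu>)) ` ?M"
  have "?A \<noteq> {}" using ne by simp
  from Sup_countable_SUP[OF this] obtain f :: "nat \<Rightarrow> ereal"
    where f: "incseq f" "range f \<subseteq> ?A" "Sup ?A = (SUP i. f i)" by auto
  have flim: "f \<longlonglongrightarrow> Sup ?A" unfolding f(3) by (rule LIMSEQ_SUP[OF f(1)])
  have "\<forall>n. \<exists>\<mu>\<in>?M. f n = ereal (\<Phi> \<mu>)" using f(2) by auto
  then obtain \<nu>s where \<nu>s: "\<And>n. \<nu>s n \<in> ?M" "\<And>n. f n = ereal (\<Phi> (\<nu>s n))" by metis
  obtain r \<rho> where r: "strict_mono (r :: nat \<Rightarrow> nat)" and \<rho>P: "\<rho> \<in> prob_measures Y" and conv: "weakly_converges Y (\<nu>s \<circ> r) \<rho>"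
    by (rule prob_measures_seq_compact[OF Y invariant_measuresD(1)[OF \<nu>s(1)]])
  have \<nu>sr: "(\<nu>s \<circ> r) n \<in> ?M" for n using \<nu>s by simp
  have \<rho>: "\<rho> \<in> ?M" by (rule weak_limit_invariant[OF Y S \<nu>sr \<rho>P conv])
  have le: "\<Phi> \<mu> \<le> \<Phi> \<rho>" if \<mu>: "\<mu> \<in> ?M" for \<mu>
  proof (rule field_le_epsilon)
    fix e :: real assume e: "0 < e"
    have ev: "eventually (\<lambda>n. f (r n) \<le> ereal (\<Phi> \<rho> + e)) sequentially"
      using usc[OF \<nu>sr \<rho> conv e] by eventually_elim (simp add: \<nu>s(2))
    have lim: "(\<lambda>n. f (r n)) \<longlonglongrightarrow> Sup ?A" using LIMSEQ_subseq_LIMSEQ[OF flim r] by (simp add: comp_def)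
    have "Sup ?A \<le> ereal (\<Phi> \<rho> + e)" by (rule tendsto_upperbound[OF lim ev sequentially_bot])
    moreover have "ereal (\<Phi> \<mu>) \<le> Sup ?A" using \<mu> by (intro Sup_upper) simp
    ultimately have "ereal (\<Phi> \<mu>) \<le> ereal (\<Phi> \<rho> + e)" by (rule order_trans[rotated])
    then show "\<Phi> \<mu> \<le> \<Phi> \<rho> + e" by simp
  qed
  show thesis using \<rho> le by (rule that)
qed

text \<open>Conditioning an invariant measure on an invariant set.\<close>

lemma uniform_measure_invariant:
  assumes S: "continuous_on Y S" "S \<in> Y \<rightarrow> Y" and \<rho>: "\<rho> \<in> invariant_measures Y S"
    and A: "A \<in> sets \<rho>" "S -` A \<inter> Y = A" "measure \<rho> A \<noteq> 0"
  shows "uniform_measure \<rho> A \<in> invariant_measures Y S"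
proof -
  note \<rho>P = invariant_measuresD(1)[OF \<rho>]
  interpret measure_preserving \<rho> S by (rule measure_preserving_invariant[OF S \<rho>])
  have sp: "space \<rho> = Y" by (rule prob_measuresD(3)[OF \<rho>P])
  have nz: "emeasure \<rho> A \<noteq> 0" using A(3) by (simp add: emeasure_eq_measure)
  let ?U = "uniform_measure \<rho> A"
  have ps: "prob_space ?U" by (rule prob_space_uniform_measure) (use nz in simp_all)
  have U: "?U \<in> prob_measures Y"
    using ps prob_measuresD(2)[OF \<rho>P] by (simp add: prob_measures_def)
  interpret U: prob_space ?U by (rule ps)
  note Sm = continuous_self_map_measurable(1)[OF S U]
  have "distr ?U (restrict_space borel Y) S = ?U"
  proof (rule measure_eqI)
    fix B assume "B \<in> sets (distr ?U (restrict_space borel Y) S)"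
    then have B: "B \<in> sets (restrict_space borel Y)" "B \<in> sets \<rho>" using prob_measuresD(2)[OF \<rho>P] by simp_all
    have SB: "S -` B \<inter> Y \<in> sets \<rho>" using measurable_sets[OF measurable_S B(2)] sp by simp
    have "A \<inter> (S -` B \<inter> Y) = (S ^^ 1) -` (A \<inter> B) \<inter> space \<rho>" unfolding sp using A(2) by auto
    then have "measure \<rho> (A \<inter> (S -` B \<inter> Y)) = measure \<rho> (A \<inter> B)"
      using measure_pow_vimage[of "A \<inter> B" 1] A(1) B(2) by (simp only: sets.Int)
    then have "emeasure \<rho> (A \<inter> (S -` B \<inter> Y)) = emeasure \<rho> (A \<inter> B)" by (simp add: emeasure_eq_measure)
    then show "emeasure (distr ?U (restrict_space borel Y) S) B = emeasure ?U B"
      using emeasure_distr[OF Sm B(1)] A(1) B(2) SB by (simp add: sp)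
  qed (simp add: prob_measuresD(2)[OF \<rho>P])
  then show ?thesis using U by (simp add: invariant_measures_def)
qed

text \<open>If \<open>A\<close> were an invariant set of measure strictly between \<open>0\<close> and \<open>1\<close>, then \<open>\<rho>\<close> would be a proper
  mixture of its conditional measures on \<open>A\<close> and on the complement of \<open>A\<close>.\<close>

lemma extreme_imp_ergodic:
  assumes S: "continuous_on Y S" "S \<in> Y \<rightarrow> Y" and \<rho>: "\<rho> \<in> invariant_measures Y S"
    and extreme: "\<And>\<mu> \<nu> t. \<mu> \<in> invariant_measures Y S \<Longrightarrow> \<nu> \<in> invariant_measures Y S \<Longrightarrow> 0 < t \<Longrightarrow> t < 1 \<Longrightarrow>
      \<rho> = mix_measure t \<mu> \<nu> \<Longrightarrow> \<mu> = \<nu>"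
  shows "\<rho> \<in> ergodic_measures Y S"
proof -
  note \<rho>P = invariant_measuresD(1)[OF \<rho>]
  interpret prob_space \<rho> by (rule prob_measuresD[OF \<rho>P])
  have sp: "space \<rho> = Y" by (rule prob_measuresD(3)[OF \<rho>P])
  have "measure \<rho> A = 0 \<or> measure \<rho> A = 1" if A: "A \<in> sets \<rho>" "S -` A \<inter> Y = A" for A
  proof (rule ccontr)
    assume *: "\<not> ?thesis"
    let ?B = "Y - A"
    have B: "?B \<in> sets \<rho>" using A(1) sp by (metis sets.compl_sets)
    have SB: "S -` ?B \<inter> Y = ?B" using A(2) S(2) by auto
    have mB: "measure \<rho> ?B = 1 - measure \<rho> A" using prob_compl[OF A(1)] sp by simp
    have nz: "measure \<rho> A \<noteq> 0" "measure \<rho> ?B \<noteq> 0" using * mB by auto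
    let ?\<mu> = "uniform_measure \<rho> A" and ?\<nu> = "uniform_measure \<rho> ?B" and ?t = "measure \<rho> ?B"
    have t: "0 < ?t" "?t < 1" using nz mB zero_less_measure_iff[of \<rho> A] zero_less_measure_iff[of \<rho> ?B] by linarith+
    have \<mu>: "?\<mu> \<in> invariant_measures Y S" and \<nu>: "?\<nu> \<in> invariant_measures Y S"
      using uniform_measure_invariant[OF S \<rho>] A B SB nz by auto
    note M = prob_measuresD(1)[OF invariant_measuresD(1)[OF \<mu>]] prob_measuresD(1)[OF invariant_measuresD(1)[OF \<nu>]]
    interpret M: prob_space ?\<mu> by (rule M)
    interpret N: prob_space ?\<nu> by (rule M)
    have um: "measure (uniform_measure \<rho> D) C = measure \<rho> (D \<inter> C) / measure \<rho> D"
      if "measure \<rho> D \<noteq> 0" "C \<in> sets \<rho>" for C D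
      using that by (intro measure_uniform_measure) (simp_all add: emeasure_eq_measure)
    have "\<rho> = mix_measure ?t ?\<mu> ?\<nu>"
    proof (rule measure_eqI)
      fix C assume C: "C \<in> sets \<rho>"
      have R: "prob_space (mix_measure ?t ?\<mu> ?\<nu>)"
        by (rule prob_measuresD(1)[OF mix_measure_in_prob_measures[OF invariant_measuresD(1)[OF \<mu>] invariant_measuresD(1)[OF \<nu>]]])
           (use t in simp)
      interpret R: prob_space "mix_measure ?t ?\<mu> ?\<nu>" by (rule R)
      have "measure (mix_measure ?t ?\<mu> ?\<nu>) C = (1 - ?t) * measure ?\<mu> C + ?t * measure ?\<nu> C"
        by (rule measure_mix_measure[OF M]) (use t C in simp_all)
      also have "\<dots> = measure \<rho> (A \<inter> C) + measure \<rho> (?B \<inter> C)"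
        using nz mB by (simp add: um[OF nz(1) C] um[OF nz(2) C])
      also have "\<dots> = measure \<rho> ((A \<inter> C) \<union> (?B \<inter> C))"
        by (rule finite_measure_Union[symmetric]) (use A B C in auto)
      also have "(A \<inter> C) \<union> (?B \<inter> C) = C" using sets.sets_into_space[OF C] sp by auto
      finally show "emeasure \<rho> C = emeasure (mix_measure ?t ?\<mu> ?\<nu>) C"
        by (simp add: emeasure_eq_measure R.emeasure_eq_measure)
    qed simp
    then have eq: "?\<mu> = ?\<nu>" by (rule extreme[OF \<mu> \<nu> t])
    have "measure ?\<mu> A = 1" using um[OF nz(1) A(1)] nz by simp
    moreover have "?B \<inter> A = {}" by auto
    then have "measure ?\<nu> A = 0" using um[OF nz(2) A(1)] by simp
    ultimately show False using eq by simp
  qed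
  then show ?thesis using \<rho> by (auto simp: ergodic_measures_def)
qed

section \<open>The path energy\<close>

lemma pushforward_in_prob_measures:
  assumes g: "continuous_on Y g" "g \<in> Y \<rightarrow> Z" and \<nu>: "\<nu> \<in> prob_measures Y"
  shows "g \<in> measurable \<nu> (restrict_space borel Z)" "distr \<nu> (restrict_space borel Z) g \<in> prob_measures Z"
proof -
  have "g \<in> restrict_space borel Y \<rightarrow>\<^sub>M restrict_space borel Z"
    using borel_measurable_continuous_on_restrict[OF g(1)] g(2)
    by (intro measurable_restrict_space2) (auto simp: space_restrict_space)
  then show m: "g \<in> measurable \<nu> (restrict_space borel Z)"
    using prob_measuresD(2)[OF \<nu>] by (simp cong: measurable_cong_sets)
  show "distr \<nu> (restrict_space borel Z) g \<in> prob_measures Z"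
    using prob_space.prob_space_distr[OF prob_measuresD(1)[OF \<nu>] m] by (simp add: prob_measures_def)
qed

lemma continuous_map_pushforward:
  fixes Y :: "'b::metric_space set" and Z :: "'c::metric_space set"
  assumes g: "continuous_on Y g" "g \<in> Y \<rightarrow> Z"
  shows "continuous_map (weak_star Y) (weak_star Z) (\<lambda>\<nu>. distr \<nu> (restrict_space borel Z) g)" (is "continuous_map _ _ ?P")
proof -
  let ?B = "{{\<nu> \<in> prob_measures Z. (\<integral>x. f x \<partial>\<nu>) \<in> U} |f U. continuous_on Z (f :: 'c \<Rightarrow> real) \<and> open U}"
  have "continuous_map (weak_star Y) (topology_generated_by ?B) ?P"
  proof (rule continuous_on_generated_topo)
    fix V assume "V \<in> ?B"
    then obtain f U where V: "V = {\<nu> \<in> prob_measures Z. (\<integral>x. f x \<partial>\<nu>) \<in> U}"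
      and f: "continuous_on Z (f :: 'c \<Rightarrow> real)" "open U" by auto
    have fg: "continuous_on Y (\<lambda>x. f (g x))"
      using continuous_on_compose2[OF f(1) g(1)] g(2) by auto
    have "(\<integral>x. f x \<partial>?P \<nu>) = (\<integral>x. f (g x) \<partial>\<nu>)" if "\<nu> \<in> prob_measures Y" for \<nu>
      by (rule integral_distr[OF pushforward_in_prob_measures(1)[OF g that] borel_measurable_continuous_on_restrict[OF f(1)]])
    then have "?P -` V \<inter> topspace (weak_star Y) = {\<nu> \<in> prob_measures Y. (\<integral>x. f (g x) \<partial>\<nu>) \<in> U}"
      unfolding topspace_weak_star V using pushforward_in_prob_measures(2)[OF g] by auto
    moreover have "openin (weak_star Y) {\<nu> \<in> prob_measures Y. (\<integral>x. f (g x) \<partial>\<nu>) \<in> U}"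
      unfolding weak_star_def
    proof (rule topology_generated_by_Basis, rule CollectI, intro exI conjI)
      show "{\<nu> \<in> prob_measures Y. (\<integral>x. f (g x) \<partial>\<nu>) \<in> U} = {\<nu> \<in> prob_measures Y. (\<integral>x. (\<lambda>x. f (g x)) x \<partial>\<nu>) \<in> U}" ..
    qed (rule fg f(2))+
    ultimately show "openin (weak_star Y) (?P -` V \<inter> topspace (weak_star Y))" by simp
  next
    have "?P ` topspace (weak_star Y) \<subseteq> topspace (weak_star Z)"
      unfolding topspace_weak_star using pushforward_in_prob_measures(2)[OF g] by auto
    then show "?P ` topspace (weak_star Y) \<subseteq> \<Union> ?B"
      unfolding weak_star_def topology_generated_by_topspace .
  qed
  then show ?thesis unfolding weak_star_def[of Z] .
qed

lemma distr_mix_measure: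
  assumes sets: "sets \<nu> = sets \<mu>" and g: "g \<in> measurable \<mu> N"
  shows "distr (mix_measure t \<mu> \<nu>) N g = mix_measure t (distr \<mu> N g) (distr \<nu> N g)"
proof (rule measure_eqI)
  fix A assume "A \<in> sets (distr (mix_measure t \<mu> \<nu>) N g)"
  then have A: "A \<in> sets N" by simp
  have gN: "g \<in> measurable \<nu> N" using g sets by (simp cong: measurable_cong_sets)
  have gR: "g \<in> measurable (mix_measure t \<mu> \<nu>) N" using g by (simp cong: measurable_cong_sets)
  have pre: "g -` A \<inter> space \<mu> \<in> sets \<mu>" using g A by (rule measurable_sets)
  have sp: "space \<nu> = space \<mu>" using sets by (rule sets_eq_imp_space_eq)
  have "emeasure (distr (mix_measure t \<mu> \<nu>) N g) A = emeasure (mix_measure t \<mu> \<nu>) (g -` A \<inter> space \<mu>)"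
    using emeasure_distr[OF gR A] by simp
  also have "\<dots> = ennreal (1 - t) * emeasure \<mu> (g -` A \<inter> space \<mu>) + ennreal t * emeasure \<nu> (g -` A \<inter> space \<mu>)"
    by (rule emeasure_mix_measure[OF sets pre])
  also have "\<dots> = ennreal (1 - t) * emeasure (distr \<mu> N g) A + ennreal t * emeasure (distr \<nu> N g) A"
    by (simp add: emeasure_distr[OF g A] emeasure_distr[OF gN A] sp)
  also have "\<dots> = emeasure (mix_measure t (distr \<mu> N g) (distr \<nu> N g)) A"
    by (rule emeasure_mix_measure[symmetric]) (simp_all add: A)
  finally show "emeasure (distr (mix_measure t \<mu> \<nu>) N g) A = emeasure (mix_measure t (distr \<mu> N g) (distr \<nu> N g)) A" .
qed simp

lemma continuous_on_proj2: "continuous_on Y (proj2 :: (nat \<Rightarrow> 'a::metric_space) \<Rightarrow> 'a \<times> 'a)"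
  unfolding proj2_def
  by (intro continuous_on_Pair continuous_on_subset[OF continuous_on_product_coordinates subset_UNIV])

lemma proj2_graph: "proj2 \<in> orbit_space X T \<rightarrow> graph_of X T"
  by (force simp: proj2_def orbit_space_def graph_of_def)

lemma continuous_map_path_energy:
  assumes "continuous_map (weak_star (graph_of X T)) euclideanreal E"
  shows "continuous_map (weak_star (orbit_space X T)) euclideanreal (path_energy X T E)"
  using continuous_map_compose[OF continuous_map_pushforward[OF continuous_on_proj2 proj2_graph] assms]
  by (simp add: comp_def path_energy_def[abs_def])

lemma path_energy_convex:
  assumes E: "convex_on_measures (graph_of X T) E"
    and \<mu>: "\<mu> \<in> prob_measures (orbit_space X T)" and \<nu>: "\<nu> \<in> prob_measures (orbit_space X T)"
    and t: "t \<in> {0..1}"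
  shows "path_energy X T E (mix_measure t \<mu> \<nu>) \<le> (1 - t) * path_energy X T E \<mu> + t * path_energy X T E \<nu>"
proof -
  have "distr (mix_measure t \<mu> \<nu>) (restrict_space borel (graph_of X T)) proj2 =
    mix_measure t (distr \<mu> (restrict_space borel (graph_of X T)) proj2) (distr \<nu> (restrict_space borel (graph_of X T)) proj2)"
    by (rule distr_mix_measure[OF _ pushforward_in_prob_measures(1)[OF continuous_on_proj2 proj2_graph \<mu>]])
       (simp add: prob_measuresD(2)[OF \<mu>] prob_measuresD(2)[OF \<nu>])
  then show ?thesis
    using E t pushforward_proj2_in_prob_measures[OF \<mu>] pushforward_proj2_in_prob_measures[OF \<nu>]
    unfolding path_energy_def convex_on_measures_def by simp
qed

section \<open>Abundance of ergodic path measures\<close>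

lemma abundance_if_entropy_dense:
  assumes E: "continuous_map (weak_star (graph_of X T)) euclideanreal E"
    and dense: "entropy_dense (orbit_space X T) orbit_shift"
  shows "abundance_of_ergodic_path_measures X T E"
  unfolding abundance_of_ergodic_path_measures_def
proof (intro ballI allI impI)
  fix \<nu> and \<eta> :: real
  assume \<nu>: "\<nu> \<in> invariant_measures (orbit_space X T) orbit_shift" and \<eta>: "0 < \<eta>"
  let ?P = "path_energy X T E"
  define U where "U = {\<rho> \<in> topspace (weak_star (orbit_space X T)). ?P \<rho> \<in> {?P \<nu> - \<eta> / 2<..}}"
  have "openin (weak_star (orbit_space X T)) U"
    unfolding U_def by (rule openin_continuous_map_preimage[OF continuous_map_path_energy[OF E]]) simp
  moreover have "\<nu> \<in> U"
    using \<nu> \<eta> by (simp add: U_def topspace_weak_star invariant_measures_def)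
  ultimately obtain \<rho> where \<rho>: "\<rho> \<in> ergodic_measures (orbit_space X T) orbit_shift" "\<rho> \<in> U"
    "KS_entropy \<rho> orbit_shift > KS_entropy \<nu> orbit_shift - ereal (\<eta> / 2)"
    using dense \<nu> \<eta> unfolding entropy_dense_def by (meson half_gt_zero)
  have "?P \<rho> > ?P \<nu> - \<eta> / 2" using \<rho>(2) by (simp add: U_def)
  \<comment> \<open>If \<open>\<nu>\<close> had infinite entropy, the strict inequality in \<open>\<rho>(3)\<close> could not hold.\<close>
  with \<rho>(3) have "KS_entropy \<rho> orbit_shift + ereal (?P \<rho>) > KS_entropy \<nu> orbit_shift + ereal (?P \<nu>) - ereal \<eta>"
    by (cases "KS_entropy \<rho> orbit_shift"; cases "KS_entropy \<nu> orbit_shift") auto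
  with \<rho>(1) show "\<exists>\<rho>\<in>ergodic_measures (orbit_space X T) orbit_shift.
    KS_entropy \<nu> orbit_shift + ereal (?P \<nu>) - ereal \<eta> < KS_entropy \<rho> orbit_shift + ereal (?P \<rho>)" by blast
qed

lemma abundance_if_convex:
  fixes X :: "'a::metric_space set"
  assumes X: "compact X" and T: "correspondence X T" and exp: "forward_expansive X T"
    and E: "continuous_map (weak_star (graph_of X T)) euclideanreal E"
    and convex: "convex_on_measures (graph_of X T) E"
  shows "abundance_of_ergodic_path_measures X T E"
  unfolding abundance_of_ergodic_path_measures_def
proof (intro ballI allI impI)
  fix \<nu>0 and \<eta> :: real
  let ?\<Omega> = "orbit_space X T" and ?P = "path_energy X T E"
  let ?M = "invariant_measures ?\<Omega> orbit_shift"
  assume \<nu>0: "\<nu>0 \<in> ?M" and \<eta>: "0 < \<eta>"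
  note Y = compact_orbit_space[OF X T]
  note S = continuous_on_orbit_shift[of ?\<Omega>] orbit_shift_self_map[of X T]
  obtain \<epsilon> where \<epsilon>: "0 < \<epsilon>"
    and sep: "\<And>x y. x \<in> ?\<Omega> \<Longrightarrow> y \<in> ?\<Omega> \<Longrightarrow> x \<noteq> y \<Longrightarrow> \<exists>j. dist (x j) (y j) > \<epsilon>"
    using exp unfolding forward_expansive_def by blast
  obtain D :: "nat \<Rightarrow> (nat \<Rightarrow> 'a) set" where D: "\<And>k. closed (D k)"
    and det: "\<And>\<mu> \<nu>. \<mu> \<in> prob_measures ?\<Omega> \<Longrightarrow> \<nu> \<in> prob_measures ?\<Omega> \<Longrightarrow>
      \<forall>k. measure \<mu> (D k \<inter> ?\<Omega>) = measure \<nu> (D k \<inter> ?\<Omega>) \<Longrightarrow> \<mu> = \<nu>"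
    by (rule compact_determining_sequence[OF Y]) (rule that)
  define h where "h \<mu> = real_of_ereal (KS_entropy \<mu> orbit_shift)" for \<mu> :: "(nat \<Rightarrow> 'a) measure"
  have rate: "h \<mu> = entropy_rate \<mu> orbit_shift (orbit_cell p r k)"
    and KS: "KS_entropy \<mu> orbit_shift = ereal (h \<mu>)"
    if "fine_cover X \<epsilon> p r k" "\<mu> \<in> ?M" for \<mu> p r k
  proof -
    have *: "KS_entropy \<mu> orbit_shift = ereal (entropy_rate \<mu> orbit_shift (orbit_cell p r k))"
      by (rule KS_entropy_orbit_cell[OF X T sep that])
    show "h \<mu> = entropy_rate \<mu> orbit_shift (orbit_cell p r k)" unfolding h_def * by simp
    show "KS_entropy \<mu> orbit_shift = ereal (h \<mu>)" unfolding h_def * by simp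
  qed
  obtain p0 r0 k0 where cover0: "fine_cover X \<epsilon> p0 r0 k0"
    by (rule null_boundary_cover[OF X T invariant_measuresD(1)[OF \<nu>0] \<epsilon>]) (rule that)
  \<comment> \<open>The last term lies between \<open>0\<close> and \<open>\<eta> / 2\<close> and makes the functional strictly convex.\<close>
  define \<Phi> where "\<Phi> \<mu> = h \<mu> + ?P \<mu> + \<eta> / 2 * square_mass D ?\<Omega> \<mu>" for \<mu>
  have usc: "eventually (\<lambda>n. \<Phi> (\<nu>s n) < \<Phi> \<nu> + e) sequentially"
    if \<nu>s: "\<And>n. \<nu>s n \<in> ?M" and \<nu>: "\<nu> \<in> ?M" and conv: "weakly_converges ?\<Omega> \<nu>s \<nu>" and e: "0 < e" for \<nu>s \<nu> e
  proof -
    note \<nu>sP = invariant_measuresD(1)[OF \<nu>s] and \<nu>P = invariant_measuresD(1)[OF \<nu>]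
    obtain p r k where cover: "fine_cover X \<epsilon> p r k"
      and null: "\<forall>i. measure \<nu> ({x. dist (p i) (x 0) = r i} \<inter> ?\<Omega>) = 0"
      by (rule null_boundary_cover[OF X T \<nu>P \<epsilon>])
    have "eventually (\<lambda>n. h (\<nu>s n) < h \<nu> + e / 3) sequentially"
      unfolding rate[OF cover \<nu>s] rate[OF cover \<nu>]
      by (rule entropy_rate_usc[OF X T \<nu>s \<nu> conv null[rule_format]]) (use e in simp)
    moreover have "eventually (\<lambda>n. ?P (\<nu>s n) < ?P \<nu> + e / 3) sequentially"
      by (rule order_tendstoD(2)[OF weakly_converges_continuous_map[OF \<nu>sP \<nu>P conv continuous_map_path_energy[OF E]]])
         (use e in simp)
    moreover have "eventually (\<lambda>n. square_mass D ?\<Omega> (\<nu>s n) < square_mass D ?\<Omega> \<nu> + 2 * e / (3 * \<eta>)) sequentially"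
      by (rule square_mass_usc[OF Y \<nu>sP \<nu>P conv D]) (use e \<eta> in simp)
    ultimately show ?thesis
    proof eventually_elim
      case (elim n)
      have "\<eta> / 2 * square_mass D ?\<Omega> (\<nu>s n) < \<eta> / 2 * (square_mass D ?\<Omega> \<nu> + 2 * e / (3 * \<eta>))"
        using elim(3) \<eta> by (intro mult_strict_left_mono) auto
      also have "\<dots> = \<eta> / 2 * square_mass D ?\<Omega> \<nu> + e / 3" using \<eta> by (simp add: field_simps)
      finally show ?case using elim(1,2) unfolding \<Phi>_def by linarith
    qed
  qed
  obtain \<rho> where \<rho>: "\<rho> \<in> ?M" and max: "\<And>\<mu>. \<mu> \<in> ?M \<Longrightarrow> \<Phi> \<mu> \<le> \<Phi> \<rho>"
    by (rule usc_attains_max_invariant[OF Y S _ usc]) (use \<nu>0 in auto)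
  have "\<rho> \<in> ergodic_measures ?\<Omega> orbit_shift"
  proof (rule extreme_imp_ergodic[OF S \<rho>], rule ccontr)
    fix \<mu> \<nu> and t :: real
    assume \<mu>: "\<mu> \<in> ?M" and \<nu>: "\<nu> \<in> ?M" and t: "0 < t" "t < 1" and mix: "\<rho> = mix_measure t \<mu> \<nu>" and neq: "\<mu> \<noteq> \<nu>"
    note \<mu>P = invariant_measuresD(1)[OF \<mu>] and \<nu>P = invariant_measuresD(1)[OF \<nu>]
    have t01: "t \<in> {0..1}" using t by simp
    obtain k where "measure \<mu> (D k \<inter> ?\<Omega>) \<noteq> measure \<nu> (D k \<inter> ?\<Omega>)" using det[OF \<mu>P \<nu>P] neq by blast
    from square_mass_strict_convex[where D = D, OF \<mu>P \<nu>P t D this]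
    have "\<eta> / 2 * square_mass D ?\<Omega> \<rho> < \<eta> / 2 * ((1 - t) * square_mass D ?\<Omega> \<mu> + t * square_mass D ?\<Omega> \<nu>)"
      unfolding mix using \<eta> by (intro mult_strict_left_mono) auto
    moreover have "h \<rho> \<le> (1 - t) * h \<mu> + t * h \<nu>"
      unfolding mix rate[OF cover0 \<mu>] rate[OF cover0 \<nu>] rate[OF cover0 \<rho>[unfolded mix]]
      by (rule entropy_rate_mix[OF orbit_measure_preserving[OF \<mu>] orbit_measure_preserving[OF \<nu>]
            orbit_measure_preserving[OF \<rho>[unfolded mix]] _ t01 simple_function_orbit_cell[OF X T \<mu>P]])
         (simp add: prob_measuresD(2)[OF \<mu>P] prob_measuresD(2)[OF \<nu>P])
    moreover have "?P \<rho> \<le> (1 - t) * ?P \<mu> + t * ?P \<nu>"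
      unfolding mix by (rule path_energy_convex[OF convex \<mu>P \<nu>P t01])
    ultimately have "\<Phi> \<rho> < (1 - t) * \<Phi> \<mu> + t * \<Phi> \<nu>"
      unfolding \<Phi>_def by (simp add: algebra_simps diff_divide_distrib)
    also have "\<dots> \<le> (1 - t) * \<Phi> \<rho> + t * \<Phi> \<rho>"
      using t max[OF \<mu>] max[OF \<nu>] by (intro add_mono mult_left_mono) auto
    finally show False by (simp add: algebra_simps)
  qed
  moreover have "h \<nu>0 + ?P \<nu>0 - \<eta> < h \<rho> + ?P \<rho>"
  proof -
    have "\<eta> / 2 * square_mass D ?\<Omega> \<rho> \<le> \<eta> / 2 * 1" "0 \<le> \<eta> / 2 * square_mass D ?\<Omega> \<nu>0"
      using square_mass_bounds[OF invariant_measuresD(1)[OF \<rho>], of D]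
        square_mass_bounds[OF invariant_measuresD(1)[OF \<nu>0], of D] \<eta>
      by (auto intro!: mult_left_mono)
    then show ?thesis using max[OF \<nu>0] \<eta> unfolding \<Phi>_def by linarith
  qed
  ultimately show "\<exists>\<rho>\<in>ergodic_measures ?\<Omega> orbit_shift.
    KS_entropy \<nu>0 orbit_shift + ereal (?P \<nu>0) - ereal \<eta> < KS_entropy \<rho> orbit_shift + ereal (?P \<rho>)"
    by (intro bexI[of _ \<rho>]) (simp_all add: KS[OF cover0 \<nu>0] KS[OF cover0 \<rho>])
qed

theorem proposition4p2:
  fixes X :: "'a::metric_space set"
    and T :: "'a \<Rightarrow> 'a set"
    and E :: "('a \<times> 'a) measure \<Rightarrow> real"
  assumes "compact X"
    and "correspondence X T"
    and "forward_expansive X T"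
    and "continuous_map (weak_star (graph_of X T)) euclideanreal E"
  shows "(entropy_dense (orbit_space X T) orbit_shift \<longrightarrow> abundance_of_ergodic_path_measures X T E) \<and>
         (convex_on_measures (graph_of X T) E \<longrightarrow> abundance_of_ergodic_path_measures X T E)"
  using abundance_if_entropy_dense[OF assms(4)] abundance_if_convex[OF assms] by blast

end
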